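(* Let $\gamma \geq 1/2$. Then there exists a constant $L_\gamma$ such that for every rooted metric tree $\Gamma$ (as described in the context) and every real-valued potential $V$ on $\Gamma$, \[ \operatorname{tr} (-\Delta_\mathcal{N} - V)_-^\gamma \leq L_\gamma \int_{\Gamma} V(x)_+^{\gamma + \frac 12} \, dx . \] In particular, $L_\gamma$ does not depend on $\Gamma$.
   Context: A rooted metric tree $\Gamma$ with root $o$ consists of vertices and edges, each edge being a segment of the real line connecting two vertices; $|x|$ denotes the distance from $x\in\Gamma$ to the root. It is assumed that $\Gamma$ has infinite height ($\sup_{x\in\Gamma}|x|=\infty$), that the root has branching number $b(o)=1$ and that every vertex $x\neq o$ has branching number $b(x)>1$ (the branching number being the number of edges emanating from the vertex, away from the root). $H^1(\Gamma)$ is the space of continuous functions $\varphi$ on $\Gamma$ with $\varphi\in H^1(e)$ on every edge $e$ and $\int_\Gamma(|\varphi'|^2+|\varphi|^2)\,dx<\infty$. The Neumann Laplacian $-\Delta_\mathcal{N}$ is the self-adjoint operator in $L_2(\Gamma)$ associated with the closed quadratic form $\int_\Gamma|\varphi'(x)|^2dx$, $\varphi\in H^1(\Gamma)$ (Kirchhoff matching conditions at vertices, Neumann condition at the root). $V$ is real-valued and sufficiently regular, with positive part vanishing at infinity, so that the negative spectrum of $-\Delta_\mathcal{N}-V$ is discrete. For a self-adjoint lower bounded operator $T$, $\operatorname{tr} T_-^\gamma$ denotes the sum of $|\lambda|^\gamma$ over the negative eigenvalues $\lambda$ of $T$ counted with multiplicity; $x_\pm=\max\{0,\pm x\}$. 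*)

theory Defs
  imports "HOL-Analysis.Analysis"
begin

text \<open>
Encoding of a rooted metric tree.  Vertices are natural numbers (every tree in question has
countably many vertices, so this is no loss of generality).  A tree is given by
  Vt  : the vertex set, r : the root, par : the parent map, len : edge lengths.
Every non-root vertex x is the endpoint (away from the root) of exactly one edge,
the edge from par x to x, which is identified with the interval [0, len x]
(parameter t = distance from par x).  So the edge set is indexed by Vt - {r}, and
a point of the tree is a pair (x, t) with x in Vt - {r} and t in [0, len x].
\<close>

definition tree_gen :: "nat \<Rightarrow> (nat \<Rightarrow> nat) \<Rightarrow> nat \<Rightarrow> nat" where
  "tree_gen r par x = (LEAST n. (par ^^ n) x = r)"

definition vdepth :: "nat \<Rightarrow> (nat \<Rightarrow> nat) \<Rightarrow> (nat \<Rightarrow> real) \<Rightarrow> nat \<Rightarrow> real" where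
  "vdepth r par len x = (\<Sum>k<tree_gen r par x. len ((par ^^ k) x))"

definition point_dist :: "nat \<Rightarrow> (nat \<Rightarrow> nat) \<Rightarrow> (nat \<Rightarrow> real) \<Rightarrow> nat \<Rightarrow> real \<Rightarrow> real" where
  "point_dist r par len x t = vdepth r par len x - len x + t"

definition metric_tree :: "nat set \<Rightarrow> nat \<Rightarrow> (nat \<Rightarrow> nat) \<Rightarrow> (nat \<Rightarrow> real) \<Rightarrow> bool" where
  "metric_tree Vt r par len \<longleftrightarrow>
     r \<in> Vt \<and>
     (\<forall>x\<in>Vt - {r}. par x \<in> Vt \<and> 0 < len x \<and> (\<exists>n. (par ^^ n) x = r)) \<and>
     card {y \<in> Vt - {r}. par y = r} = 1 \<and>
     (\<forall>x\<in>Vt - {r}. finite {y \<in> Vt - {r}. par y = x} \<and> 1 < card {y \<in> Vt - {r}. par y = x}) \<and>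
     (\<forall>R. \<exists>x\<in>Vt - {r}. R < vdepth r par len x)"

definition tree_measure :: "nat set \<Rightarrow> nat \<Rightarrow> (nat \<Rightarrow> real) \<Rightarrow> (nat \<times> real) measure" where
  "tree_measure Vt r len =
     density (count_space (Vt - {r}) \<Otimes>\<^sub>M lborel)
             (\<lambda>p. indicator {q. snd q \<in> {0 .. len (fst q)}} p)"

text \<open>phi is in H^1(Gamma) with edgewise weak derivative dphi.  A function on the tree is a
map nat => real => real; as canonical representative it vanishes off the tree.\<close>
definition tree_H1 ::
  "nat set \<Rightarrow> nat \<Rightarrow> (nat \<Rightarrow> nat) \<Rightarrow> (nat \<Rightarrow> real) \<Rightarrow> (nat \<Rightarrow> real \<Rightarrow> real) \<Rightarrow> (nat \<Rightarrow> real \<Rightarrow> real) \<Rightarrow> bool"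
where
  "tree_H1 Vt r par len phi dphi \<longleftrightarrow>
     (\<forall>x t. (x \<notin> Vt - {r} \<or> t \<notin> {0 .. len x}) \<longrightarrow> phi x t = 0) \<and>
     (\<forall>x\<in>Vt - {r}. set_integrable lborel {0 .. len x} (dphi x) \<and>
        (\<forall>t\<in>{0 .. len x}. phi x t = phi x 0 + (LINT s:{0..t}|lborel. dphi x s))) \<and>
     (\<forall>y\<in>Vt - {r}. par y \<noteq> r \<longrightarrow> phi y 0 = phi (par y) (len (par y))) \<and>
     (\<forall>y\<in>Vt - {r}. \<forall>z\<in>Vt - {r}. par y = par z \<longrightarrow> phi y 0 = phi z 0) \<and>
     (\<lambda>p. phi (fst p) (snd p)) \<in> borel_measurable (tree_measure Vt r len) \<and>
     (\<lambda>p. dphi (fst p) (snd p)) \<in> borel_measurable (tree_measure Vt r len) \<and>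
     integrable (tree_measure Vt r len) (\<lambda>p. (phi (fst p) (snd p))\<^sup>2) \<and>
     integrable (tree_measure Vt r len) (\<lambda>p. (dphi (fst p) (snd p))\<^sup>2)"

text \<open>Form domain of the closed form  int |phi'|^2 - int V |phi|^2 .\<close>
definition form_dom ::
  "nat set \<Rightarrow> nat \<Rightarrow> (nat \<Rightarrow> nat) \<Rightarrow> (nat \<Rightarrow> real) \<Rightarrow> (nat \<Rightarrow> real \<Rightarrow> real) \<Rightarrow>
   (nat \<Rightarrow> real \<Rightarrow> real) \<Rightarrow> (nat \<Rightarrow> real \<Rightarrow> real) \<Rightarrow> bool"
where
  "form_dom Vt r par len V phi dphi \<longleftrightarrow>
     tree_H1 Vt r par len phi dphi \<and>
     integrable (tree_measure Vt r len) (\<lambda>p. max 0 (- V (fst p) (snd p)) * (phi (fst p) (snd p))\<^sup>2)"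

text \<open>phi is an eigenfunction of -Delta_N - V with eigenvalue lam (weak form: phi is in
the operator domain and T phi = lam phi).\<close>
definition eigenfun ::
  "nat set \<Rightarrow> nat \<Rightarrow> (nat \<Rightarrow> nat) \<Rightarrow> (nat \<Rightarrow> real) \<Rightarrow> (nat \<Rightarrow> real \<Rightarrow> real) \<Rightarrow> real \<Rightarrow>
   (nat \<Rightarrow> real \<Rightarrow> real) \<Rightarrow> (nat \<Rightarrow> real \<Rightarrow> real) \<Rightarrow> bool"
where
  "eigenfun Vt r par len V lam phi dphi \<longleftrightarrow>
     form_dom Vt r par len V phi dphi \<and>
     (\<forall>psi dpsi. form_dom Vt r par len V psi dpsi \<longrightarrow>
        (LINT p|tree_measure Vt r len. dphi (fst p) (snd p) * dpsi (fst p) (snd p))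
        - (LINT p|tree_measure Vt r len. V (fst p) (snd p) * phi (fst p) (snd p) * psi (fst p) (snd p))
        = lam * (LINT p|tree_measure Vt r len. phi (fst p) (snd p) * psi (fst p) (snd p)))"

text \<open>Multiplicity of lam: dimension of the eigenspace (sup of sizes of L2-orthonormal families
of eigenfunctions); 0 if lam is not an eigenvalue; possibly infinite.\<close>
definition eig_mult ::
  "nat set \<Rightarrow> nat \<Rightarrow> (nat \<Rightarrow> nat) \<Rightarrow> (nat \<Rightarrow> real) \<Rightarrow> (nat \<Rightarrow> real \<Rightarrow> real) \<Rightarrow> real \<Rightarrow> ennreal"
where
  "eig_mult Vt r par len V lam =
     Sup {of_nat n | n. \<exists>phi dphi :: nat \<Rightarrow> nat \<Rightarrow> real \<Rightarrow> real.
        (\<forall>i<n. eigenfun Vt r par len V lam (phi i) (dphi i)) \<and>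
        (\<forall>i<n. \<forall>j<n. (LINT p|tree_measure Vt r len. phi i (fst p) (snd p) * phi j (fst p) (snd p))
                     = (if i = j then 1 else 0))}"

definition neg_trace ::
  "nat set \<Rightarrow> nat \<Rightarrow> (nat \<Rightarrow> nat) \<Rightarrow> (nat \<Rightarrow> real) \<Rightarrow> (nat \<Rightarrow> real \<Rightarrow> real) \<Rightarrow> real \<Rightarrow> ennreal"
where
  "neg_trace Vt r par len V gamma =
     (\<integral>\<^sup>+ lam. eig_mult Vt r par len V lam * ennreal (\<bar>lam\<bar> powr gamma) \<partial>count_space {lam. lam < 0})"

definition admissible_potential ::
  "nat set \<Rightarrow> nat \<Rightarrow> (nat \<Rightarrow> nat) \<Rightarrow> (nat \<Rightarrow> real) \<Rightarrow> (nat \<Rightarrow> real \<Rightarrow> real) \<Rightarrow> bool"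
where
  "admissible_potential Vt r par len V \<longleftrightarrow>
     (\<lambda>p. V (fst p) (snd p)) \<in> borel_measurable (count_space (Vt - {r}) \<Otimes>\<^sub>M lborel) \<and>
     (\<forall>R. \<exists>C. \<forall>x\<in>Vt - {r}. \<forall>t\<in>{0 .. len x}. point_dist r par len x t \<le> R \<longrightarrow> \<bar>V x t\<bar> \<le> C) \<and>
     (\<forall>e>0. \<exists>R. \<forall>x\<in>Vt - {r}. \<forall>t\<in>{0 .. len x}. R < point_dist r par len x t \<longrightarrow> V x t \<le> e)"

end

theory Submission
  imports Defs
begin

text \<open>
The potential is first truncated to \<open>W = 2 (V - \<tau>)\<^sub>+\<close> with \<open>\<tau> > 0\<close>, which is bounded and lives in a
ball around the root, and only finitely many generations are kept. This finite subtree is cut from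
the leaves upwards into pieces: the piece below a point is closed off as soon as its height times
its potential mass \<open>u\<close> exceeds a fixed constant, but before it becomes large along any single branch.
On such a piece the form \<open>\<integral>|\<phi>'|\<^sup>2 - \<integral>W|\<phi>|\<^sup>2\<close> is nonnegative if \<open>\<phi>\<close> vanishes at the top, and it is
bounded below by a multiple of \<open>-u\<^sup>2\<integral>|\<phi>|\<^sup>2\<close> otherwise. What is left at the root has no height to
spare, but there a long path of the full tree of infinite height takes over. Hence the number of
eigenvalues below \<open>-64 e\<^sup>2\<close> is at most the number of pieces with \<open>u \<ge> e\<close>, and summing over \<open>e\<close> gives
the case \<open>\<gamma> = 1/2\<close>, because the masses \<open>u\<close> add up to at most \<open>\<integral>W\<close>. The Aizenman--Lieb argument,
integration over \<open>\<tau>\<close> against \<open>\<tau>\<close> to the power \<open>\<gamma> - 3/2\<close>, lifts this to all \<open>\<gamma> \<ge> 1/2\<close>.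
\<close>

text \<open>A metric tree has no positive lower bound on its edge lengths and no upper bound on its
  branching. A ball around the root may contain infinitely many edges, which is why the generations
  are truncated as well as the potential; the edges left out are paid for by a Sobolev bound in the
  ball. At a branching point the product of height and mass can jump to any size, since a long
  branch with little potential may meet a short one with much. Such a piece is estimated branch by
  branch, never through its total height times its total mass. The constant 64 is 4 * 16: the
  threshold for height times mass is 1/16, and 4 comes from two uses of
  \<open>square_add_le\<close>. The potential is doubled because the covering costs 5/4 of the
  kinetic energy, 1/4 of it for the remainder at the root. Halving that inequality leaves 5/8, and
  the other 3/8 pay for the truncation. Closing a piece costs one linear equation for \<phi>, so
  only the number of pieces counts, and neither the tree nor the potential enters the
  constants.\<close>

section \<open>The greedy covering\<close>

text \<open>
State of the greedy procedure on the part of the tree below a point, where \<open>a \<phi>\<close> is the value of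
\<open>\<phi>\<close>. There \<open>K\<close>, \<open>M\<close>, \<open>U\<close> are the integrals of \<open>|\<phi>'|\<^sup>2\<close>, \<open>|\<phi>|\<^sup>2\<close>, \<open>W|\<phi>|\<^sup>2\<close>, and \<open>l\<close>, \<open>w\<close> bound
the height and the potential mass. The list \<open>ks\<close> records the closed pieces (evaluation at the top,
potential mass); \<open>h\<close> and \<open>v\<close> are the height and mass of the piece still open. The numbers \<open>D\<close> and
\<open>m\<close> are the parts of \<open>K\<close> and \<open>M\<close> that belong to the open piece; the last clause says that it
contains a path of length \<open>h\<close>, so that \<open>|\<phi>|\<close> is at most \<open>b\<close> somewhere on its first segment of length \<open>L\<close>.
\<close>

definition energy_cover ::
  "'f set \<Rightarrow> ('f \<Rightarrow> real) set \<Rightarrow> ('f \<Rightarrow> real) \<Rightarrow> ('f \<Rightarrow> real) \<Rightarrow> ('f \<Rightarrow> real) \<Rightarrow> ('f \<Rightarrow> real)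
    \<Rightarrow> real \<Rightarrow> real \<Rightarrow> bool" where
  "energy_cover H Ev a K M U l w \<longleftrightarrow>
    (\<exists>h v ks. 0 \<le> h \<and> h \<le> l \<and> 0 \<le> v \<and> h * v \<le> 1/16 \<and> v + sum_list (map snd ks) \<le> w \<and>
       (\<forall>(f, u) \<in> set ks. f \<in> Ev \<and> 0 \<le> u) \<and>
       (\<forall>e>0. \<forall>\<phi>\<in>H. (\<forall>(f, u) \<in> set ks. e \<le> u \<longrightarrow> f \<phi> = 0) \<longrightarrow>
          (\<exists>D m. 0 \<le> D \<and> 0 \<le> m \<and>
             U \<phi> \<le> v * (\<bar>a \<phi>\<bar> + sqrt (h * D))\<^sup>2 + (K \<phi> - D) + 64 * e\<^sup>2 * (M \<phi> - m) \<and>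
             (\<forall>L. 0 < L \<and> L \<le> h \<longrightarrow> (\<exists>b\<ge>0. L * b\<^sup>2 \<le> m \<and> \<bar>a \<phi>\<bar> \<le> b + sqrt (L * D))))))"

lemma energy_coverI:
  assumes "0 \<le> h" "h \<le> l" "0 \<le> v" "h * v \<le> 1/16" "v + sum_list (map snd ks) \<le> w"
    "\<forall>(f, u) \<in> set ks. f \<in> Ev \<and> 0 \<le> u"
    "\<forall>e>0. \<forall>\<phi>\<in>H. (\<forall>(f, u) \<in> set ks. e \<le> u \<longrightarrow> f \<phi> = 0) \<longrightarrow>
       (\<exists>D m. 0 \<le> D \<and> 0 \<le> m \<and>
          U \<phi> \<le> v * (\<bar>a \<phi>\<bar> + sqrt (h * D))\<^sup>2 + (K \<phi> - D) + 64 * e\<^sup>2 * (M \<phi> - m) \<and>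
          (\<forall>L. 0 < L \<and> L \<le> h \<longrightarrow> (\<exists>b\<ge>0. L * b\<^sup>2 \<le> m \<and> \<bar>a \<phi>\<bar> \<le> b + sqrt (L * D))))"
  shows "energy_cover H Ev a K M U l w"
  unfolding energy_cover_def using assms by metis

lemma energy_coverE:
  assumes "energy_cover H Ev a K M U l w"
  obtains h v ks where "0 \<le> h" "h \<le> l" "0 \<le> v" "h * v \<le> 1/16" "v + sum_list (map snd ks) \<le> w"
    "\<forall>(f, u) \<in> set ks. f \<in> Ev \<and> 0 \<le> u"
    "\<And>e \<phi>. 0 < e \<Longrightarrow> \<phi> \<in> H \<Longrightarrow> \<forall>(f, u) \<in> set ks. e \<le> u \<longrightarrow> f \<phi> = 0 \<Longrightarrow>
       \<exists>D m. 0 \<le> D \<and> 0 \<le> m \<and>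
          U \<phi> \<le> v * (\<bar>a \<phi>\<bar> + sqrt (h * D))\<^sup>2 + (K \<phi> - D) + 64 * e\<^sup>2 * (M \<phi> - m) \<and>
          (\<forall>L. 0 < L \<and> L \<le> h \<longrightarrow> (\<exists>b\<ge>0. L * b\<^sup>2 \<le> m \<and> \<bar>a \<phi>\<bar> \<le> b + sqrt (L * D)))"
  using assms unfolding energy_cover_def by metis

lemma energy_cover_cong:
  assumes "energy_cover H Ev a K M U l w"
    and "\<And>\<phi>. \<phi> \<in> H \<Longrightarrow> a \<phi> = a' \<phi> \<and> K \<phi> = K' \<phi> \<and> M \<phi> = M' \<phi> \<and> U \<phi> = U' \<phi>" "l = l'" "w = w'"
  shows "energy_cover H Ev a' K' M' U' l' w'"
  using assms(1) unfolding energy_cover_def assms(3,4) using assms(2) by (simp cong: ball_cong)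

text \<open>Cauchy-Schwarz for the vectors (sqrt h, sqrt s) and (sqrt D, sqrt K). Oscillation bounds
  of the form sqrt(length * energy) thereby add up along consecutive parts of a path.\<close>

lemma sqrt_add_le_sqrt_prod:
  assumes "0 \<le> h" "0 \<le> D" "0 \<le> s" "0 \<le> (K::real)"
  shows "sqrt (h * D) + sqrt (s * K) \<le> sqrt ((h + s) * (D + K))"
proof (rule real_le_rsqrt)
  have "(sqrt (h * D) + sqrt (s * K))\<^sup>2 = h * D + s * K + 2 * (sqrt (h * D) * sqrt (s * K))"
    using assms by (simp add: power2_sum)
  also have "sqrt (h * D) * sqrt (s * K) = sqrt (h * K) * sqrt (s * D)"
    by (simp add: real_sqrt_mult ac_simps)
  also have "h * D + s * K + 2 * (sqrt (h * K) * sqrt (s * D)) \<le> h * D + s * K + (h * K + s * D)"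
    using sum_squares_bound[of "sqrt (h * K)" "sqrt (s * D)"] assms by simp
  finally show "(sqrt (h * D) + sqrt (s * K))\<^sup>2 \<le> (h + s) * (D + K)"
    by (simp add: algebra_simps)
qed

lemma square_add_le: "((x::real) + y)\<^sup>2 \<le> 2 * x\<^sup>2 + 2 * y\<^sup>2"
  using sum_squares_bound[of x y] by (simp add: power2_sum)

text \<open>A path of length \<open>h\<close> that starts with the value \<open>a\<close> is
  prolonged upwards by a segment of length \<open>s\<close>, at whose top the value is
  \<open>a'\<close>. If \<open>L\<close> exceeds \<open>s\<close>, the segment is used entirely and
  the old path up to length \<open>L - s\<close>.\<close>

lemma small_value_extend:
  fixes a a' :: real
  assumes s: "0 < s" and D: "0 \<le> D" and K: "0 \<le> K" and m: "0 \<le> m" and M: "0 \<le> M"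
    and aa: "\<bar>a - a'\<bar> \<le> sqrt (s * K)"
    and bs: "\<And>L. 0 < L \<Longrightarrow> L \<le> s \<Longrightarrow> \<exists>b\<ge>0. L * b\<^sup>2 \<le> M \<and> \<bar>a'\<bar> \<le> b + sqrt (L * K)"
    and bh: "\<And>L. 0 < L \<Longrightarrow> L \<le> h \<Longrightarrow> \<exists>b\<ge>0. L * b\<^sup>2 \<le> m \<and> \<bar>a\<bar> \<le> b + sqrt (L * D)"
    and L: "0 < L" "L \<le> h + s"
  shows "\<exists>b\<ge>0. L * b\<^sup>2 \<le> m + M \<and> \<bar>a'\<bar> \<le> b + sqrt (L * (D + K))"
proof (cases "L \<le> s")
  case True
  then obtain b where b: "b \<ge> 0" "L * b\<^sup>2 \<le> M" "\<bar>a'\<bar> \<le> b + sqrt (L * K)"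
    using bs L by blast
  have "sqrt (L * K) \<le> sqrt (L * (D + K))"
    using L D by (intro real_sqrt_le_mono mult_left_mono) auto
  then show ?thesis using b m by (intro exI[of _ b] conjI) linarith+
next
  case False
  then obtain b1 where b1: "b1 \<ge> 0" "(L - s) * b1\<^sup>2 \<le> m" "\<bar>a\<bar> \<le> b1 + sqrt ((L - s) * D)"
    using bh[of "L - s"] L by auto
  obtain b2 where b2: "b2 \<ge> 0" "s * b2\<^sup>2 \<le> M" "\<bar>a'\<bar> \<le> b2 + sqrt (s * K)"
    using bs[of s] s by blast
  \<comment> \<open>Both \<open>b1\<close> and \<open>b2\<close> bound the new value from above, up
    to the same square root, so the smaller one does too; and the smaller one fits into both mass
    bounds at once.\<close>
  define b where "b = min b1 b2"
  have b: "0 \<le> b" "b \<le> b1" "b \<le> b2" using b1 b2 by (auto simp: b_def)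
  have "L * b\<^sup>2 = (L - s) * b\<^sup>2 + s * b\<^sup>2" by (simp add: algebra_simps)
  also have "\<dots> \<le> (L - s) * b1\<^sup>2 + s * b2\<^sup>2"
    using b False s by (intro add_mono mult_left_mono power_mono) auto
  finally have "L * b\<^sup>2 \<le> m + M" using b1 b2 by linarith
  moreover have "sqrt ((L - s) * D) + sqrt (s * K) \<le> sqrt (L * (D + K))"
    using sqrt_add_le_sqrt_prod[of "L - s" D s K] False s D K by simp
  then have "\<bar>a'\<bar> \<le> b1 + sqrt (L * (D + K))"
    using b1(3) aa by linarith
  moreover have "sqrt (s * K) \<le> sqrt (L * (D + K))"
    using False s D K by (intro real_sqrt_le_mono mult_mono) auto
  then have "\<bar>a'\<bar> \<le> b2 + sqrt (L * (D + K))"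
    using b2(3) by linarith
  ultimately show ?thesis using b by (intro exI[of _ b]) (auto simp: b_def min_def)
qed

text \<open>The empty subtree: the start of the induction below the last generation kept, and of the
  merging of the children of a vertex.\<close>

lemma energy_cover_0: "energy_cover H Ev a (\<lambda>_. 0) (\<lambda>_. 0) (\<lambda>_. 0) 0 0"
  unfolding energy_cover_def
  by (rule exI[of _ 0], rule exI[of _ 0], rule exI[of _ "[]"]) (auto intro!: exI[of _ 0])

text \<open>The open piece is closed, with the evaluation \<open>a\<close> as its functional.\<close>

lemma energy_cover_cut:
  assumes a: "a \<in> Ev" and w: "v + sum_list (map snd ks) \<le> w" and v: "0 \<le> v" and l: "0 \<le> l"
    and ks: "\<forall>(f, u) \<in> set ks. f \<in> Ev \<and> 0 \<le> u"
    and zero: "\<And>e \<phi>. 0 < e \<Longrightarrow> \<phi> \<in> H \<Longrightarrow> \<forall>(f, u) \<in> set ks. e \<le> u \<longrightarrow> f \<phi> = 0 \<Longrightarrow> a \<phi> = 0 \<or> v < e \<Longrightarrow>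
       U \<phi> \<le> K \<phi> + 64 * e\<^sup>2 * M \<phi>"
  shows "energy_cover H Ev a K M U l w"
  unfolding energy_cover_def
proof (intro exI conjI allI ballI impI)
  show "0 + sum_list (map snd ((a, v) # ks)) \<le> w" using w by simp
  show "case x of (f, u) \<Rightarrow> f \<in> Ev \<and> 0 \<le> u" if "x \<in> set ((a, v) # ks)" for x
    using that a v ks by auto
  fix e \<phi> assume "(0::real) < e" "\<phi> \<in> H" "\<forall>(f, u) \<in> set ((a, v) # ks). e \<le> u \<longrightarrow> f \<phi> = 0"
  then have "U \<phi> \<le> K \<phi> + 64 * e\<^sup>2 * M \<phi>" by (intro zero) auto
  then show "U \<phi> \<le> 0 * (\<bar>a \<phi>\<bar> + sqrt (0 * 0))\<^sup>2 + (K \<phi> - 0) + 64 * e\<^sup>2 * (M \<phi> - 0)" by simp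
qed (use l in auto)

text \<open>The two branches leave the same point. Their heights are maximised and their masses
  added, so \<open>h * v\<close> may exceed 1/16 by any factor. For this reason \<open>c\<close>
  keeps \<open>D1\<close> and \<open>D2\<close> apart: within each branch the product is still at
  most 1/16, and this is enough to close the union.\<close>

lemma energy_cover_merge:
  assumes "energy_cover H Ev a1 K1 M1 U1 l1 w1" "energy_cover H Ev a2 K2 M2 U2 l2 w2"
    and a1: "\<And>\<phi>. \<phi> \<in> H \<Longrightarrow> a1 \<phi> = a \<phi>" and a2: "\<And>\<phi>. \<phi> \<in> H \<Longrightarrow> a2 \<phi> = a \<phi>" and aE: "a \<in> Ev"
  shows "energy_cover H Ev a (\<lambda>\<phi>. K1 \<phi> + K2 \<phi>) (\<lambda>\<phi>. M1 \<phi> + M2 \<phi>) (\<lambda>\<phi>. U1 \<phi> + U2 \<phi>) (l1 + l2) (w1 + w2)"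
proof -
  obtain h1 v1 ks1 where h1: "0 \<le> h1" "h1 \<le> l1" "0 \<le> v1" "h1 * v1 \<le> 1/16"
    "v1 + sum_list (map snd ks1) \<le> w1" "\<forall>(f, u) \<in> set ks1. f \<in> Ev \<and> 0 \<le> u"
    and c1: "\<And>e \<phi>. 0 < e \<Longrightarrow> \<phi> \<in> H \<Longrightarrow> \<forall>(f, u) \<in> set ks1. e \<le> u \<longrightarrow> f \<phi> = 0 \<Longrightarrow>
          (\<exists>D m. 0 \<le> D \<and> 0 \<le> m \<and>
             U1 \<phi> \<le> v1 * (\<bar>a \<phi>\<bar> + sqrt (h1 * D))\<^sup>2 + (K1 \<phi> - D) + 64 * e\<^sup>2 * (M1 \<phi> - m) \<and>
             (\<forall>L. 0 < L \<and> L \<le> h1 \<longrightarrow> (\<exists>b\<ge>0. L * b\<^sup>2 \<le> m \<and> \<bar>a \<phi>\<bar> \<le> b + sqrt (L * D))))"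
    using assms(1) unfolding energy_cover_def using a1 by metis
  obtain h2 v2 ks2 where h2: "0 \<le> h2" "h2 \<le> l2" "0 \<le> v2" "h2 * v2 \<le> 1/16"
    "v2 + sum_list (map snd ks2) \<le> w2" "\<forall>(f, u) \<in> set ks2. f \<in> Ev \<and> 0 \<le> u"
    and c2: "\<And>e \<phi>. 0 < e \<Longrightarrow> \<phi> \<in> H \<Longrightarrow> \<forall>(f, u) \<in> set ks2. e \<le> u \<longrightarrow> f \<phi> = 0 \<Longrightarrow>
          (\<exists>D m. 0 \<le> D \<and> 0 \<le> m \<and>
             U2 \<phi> \<le> v2 * (\<bar>a \<phi>\<bar> + sqrt (h2 * D))\<^sup>2 + (K2 \<phi> - D) + 64 * e\<^sup>2 * (M2 \<phi> - m) \<and>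
             (\<forall>L. 0 < L \<and> L \<le> h2 \<longrightarrow> (\<exists>b\<ge>0. L * b\<^sup>2 \<le> m \<and> \<bar>a \<phi>\<bar> \<le> b + sqrt (L * D))))"
    using assms(2) unfolding energy_cover_def using a2 by metis
  define h where "h = max h1 h2"
  define v where "v = v1 + v2"
  have hv: "0 \<le> h" "0 \<le> v" "h1 \<le> h" "h2 \<le> h" "h \<le> l1 + l2" using h1 h2 by (auto simp: h_def v_def)
  have ks: "\<forall>(f, u) \<in> set (ks1 @ ks2). f \<in> Ev \<and> 0 \<le> u" using h1 h2 by auto
  have w: "v + sum_list (map snd (ks1 @ ks2)) \<le> w1 + w2" using h1 h2 by (simp add: v_def)
  have c: "\<exists>D1 D2 D m. 0 \<le> D1 \<and> 0 \<le> D2 \<and> D = D1 + D2 \<and> 0 \<le> m \<and>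
     U1 \<phi> + U2 \<phi> \<le> v1 * (\<bar>a \<phi>\<bar> + sqrt (h1 * D1))\<^sup>2 + v2 * (\<bar>a \<phi>\<bar> + sqrt (h2 * D2))\<^sup>2
        + (K1 \<phi> + K2 \<phi> - D) + 64 * e\<^sup>2 * (M1 \<phi> + M2 \<phi> - m) \<and>
     (\<forall>L. 0 < L \<and> L \<le> h \<longrightarrow> (\<exists>b\<ge>0. L * b\<^sup>2 \<le> m \<and> \<bar>a \<phi>\<bar> \<le> b + sqrt (L * D)))"
    if e: "0 < e" "\<phi> \<in> H" "\<forall>(f, u) \<in> set (ks1 @ ks2). e \<le> u \<longrightarrow> f \<phi> = 0" for e \<phi>
  proof -
    obtain D1 m1 where d1: "0 \<le> D1" "0 \<le> m1"
      "U1 \<phi> \<le> v1 * (\<bar>a \<phi>\<bar> + sqrt (h1 * D1))\<^sup>2 + (K1 \<phi> - D1) + 64 * e\<^sup>2 * (M1 \<phi> - m1)"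
      "\<And>L. 0 < L \<Longrightarrow> L \<le> h1 \<Longrightarrow> \<exists>b\<ge>0. L * b\<^sup>2 \<le> m1 \<and> \<bar>a \<phi>\<bar> \<le> b + sqrt (L * D1)"
      using c1[OF e(1,2)] e(3) by (metis Un_iff set_append)
    obtain D2 m2 where d2: "0 \<le> D2" "0 \<le> m2"
      "U2 \<phi> \<le> v2 * (\<bar>a \<phi>\<bar> + sqrt (h2 * D2))\<^sup>2 + (K2 \<phi> - D2) + 64 * e\<^sup>2 * (M2 \<phi> - m2)"
      "\<And>L. 0 < L \<Longrightarrow> L \<le> h2 \<Longrightarrow> \<exists>b\<ge>0. L * b\<^sup>2 \<le> m2 \<and> \<bar>a \<phi>\<bar> \<le> b + sqrt (L * D2)"
      using c2[OF e(1,2)] e(3) by (metis Un_iff set_append)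
    have "\<exists>b\<ge>0. L * b\<^sup>2 \<le> m1 + m2 \<and> \<bar>a \<phi>\<bar> \<le> b + sqrt (L * (D1 + D2))" if L: "0 < L" "L \<le> h" for L
    proof -
      have m: "sqrt (L * D1) \<le> sqrt (L * (D1 + D2))" "sqrt (L * D2) \<le> sqrt (L * (D1 + D2))"
        using d1 d2 L by (auto intro!: mult_left_mono)
      show ?thesis
      proof (cases "L \<le> h1")
        case True
        then obtain b where "b \<ge> 0" "L * b\<^sup>2 \<le> m1" "\<bar>a \<phi>\<bar> \<le> b + sqrt (L * D1)"
          using d1(4) L by blast
        then show ?thesis using m d2 by (intro exI[of _ b] conjI) linarith+
      next
        case False
        then have "L \<le> h2" using L by (auto simp: h_def)
        then obtain b where "b \<ge> 0" "L * b\<^sup>2 \<le> m2" "\<bar>a \<phi>\<bar> \<le> b + sqrt (L * D2)"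
          using d2(4) L by blast
        then show ?thesis using m d1 by (intro exI[of _ b] conjI) linarith+
      qed
    qed
    moreover have "64 * e\<^sup>2 * (M1 \<phi> + M2 \<phi> - (m1 + m2)) = 64 * e\<^sup>2 * (M1 \<phi> - m1) + 64 * e\<^sup>2 * (M2 \<phi> - m2)"
      by (simp add: algebra_simps)
    moreover have ineq: "y \<le> p + (k - d) + r \<Longrightarrow> y' \<le> p' + (k' - d') + r' \<Longrightarrow> q = r + r' \<Longrightarrow>
        y + y' \<le> p + p' + (k + k' - (d + d')) + q" for y y' p p' k k' d d' q r r' :: real by linarith
    ultimately have
      "U1 \<phi> + U2 \<phi> \<le> v1 * (\<bar>a \<phi>\<bar> + sqrt (h1 * D1))\<^sup>2 + v2 * (\<bar>a \<phi>\<bar> + sqrt (h2 * D2))\<^sup>2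
        + (K1 \<phi> + K2 \<phi> - (D1 + D2)) + 64 * e\<^sup>2 * (M1 \<phi> + M2 \<phi> - (m1 + m2)) \<and>
       (\<forall>L. 0 < L \<and> L \<le> h \<longrightarrow> (\<exists>b\<ge>0. L * b\<^sup>2 \<le> m1 + m2 \<and> \<bar>a \<phi>\<bar> \<le> b + sqrt (L * (D1 + D2))))"
      using ineq[OF d1(3) d2(3)] by blast
    moreover have "0 \<le> m1 + m2" using d1 d2 by simp
    ultimately show ?thesis
      using d1(1) d2(1) by blast
  qed
  show ?thesis
  proof (cases "h * v \<le> 1/16")
    case True
    have main: "\<forall>e>0. \<forall>\<phi>\<in>H. (\<forall>(f, u) \<in> set (ks1 @ ks2). e \<le> u \<longrightarrow> f \<phi> = 0) \<longrightarrow>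
          (\<exists>D m. 0 \<le> D \<and> 0 \<le> m \<and>
             U1 \<phi> + U2 \<phi> \<le> v * (\<bar>a \<phi>\<bar> + sqrt (h * D))\<^sup>2 + (K1 \<phi> + K2 \<phi> - D) + 64 * e\<^sup>2 * (M1 \<phi> + M2 \<phi> - m) \<and>
             (\<forall>L. 0 < L \<and> L \<le> h \<longrightarrow> (\<exists>b\<ge>0. L * b\<^sup>2 \<le> m \<and> \<bar>a \<phi>\<bar> \<le> b + sqrt (L * D))))"
    proof (intro allI ballI impI)
      fix e \<phi> assume e: "(0::real) < e" "\<phi> \<in> H" "\<forall>(f, u) \<in> set (ks1 @ ks2). e \<le> u \<longrightarrow> f \<phi> = 0"
      obtain D1 D2 D m where d: "0 \<le> D1" "0 \<le> D2" "D = D1 + D2" "0 \<le> m"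
       "U1 \<phi> + U2 \<phi> \<le> v1 * (\<bar>a \<phi>\<bar> + sqrt (h1 * D1))\<^sup>2 + v2 * (\<bar>a \<phi>\<bar> + sqrt (h2 * D2))\<^sup>2
          + (K1 \<phi> + K2 \<phi> - D) + 64 * e\<^sup>2 * (M1 \<phi> + M2 \<phi> - m)"
       "\<And>L. 0 < L \<and> L \<le> h \<longrightarrow> (\<exists>b\<ge>0. L * b\<^sup>2 \<le> m \<and> \<bar>a \<phi>\<bar> \<le> b + sqrt (L * D))"
        using c[OF e] by blast
      have "v1 * (\<bar>a \<phi>\<bar> + sqrt (h1 * D1))\<^sup>2 \<le> v1 * (\<bar>a \<phi>\<bar> + sqrt (h * D))\<^sup>2"
        using d h1 hv by (intro mult_left_mono power_mono add_left_mono real_sqrt_le_mono mult_mono) auto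
      moreover have "v2 * (\<bar>a \<phi>\<bar> + sqrt (h2 * D2))\<^sup>2 \<le> v2 * (\<bar>a \<phi>\<bar> + sqrt (h * D))\<^sup>2"
        using d h2 hv by (intro mult_left_mono power_mono add_left_mono real_sqrt_le_mono mult_mono) auto
      ultimately have "U1 \<phi> + U2 \<phi> \<le> v * (\<bar>a \<phi>\<bar> + sqrt (h * D))\<^sup>2 + (K1 \<phi> + K2 \<phi> - D)
          + 64 * e\<^sup>2 * (M1 \<phi> + M2 \<phi> - m)"
        using d(5) unfolding v_def distrib_right by linarith
      then show "\<exists>D m. 0 \<le> D \<and> 0 \<le> m \<and>
             U1 \<phi> + U2 \<phi> \<le> v * (\<bar>a \<phi>\<bar> + sqrt (h * D))\<^sup>2 + (K1 \<phi> + K2 \<phi> - D) + 64 * e\<^sup>2 * (M1 \<phi> + M2 \<phi> - m) \<and>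
             (\<forall>L. 0 < L \<and> L \<le> h \<longrightarrow> (\<exists>b\<ge>0. L * b\<^sup>2 \<le> m \<and> \<bar>a \<phi>\<bar> \<le> b + sqrt (L * D)))"
        using d by (intro exI[of _ D] exI[of _ m]) auto
    qed
    show ?thesis by (rule energy_coverI[OF hv(1,5,2) True w ks main])
  next
    case False
    then have hv16: "1/16 < h * v" by simp
    then have vpos: "0 < v" using hv by (cases "v = 0") auto
    show ?thesis
    proof (rule energy_cover_cut[where v = v and ks = "ks1 @ ks2"])
      fix e \<phi> assume e: "(0::real) < e" "\<phi> \<in> H" "\<forall>(f, u) \<in> set (ks1 @ ks2). e \<le> u \<longrightarrow> f \<phi> = 0"
        and cs: "a \<phi> = 0 \<or> v < e"
      obtain D1 D2 D m where d: "0 \<le> D1" "0 \<le> D2" "D = D1 + D2" "0 \<le> m"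
       "U1 \<phi> + U2 \<phi> \<le> v1 * (\<bar>a \<phi>\<bar> + sqrt (h1 * D1))\<^sup>2 + v2 * (\<bar>a \<phi>\<bar> + sqrt (h2 * D2))\<^sup>2
          + (K1 \<phi> + K2 \<phi> - D) + 64 * e\<^sup>2 * (M1 \<phi> + M2 \<phi> - m)"
       "\<And>L. 0 < L \<and> L \<le> h \<longrightarrow> (\<exists>b\<ge>0. L * b\<^sup>2 \<le> m \<and> \<bar>a \<phi>\<bar> \<le> b + sqrt (L * D))"
        using c[OF e] by blast
      \<comment> \<open>Applied to each branch with its own height and mass, this costs only 1/8 of
        the energy \<open>D\<close>; the remaining 7/8 serve to control the value at the
        top.\<close>
      have s: "v' * (\<bar>a \<phi>\<bar> + sqrt (h' * D'))\<^sup>2 \<le> 2 * v' * (a \<phi>)\<^sup>2 + D' / 8"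
        if "0 \<le> v'" "0 \<le> h'" "0 \<le> D'" "h' * v' \<le> 1/16" for v' h' D'
      proof -
        have "v' * (\<bar>a \<phi>\<bar> + sqrt (h' * D'))\<^sup>2 \<le> v' * (2 * \<bar>a \<phi>\<bar>\<^sup>2 + 2 * (sqrt (h' * D'))\<^sup>2)"
          by (rule mult_left_mono[OF square_add_le that(1)])
        also have "\<dots> = 2 * v' * (a \<phi>)\<^sup>2 + 2 * (h' * v') * D'" using that by (simp add: algebra_simps)
        also have "\<dots> \<le> 2 * v' * (a \<phi>)\<^sup>2 + 2 * (1/16) * D'"
          using that by (intro add_left_mono mult_right_mono mult_left_mono) auto
        finally show ?thesis by simp
      qed
      have ineq: "y \<le> p + p' + k + E * (n - n') \<Longrightarrow> p \<le> q + d1 / 8 \<Longrightarrow> p' \<le> q' + d2 / 8 \<Longrightarrow>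
          y \<le> q + q' + (d1 + d2) / 8 + k + E * n - E * n'" for y p p' k E n n' q q' d1 d2 :: real
        unfolding right_diff_distrib add_divide_distrib by linarith
      have U: "U1 \<phi> + U2 \<phi> \<le> 2 * v * (a \<phi>)\<^sup>2 - 7 / 8 * D + (K1 \<phi> + K2 \<phi>) + 64 * e\<^sup>2 * (M1 \<phi> + M2 \<phi>) - 64 * e\<^sup>2 * m"
      proof -
        have "2 * v * (a \<phi>)\<^sup>2 = 2 * v1 * (a \<phi>)\<^sup>2 + 2 * v2 * (a \<phi>)\<^sup>2" by (simp add: v_def algebra_simps)
        moreover have "(D1 + D2) / 8 - D = - 7 / 8 * D" unfolding d(3) by (simp add: field_simps)
        ultimately show ?thesis
          using ineq[OF d(5) s[OF h1(3,1) d(1) h1(4)] s[OF h2(3,1) d(2) h2(4)]] by linarith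
      qed
      have "2 * v * (a \<phi>)\<^sup>2 \<le> 64 * e\<^sup>2 * m + D / 4"
      proof (cases "a \<phi> = 0")
        case False
        then have ve: "v < e" using cs by simp
        \<comment> \<open>\<open>L\<close> is the length with L * v = 1/16, available because
          \<open>h * v\<close> exceeds 1/16. Then 4 * v * L * D = D / 4, and 4 * v * b^2 = 64 * v^2
          * (L * b^2), which is the origin of the constant 64.\<close>
        define L where "L = 1 / (16 * v)"
        have L: "0 < L" "L \<le> h" "L * v = 1/16" using vpos hv16 by (auto simp: L_def field_simps)
        obtain b where b: "b \<ge> 0" "L * b\<^sup>2 \<le> m" "\<bar>a \<phi>\<bar> \<le> b + sqrt (L * D)" using d(6) L by blast
        have "(a \<phi>)\<^sup>2 = \<bar>a \<phi>\<bar>\<^sup>2" by simp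
        also have "\<dots> \<le> (b + sqrt (L * D))\<^sup>2" using b by (intro power_mono) auto
        also have "\<dots> \<le> 2 * b\<^sup>2 + 2 * (sqrt (L * D))\<^sup>2" by (rule square_add_le)
        also have "\<dots> = 2 * b\<^sup>2 + 2 * (L * D)" using L d by simp
        finally have "2 * v * (a \<phi>)\<^sup>2 \<le> 2 * v * (2 * b\<^sup>2 + 2 * (L * D))" using vpos by simp
        also have "\<dots> = 64 * v\<^sup>2 * (L * b\<^sup>2) + D / 4"
          using L(3) vpos by (simp add: L_def power2_eq_square field_simps)
        also have "\<dots> \<le> 64 * e\<^sup>2 * m + D / 4"
          using ve vpos b L d by (intro add_right_mono mult_mono) (auto intro!: power_mono)
        finally show ?thesis .
      qed (use d in auto)
      then show "U1 \<phi> + U2 \<phi> \<le> K1 \<phi> + K2 \<phi> + 64 * e\<^sup>2 * (M1 \<phi> + M2 \<phi>)"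
        using U d by linarith
    qed (use hv ks w aE h1 h2 in auto)
  qed
qed

text \<open>By \<open>small\<close> the product of height and mass grows by at most 1/16, so a piece
  that has to be closed here satisfies 1/16 < h * v \<le> 1/8. The upper bound lets the kinetic
  energy absorb the potential; the lower bound makes the path long enough to charge the value at the
  top to the mass.\<close>

lemma energy_cover_extend:
  assumes "energy_cover H Ev a K M U l w" and a'E: "a' \<in> Ev"
    and s: "0 < s" "0 \<le> \<omega>" and small: "s * w + l * \<omega> + s * \<omega> \<le> 1/16"
    and Ks: "\<And>\<phi>. \<phi> \<in> H \<Longrightarrow> 0 \<le> Ks \<phi>" and Ms: "\<And>\<phi>. \<phi> \<in> H \<Longrightarrow> 0 \<le> Ms \<phi>"
    and aa: "\<And>\<phi>. \<phi> \<in> H \<Longrightarrow> \<bar>a \<phi> - a' \<phi>\<bar> \<le> sqrt (s * Ks \<phi>)"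
    and Us: "\<And>\<phi>. \<phi> \<in> H \<Longrightarrow> Us \<phi> \<le> \<omega> * (\<bar>a' \<phi>\<bar> + sqrt (s * Ks \<phi>))\<^sup>2"
    and bs: "\<And>\<phi> L. \<phi> \<in> H \<Longrightarrow> 0 < L \<Longrightarrow> L \<le> s \<Longrightarrow>
        \<exists>b\<ge>0. L * b\<^sup>2 \<le> Ms \<phi> \<and> \<bar>a' \<phi>\<bar> \<le> b + sqrt (L * Ks \<phi>)"
  shows "energy_cover H Ev a' (\<lambda>\<phi>. K \<phi> + Ks \<phi>) (\<lambda>\<phi>. M \<phi> + Ms \<phi>) (\<lambda>\<phi>. U \<phi> + Us \<phi>) (l + s) (w + \<omega>)"
proof -
  obtain h0 v0 ks where h0: "0 \<le> h0" "h0 \<le> l" "0 \<le> v0" "h0 * v0 \<le> 1/16"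
    "v0 + sum_list (map snd ks) \<le> w" and ks: "\<forall>(f, u) \<in> set ks. f \<in> Ev \<and> 0 \<le> u"
    and c0: "\<And>e \<phi>. 0 < e \<Longrightarrow> \<phi> \<in> H \<Longrightarrow> \<forall>(f, u) \<in> set ks. e \<le> u \<longrightarrow> f \<phi> = 0 \<Longrightarrow>
          (\<exists>D m. 0 \<le> D \<and> 0 \<le> m \<and>
             U \<phi> \<le> v0 * (\<bar>a \<phi>\<bar> + sqrt (h0 * D))\<^sup>2 + (K \<phi> - D) + 64 * e\<^sup>2 * (M \<phi> - m) \<and>
             (\<forall>L. 0 < L \<and> L \<le> h0 \<longrightarrow> (\<exists>b\<ge>0. L * b\<^sup>2 \<le> m \<and> \<bar>a \<phi>\<bar> \<le> b + sqrt (L * D))))"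
    using assms(1) unfolding energy_cover_def by metis
  define h where "h = h0 + s"
  define v where "v = v0 + \<omega>"
  have "0 \<le> sum_list (map snd ks)" using ks by (intro sum_list_nonneg) auto
  then have v0w: "v0 \<le> w" using h0 by linarith
  have "h * v = h0 * v0 + s * v0 + h0 * \<omega> + s * \<omega>" by (simp add: h_def v_def algebra_simps)
  also have "\<dots> \<le> 1/16 + s * w + l * \<omega> + s * \<omega>"
    using h0 v0w s by (intro add_mono mult_left_mono mult_right_mono) auto
  finally have hv8: "h * v \<le> 1/8" using small by linarith
  have hv: "0 < h" "0 \<le> v" "h \<le> l + s" using h0 s by (auto simp: h_def v_def)
  have w: "v + sum_list (map snd ks) \<le> w + \<omega>" using h0 by (simp add: v_def)
  have c: "\<exists>D m. 0 \<le> D \<and> 0 \<le> m \<and>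
     U \<phi> + Us \<phi> \<le> v * (\<bar>a' \<phi>\<bar> + sqrt (h * D))\<^sup>2 + (K \<phi> + Ks \<phi> - D) + 64 * e\<^sup>2 * (M \<phi> + Ms \<phi> - m) \<and>
     (\<forall>L. 0 < L \<and> L \<le> h \<longrightarrow> (\<exists>b\<ge>0. L * b\<^sup>2 \<le> m \<and> \<bar>a' \<phi>\<bar> \<le> b + sqrt (L * D)))"
    if e: "0 < e" "\<phi> \<in> H" "\<forall>(f, u) \<in> set ks. e \<le> u \<longrightarrow> f \<phi> = 0" for e \<phi>
  proof -
    obtain D m where d: "0 \<le> D" "0 \<le> m"
      "U \<phi> \<le> v0 * (\<bar>a \<phi>\<bar> + sqrt (h0 * D))\<^sup>2 + (K \<phi> - D) + 64 * e\<^sup>2 * (M \<phi> - m)"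
      "\<And>L. 0 < L \<Longrightarrow> L \<le> h0 \<Longrightarrow> \<exists>b\<ge>0. L * b\<^sup>2 \<le> m \<and> \<bar>a \<phi>\<bar> \<le> b + sqrt (L * D)"
      using c0[OF e] by metis
    note K = Ks[OF e(2)] and M = Ms[OF e(2)]
    have sq: "sqrt (s * Ks \<phi>) \<le> sqrt (L * (D + Ks \<phi>))" if "s \<le> L" for L
      using that s d K by (intro real_sqrt_le_mono mult_mono) auto
    have i1: "v0 * (\<bar>a \<phi>\<bar> + sqrt (h0 * D))\<^sup>2 \<le> v0 * (\<bar>a' \<phi>\<bar> + sqrt (h * (D + Ks \<phi>)))\<^sup>2"
      using aa[OF e(2)] sqrt_add_le_sqrt_prod[of h0 D s "Ks \<phi>"] h0 s d K
      unfolding h_def by (intro mult_left_mono power_mono) auto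
    have i2: "\<omega> * (\<bar>a' \<phi>\<bar> + sqrt (s * Ks \<phi>))\<^sup>2 \<le> \<omega> * (\<bar>a' \<phi>\<bar> + sqrt (h * (D + Ks \<phi>)))\<^sup>2"
      using sq[of h] h0 s K by (intro mult_left_mono power_mono) (auto simp: h_def)
    have ineq: "y \<le> p + q + r \<Longrightarrow> z \<le> w \<Longrightarrow> p \<le> p' \<Longrightarrow> w \<le> w' \<Longrightarrow> y + z \<le> p' + w' + q + r"
      for y z p p' q r w w' :: real by linarith
    have "U \<phi> + Us \<phi> \<le> v * (\<bar>a' \<phi>\<bar> + sqrt (h * (D + Ks \<phi>)))\<^sup>2
        + (K \<phi> + Ks \<phi> - (D + Ks \<phi>)) + 64 * e\<^sup>2 * (M \<phi> + Ms \<phi> - (m + Ms \<phi>))"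
      unfolding v_def distrib_right add_diff_cancel_right
      by (rule ineq[OF d(3) Us[OF e(2)] i1 i2])
    moreover have "\<exists>b\<ge>0. L * b\<^sup>2 \<le> m + Ms \<phi> \<and> \<bar>a' \<phi>\<bar> \<le> b + sqrt (L * (D + Ks \<phi>))"
      if L: "0 < L" "L \<le> h" for L
      using small_value_extend[OF s(1) d(1) K d(2) M aa[OF e(2)] bs[OF e(2)] d(4)] L by (simp add: h_def)
    \<comment> \<open>The new segment joins the open piece with all of its energy and mass.\<close>
    ultimately show ?thesis using d K M by (intro exI[of _ "D + Ks \<phi>"] exI[of _ "m + Ms \<phi>"]) auto
  qed
  show ?thesis
  proof (cases "h * v \<le> 1/16")
    case True
    have h0': "0 \<le> h" using hv by simp
    have main: "\<forall>e>0. \<forall>\<phi>\<in>H. (\<forall>(f, u) \<in> set ks. e \<le> u \<longrightarrow> f \<phi> = 0) \<longrightarrow>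
          (\<exists>D m. 0 \<le> D \<and> 0 \<le> m \<and>
             U \<phi> + Us \<phi> \<le> v * (\<bar>a' \<phi>\<bar> + sqrt (h * D))\<^sup>2 + (K \<phi> + Ks \<phi> - D) + 64 * e\<^sup>2 * (M \<phi> + Ms \<phi> - m) \<and>
             (\<forall>L. 0 < L \<and> L \<le> h \<longrightarrow> (\<exists>b\<ge>0. L * b\<^sup>2 \<le> m \<and> \<bar>a' \<phi>\<bar> \<le> b + sqrt (L * D))))"
      using c by blast
    show ?thesis by (rule energy_coverI[OF h0' hv(3,2) True w ks main])
  next
    case False
    then have hv16: "1/16 < h * v" by simp
    then have vpos: "0 < v" using hv by (cases "v = 0") auto
    show ?thesis
    proof (rule energy_cover_cut[where v = v and ks = ks])
      fix e \<phi> assume e: "(0::real) < e" "\<phi> \<in> H" "\<forall>(f, u) \<in> set ks. e \<le> u \<longrightarrow> f \<phi> = 0"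
        and cs: "a' \<phi> = 0 \<or> v < e"
      obtain D m where d: "0 \<le> D" "0 \<le> m"
       "U \<phi> + Us \<phi> \<le> v * (\<bar>a' \<phi>\<bar> + sqrt (h * D))\<^sup>2 + (K \<phi> + Ks \<phi> - D) + 64 * e\<^sup>2 * (M \<phi> + Ms \<phi> - m)"
       "\<And>L. 0 < L \<and> L \<le> h \<longrightarrow> (\<exists>b\<ge>0. L * b\<^sup>2 \<le> m \<and> \<bar>a' \<phi>\<bar> \<le> b + sqrt (L * D))"
        using c[OF e] by blast
      have hvD: "h * v * D \<le> 1/8 * D" using hv8 d by (intro mult_right_mono) auto
      have "v * (\<bar>a' \<phi>\<bar> + sqrt (h * D))\<^sup>2 \<le> D + 64 * e\<^sup>2 * m"
      proof (cases "a' \<phi> = 0")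
        case True
        then have "v * (\<bar>a' \<phi>\<bar> + sqrt (h * D))\<^sup>2 = h * v * D" using hv d(1) by simp
        moreover have "0 \<le> 64 * e\<^sup>2 * m" using d(2) by simp
        ultimately show ?thesis using hvD d(1) by linarith
      next
        case False
        then have ve: "v < e" using cs by simp
        \<comment> \<open>The whole length \<open>h\<close> is used as \<open>L\<close>; with h * v
          \<le> 1/8 the term 8 * (h * v * D) below is at most \<open>D\<close>.\<close>
        obtain b where b: "b \<ge> 0" "h * b\<^sup>2 \<le> m" "\<bar>a' \<phi>\<bar> \<le> b + sqrt (h * D)" using d(4) hv by blast
        have "(\<bar>a' \<phi>\<bar> + sqrt (h * D))\<^sup>2 \<le> (b + 2 * sqrt (h * D))\<^sup>2"
          using b hv d by (intro power_mono) auto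
        also have "\<dots> \<le> 2 * b\<^sup>2 + 2 * (2 * sqrt (h * D))\<^sup>2" by (rule square_add_le)
        also have "\<dots> = 2 * b\<^sup>2 + 8 * (h * D)" using hv d by (simp add: power_mult_distrib)
        finally have "v * (\<bar>a' \<phi>\<bar> + sqrt (h * D))\<^sup>2 \<le> v * (2 * b\<^sup>2 + 8 * (h * D))" using vpos by simp
        also have "\<dots> = 2 * v * b\<^sup>2 + 8 * (h * v * D)" by (simp add: algebra_simps)
        also have "\<dots> \<le> 2 * v * b\<^sup>2 + D" using hvD by simp
        \<comment> \<open>Multiplication by 16 * h * v, which exceeds 1.\<close>
        also have "2 * v * b\<^sup>2 \<le> 32 * v\<^sup>2 * (h * b\<^sup>2)"
        proof -
          have "1/16 * (v * b\<^sup>2) \<le> h * v * (v * b\<^sup>2)" using hv16 vpos by (intro mult_right_mono) auto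
          then show ?thesis by (simp add: power2_eq_square algebra_simps)
        qed
        also have "32 * v\<^sup>2 * (h * b\<^sup>2) \<le> 64 * e\<^sup>2 * m"
          using ve vpos b hv by (intro mult_mono) (auto intro!: power_mono)
        finally show ?thesis by simp
      qed
      then show "U \<phi> + Us \<phi> \<le> K \<phi> + Ks \<phi> + 64 * e\<^sup>2 * (M \<phi> + Ms \<phi>)"
        using d(3) by (simp add: algebra_simps)
    qed (use hv w ks a'E in auto)
  qed
qed

section \<open>Sobolev functions on the edges\<close>

text \<open>The integral of (g - c)^2 is nonnegative, where \<open>c\<close> is the mean of
  \<open>g\<close>; multiplied by the length of the interval this is the claim.\<close>

lemma interval_Cauchy_Schwarz:
  fixes g :: "real \<Rightarrow> real"
  assumes ab: "a \<le> b" and g: "set_integrable lborel {a..b} g" "set_integrable lborel {a..b} (\<lambda>s. (g s)\<^sup>2)"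
  shows "(LINT s:{a..b}|lborel. g s)\<^sup>2 \<le> (b - a) * (LINT s:{a..b}|lborel. (g s)\<^sup>2)"
proof (cases "a = b")
  case True
  have "AE s in lborel. s \<noteq> b" by (rule AE_lborel_singleton)
  then have "AE s in lborel. indicator {b..b} s *\<^sub>R g s = 0" by eventually_elim auto
  then have "(LINT s:{b..b}|lborel. g s) = 0"
    unfolding set_lebesgue_integral_def by (rule integral_eq_zero_AE)
  then show ?thesis using True by simp
next
  case False
  define c where "c = (LINT s:{a..b}|lborel. g s) / (b - a)"
  have const: "set_integrable lborel {a..b} (\<lambda>_. c\<^sup>2)"
    by (intro borel_integrable_atLeastAtMost') auto
  have cg: "set_integrable lborel {a..b} (\<lambda>s. 2 * c * g s)"
    using set_integrable_mult_right[OF g(1), of "2 * c"] by simp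
  have "0 \<le> (LINT s:{a..b}|lborel. (g s)\<^sup>2 - 2 * c * g s + c\<^sup>2)"
    unfolding set_lebesgue_integral_def
    using sum_squares_bound[of "g _" c]
    by (intro Bochner_Integration.integral_nonneg) (auto simp: indicator_def algebra_simps power2_eq_square)
  also have "\<dots> = (LINT s:{a..b}|lborel. (g s)\<^sup>2) - 2 * c * (LINT s:{a..b}|lborel. g s) + c\<^sup>2 * (b - a)"
    using ab const cg g by (simp add: set_integral_add set_integral_diff set_integral_const)
  finally have "0 \<le> (b - a) * ((LINT s:{a..b}|lborel. (g s)\<^sup>2) - 2 * c * (LINT s:{a..b}|lborel. g s) + c\<^sup>2 * (b - a))"
    using ab by simp
  moreover have c: "c * (b - a) = (LINT s:{a..b}|lborel. g s)" using ab False by (simp add: c_def)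
  have "(b - a) * (Q - 2 * c * S + c\<^sup>2 * (b - a)) = (b - a) * Q - 2 * (c * (b - a)) * S + (c * (b - a))\<^sup>2" for Q S
    by (simp add: power2_eq_square algebra_simps)
  then have "(b - a) * ((LINT s:{a..b}|lborel. (g s)\<^sup>2) - 2 * c * (LINT s:{a..b}|lborel. g s) + c\<^sup>2 * (b - a))
     = (b - a) * (LINT s:{a..b}|lborel. (g s)\<^sup>2) - (LINT s:{a..b}|lborel. g s)\<^sup>2"
    unfolding c by (simp add: power2_eq_square)
  ultimately show ?thesis by simp
qed

lemma set_integral_Icc_split:
  fixes g :: "real \<Rightarrow> real"
  assumes "a \<le> b" "b \<le> c" "set_integrable lborel {a..c} g"
  shows "(LINT s:{a..c}|lborel. g s) = (LINT s:{a..b}|lborel. g s) + (LINT s:{b..c}|lborel. g s)"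
proof -
  have "AE s in lborel. s \<noteq> b" by (rule AE_lborel_singleton)
  then have "AE s in lborel. \<not> (s \<in> {a..b} \<and> s \<in> {b..c})" by eventually_elim auto
  moreover have "{a..c} = {a..b} \<union> {b..c}" using assms by auto
  moreover have "set_integrable lborel {a..b} g" "set_integrable lborel {b..c} g"
    using assms by (auto intro: set_integrable_subset[OF assms(3)])
  ultimately show ?thesis by (simp add: set_integral_Un_AE)
qed

section \<open>Integration over the tree, edge by edge\<close>

lemma sets_tree_measure [measurable_cong]:
  "sets (tree_measure Vt r len) = sets (count_space (Vt - {r}) \<Otimes>\<^sub>M lborel)"
  by (simp add: tree_measure_def)

lemma tree_measure_alt:
  "tree_measure Vt r len = density (count_space (Vt - {r}) \<Otimes>\<^sub>M lborel)
     (\<lambda>p. ennreal (indicator {0..len (fst p)} (snd p)))"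
  unfolding tree_measure_def by (intro arg_cong2[where f = density]) (auto simp: indicator_def)

lemma measurable_edge_indicator [measurable]:
  fixes len :: "nat \<Rightarrow> real"
  shows "(\<lambda>p. indicator {0..len (fst p)} (snd p) :: real)
     \<in> borel_measurable (count_space (E :: nat set) \<Otimes>\<^sub>M lborel)"
  by (rule measurable_pair_measure_countable1) auto

lemma pair_sigma_finite_edges: "pair_sigma_finite (count_space (E :: nat set)) lborel"
  by (intro pair_sigma_finite.intro sigma_finite_measure_count_space_countable lborel.sigma_finite_measure_axioms) auto

text \<open>Fubini for counting measure times Lebesgue measure. The sum over the edges is stated
  with \<open>has_sum\<close>, so that finite partial sums can bound and approximate the
  integral.\<close>

lemma
  fixes f :: "nat \<times> real \<Rightarrow> real"
  assumes f: "integrable (tree_measure Vt r len) f"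
  shows integrable_tree_edge: "x \<in> Vt - {r} \<Longrightarrow> set_integrable lborel {0..len x} (\<lambda>s. f (x, s))"
    and has_sum_tree_integral:
      "((\<lambda>x. LINT s:{0..len x}|lborel. f (x, s)) has_sum integral\<^sup>L (tree_measure Vt r len) f) (Vt - {r})"
proof -
  interpret pair_sigma_finite "count_space (Vt - {r})" lborel by (rule pair_sigma_finite_edges)
  have fm [measurable]: "f \<in> borel_measurable (count_space (Vt - {r}) \<Otimes>\<^sub>M lborel)"
    using borel_measurable_integrable[OF f] by measurable
  let ?g = "\<lambda>p. indicator {0..len (fst p)} (snd p) *\<^sub>R f p"
  have g: "integrable (count_space (Vt - {r}) \<Otimes>\<^sub>M lborel) ?g"
    using f unfolding tree_measure_alt by (subst (asm) integrable_density) auto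
  have e: "integral\<^sup>L (tree_measure Vt r len) f = integral\<^sup>L (count_space (Vt - {r}) \<Otimes>\<^sub>M lborel) ?g"
    unfolding tree_measure_alt by (rule integral_density) auto
  show "x \<in> Vt - {r} \<Longrightarrow> set_integrable lborel {0..len x} (\<lambda>s. f (x, s))"
    using AE_integrable_fst'[OF g] by (simp add: AE_count_space set_integrable_def)
  have "integrable (count_space (Vt - {r})) (\<lambda>x. LINT s:{0..len x}|lborel. f (x, s))"
    using integrable_fst'[OF g] by (simp add: set_lebesgue_integral_def)
  then have s: "Infinite_Set_Sum.abs_summable_on (\<lambda>x. LINT s:{0..len x}|lborel. f (x, s)) (Vt - {r})"
    by (simp add: abs_summable_on_def)
  have "infsetsum (\<lambda>x. LINT s:{0..len x}|lborel. f (x, s)) (Vt - {r}) = integral\<^sup>L (tree_measure Vt r len) f"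
    unfolding infsetsum_def e using integral_fst'[OF g] by (simp add: set_lebesgue_integral_def)
  then show "((\<lambda>x. LINT s:{0..len x}|lborel. f (x, s)) has_sum integral\<^sup>L (tree_measure Vt r len) f) (Vt - {r})"
    using has_sum_infsum[OF abs_summable_summable[OF s[folded abs_summable_equivalent]]]
    unfolding infsetsum_infsum[OF s] by simp
qed

section \<open>Functions in H1 on a single edge\<close>

locale neumann_tree =
  fixes Vt :: "nat set" and r :: nat and par :: "nat \<Rightarrow> nat" and len :: "nat \<Rightarrow> real"
  assumes tree: "metric_tree Vt r par len"
begin

abbreviation "edges \<equiv> Vt - {r}"
text \<open>Elements are pairs of a function and its derivative, since \<open>tree_H1\<close> takes
  the derivative as data and linear combinations have to act on both.\<close>

definition "H1 = {\<phi>. tree_H1 Vt r par len (fst \<phi>) (snd \<phi>)}"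
abbreviation "T \<equiv> tree_measure Vt r len"
definition "kin x a b \<phi> = (LINT s:{a..b}|lborel. (snd \<phi> x s)\<^sup>2)"
  for x :: nat and \<phi> :: "(nat \<Rightarrow> real \<Rightarrow> real) \<times> (nat \<Rightarrow> real \<Rightarrow> real)"
definition "mass x a b \<phi> = (LINT s:{a..b}|lborel. (fst \<phi> x s)\<^sup>2)"
  for x :: nat and \<phi> :: "(nat \<Rightarrow> real \<Rightarrow> real) \<times> (nat \<Rightarrow> real \<Rightarrow> real)"
definition "kin_total \<phi> = (LINT p|T. (snd \<phi> (fst p) (snd p))\<^sup>2)"
  for \<phi> :: "(nat \<Rightarrow> real \<Rightarrow> real) \<times> (nat \<Rightarrow> real \<Rightarrow> real)"
definition "mass_total \<phi> = (LINT p|T. (fst \<phi> (fst p) (snd p))\<^sup>2)"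
  for \<phi> :: "(nat \<Rightarrow> real \<Rightarrow> real) \<times> (nat \<Rightarrow> real \<Rightarrow> real)"

lemma len_pos: "x \<in> edges \<Longrightarrow> 0 < len x"
  using tree by (simp add: metric_tree_def)

lemma kin_nonneg: "0 \<le> kin x a b \<phi>" and mass_nonneg: "0 \<le> mass x a b \<phi>"
  unfolding kin_def mass_def set_lebesgue_integral_def
  by (auto intro!: Bochner_Integration.integral_nonneg)

context
  fixes \<phi> assumes \<phi>: "\<phi> \<in> H1"
begin

lemma H1_edge:
  assumes x: "x \<in> edges" and ab: "0 \<le> a" "b \<le> len x"
  shows "set_integrable lborel {a..b} (snd \<phi> x)"
    and "set_integrable lborel {a..b} (\<lambda>s. (snd \<phi> x s)\<^sup>2)"
    and "set_integrable lborel {a..b} (\<lambda>s. (fst \<phi> x s)\<^sup>2)"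
    and "a \<le> b \<Longrightarrow> fst \<phi> x b = fst \<phi> x a + (LINT s:{a..b}|lborel. snd \<phi> x s)"
proof -
  have H: "tree_H1 Vt r par len (fst \<phi>) (snd \<phi>)" using \<phi> by (simp add: H1_def)
  have sub: "{a..b} \<subseteq> {0..len x}" using ab by auto
  have i1: "set_integrable lborel {0..len x} (snd \<phi> x)" using H x unfolding tree_H1_def by blast
  have i2: "set_integrable lborel {0..len x} (\<lambda>s. (snd \<phi> x s)\<^sup>2)"
    using integrable_tree_edge[of Vt r len "\<lambda>p. (snd \<phi> (fst p) (snd p))\<^sup>2" x] H x
    unfolding tree_H1_def by simp
  have i3: "set_integrable lborel {0..len x} (\<lambda>s. (fst \<phi> x s)\<^sup>2)"
    using integrable_tree_edge[of Vt r len "\<lambda>p. (fst \<phi> (fst p) (snd p))\<^sup>2" x] H x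
    unfolding tree_H1_def by simp
  show "set_integrable lborel {a..b} (snd \<phi> x)" "set_integrable lborel {a..b} (\<lambda>s. (snd \<phi> x s)\<^sup>2)"
    "set_integrable lborel {a..b} (\<lambda>s. (fst \<phi> x s)\<^sup>2)"
    using set_integrable_subset[OF i1 _ sub] set_integrable_subset[OF i2 _ sub] set_integrable_subset[OF i3 _ sub]
    by auto
  assume "a \<le> b"
  have f: "fst \<phi> x t = fst \<phi> x 0 + (LINT s:{0..t}|lborel. snd \<phi> x s)" if "t \<in> {0..len x}" for t
    using H x that unfolding tree_H1_def by blast
  have "set_integrable lborel {0..b} (snd \<phi> x)"
    using ab by (intro set_integrable_subset[OF i1]) auto
  then show "fst \<phi> x b = fst \<phi> x a + (LINT s:{a..b}|lborel. snd \<phi> x s)"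
    using f[of a] f[of b] ab \<open>a \<le> b\<close> set_integral_Icc_split[of 0 a b "snd \<phi> x"] by auto
qed

lemma H1_vertex: "y \<in> edges \<Longrightarrow> par y \<noteq> r \<Longrightarrow> fst \<phi> y 0 = fst \<phi> (par y) (len (par y))"
  using \<phi> unfolding H1_def tree_H1_def by blast

lemma H1_total:
  shows "((\<lambda>x. kin x 0 (len x) \<phi>) has_sum kin_total \<phi>) edges"
    and "((\<lambda>x. mass x 0 (len x) \<phi>) has_sum mass_total \<phi>) edges"
  using \<phi> has_sum_tree_integral[of Vt r len "\<lambda>p. (snd \<phi> (fst p) (snd p))\<^sup>2"]
    has_sum_tree_integral[of Vt r len "\<lambda>p. (fst \<phi> (fst p) (snd p))\<^sup>2"]
  unfolding H1_def tree_H1_def kin_total_def mass_total_def kin_def mass_def by auto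

lemma kin_split:
  assumes "x \<in> edges" "0 \<le> a" "a \<le> b" "b \<le> c" "c \<le> len x"
  shows "kin x a c \<phi> = kin x a b \<phi> + kin x b c \<phi>" "mass x a c \<phi> = mass x a b \<phi> + mass x b c \<phi>"
  unfolding kin_def mass_def using assms by (auto intro!: set_integral_Icc_split H1_edge)

lemma kin_mono:
  assumes "x \<in> edges" "0 \<le> a" "a \<le> a'" "a' \<le> b'" "b' \<le> b" "b \<le> len x"
  shows "kin x a' b' \<phi> \<le> kin x a b \<phi>" "mass x a' b' \<phi> \<le> mass x a b \<phi>"
  using kin_split[of x a a' b] kin_split[of x a' b' b] assms
    kin_nonneg[of x a a' \<phi>] kin_nonneg[of x b' b \<phi>] mass_nonneg[of x a a' \<phi>] mass_nonneg[of x b' b \<phi>] by auto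

lemma H1_oscillation:
  assumes x: "x \<in> edges" and ab: "0 \<le> a" "a \<le> b" "b \<le> len x"
  shows "\<bar>fst \<phi> x b - fst \<phi> x a\<bar> \<le> sqrt ((b - a) * kin x a b \<phi>)"
  unfolding kin_def using H1_edge[OF x, of a b] ab
  by (intro real_le_rsqrt) (auto intro!: interval_Cauchy_Schwarz)

text \<open>This is the last clause of \<open>energy_cover\<close> for one segment. The infimum of
  |\<phi>| over the segment is at most the quadratic mean, and the value at \<open>a\<close> exceeds
  any other value by at most the oscillation.\<close>

lemma H1_small_value:
  assumes x: "x \<in> edges" and ab: "0 \<le> a" "a + L \<le> len x" "0 < L"
  shows "\<exists>b\<ge>0. L * b\<^sup>2 \<le> mass x a (a + L) \<phi> \<and> \<bar>fst \<phi> x a\<bar> \<le> b + sqrt (L * kin x a (a + L) \<phi>)"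
proof (intro exI conjI)
  let ?b = "INF s\<in>{a..a+L}. \<bar>fst \<phi> x s\<bar>"
  have bdd: "bdd_below ((\<lambda>s. \<bar>fst \<phi> x s\<bar>) ` {a..a+L})" by (rule bdd_belowI2[of _ 0]) auto
  show b0: "0 \<le> ?b" using ab by (intro cINF_greatest) auto
  have le: "?b \<le> \<bar>fst \<phi> x s\<bar>" if "s \<in> {a..a+L}" for s using that bdd by (rule cINF_lower[rotated])
  have "L * ?b\<^sup>2 = (LINT s:{a..a+L}|lborel. ?b\<^sup>2)"
    using ab by (subst set_integral_const) auto
  also have "\<dots> \<le> (LINT s:{a..a+L}|lborel. (fst \<phi> x s)\<^sup>2)"
  proof (rule set_integral_mono)
    show "set_integrable lborel {a..a+L} (\<lambda>_. ?b\<^sup>2)"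
      by (intro borel_integrable_atLeastAtMost') auto
    show "set_integrable lborel {a..a+L} (\<lambda>s. (fst \<phi> x s)\<^sup>2)" using H1_edge(3)[OF x ab(1,2)] .
    show "?b\<^sup>2 \<le> (fst \<phi> x s)\<^sup>2" if "s \<in> {a..a+L}" for s
      using power_mono[OF le[OF that] b0, of 2] by simp
  qed
  finally show "L * ?b\<^sup>2 \<le> mass x a (a + L) \<phi>" by (simp add: mass_def)
  have "\<bar>fst \<phi> x a\<bar> - sqrt (L * kin x a (a + L) \<phi>) \<le> \<bar>fst \<phi> x s\<bar>" if s: "s \<in> {a..a+L}" for s
  proof -
    have "\<bar>fst \<phi> x s - fst \<phi> x a\<bar> \<le> sqrt ((s - a) * kin x a s \<phi>)"
      using s ab by (intro H1_oscillation x) auto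
    also have "\<dots> \<le> sqrt (L * kin x a (a + L) \<phi>)"
      using s ab x by (intro real_sqrt_le_mono mult_mono kin_mono kin_nonneg) auto
    finally show ?thesis by linarith
  qed
  then have "\<bar>fst \<phi> x a\<bar> - sqrt (L * kin x a (a + L) \<phi>) \<le> ?b"
    using ab by (intro cINF_greatest) auto
  then show "\<bar>fst \<phi> x a\<bar> \<le> ?b + sqrt (L * kin x a (a + L) \<phi>)" by simp
qed

end

end

section \<open>Generations and paths\<close>

context neumann_tree
begin

abbreviation "gen \<equiv> tree_gen r par"
definition "children x = {y \<in> edges. par y = x}"

lemma reaches_root: "x \<in> edges \<Longrightarrow> \<exists>n. (par ^^ n) x = r"
  using tree unfolding metric_tree_def by blast

lemma gen_Suc: "x \<in> edges \<Longrightarrow> gen x = Suc (gen (par x))"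
proof -
  assume x: "x \<in> edges"
  then obtain n where n: "(par ^^ n) x = r" using reaches_root by blast
  have "\<not> (par ^^ 0) x = r" using x by simp
  then have "(LEAST n. (par ^^ n) x = r) = Suc (LEAST m. (par ^^ Suc m) x = r)"
    using n by (intro Least_Suc) auto
  then show ?thesis by (simp add: tree_gen_def funpow_swap1)
qed

lemma gen_root: "gen r = 0"
  by (simp add: tree_gen_def Least_eq_0)

lemma par_in: "x \<in> edges \<Longrightarrow> par x \<noteq> r \<Longrightarrow> par x \<in> edges"
  using tree by (simp add: metric_tree_def)

lemma ancestor: "x \<in> edges \<Longrightarrow> i < gen x \<Longrightarrow> (par ^^ i) x \<in> edges \<and> gen ((par ^^ i) x) = gen x - i"
proof (induction i)
  case (Suc i)
  then have *: "(par ^^ i) x \<in> edges" "gen ((par ^^ i) x) = gen x - i" by auto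
  then have "gen (par ((par ^^ i) x)) = gen x - Suc i" using gen_Suc[of "(par ^^ i) x"] by simp
  moreover from this have "par ((par ^^ i) x) \<noteq> r" using Suc.prems gen_root by auto
  ultimately show ?case using par_in[of "(par ^^ i) x"] * by simp
qed simp

lemma ancestor_root: "x \<in> edges \<Longrightarrow> par ((par ^^ (gen x - 1)) x) = r"
proof -
  assume x: "x \<in> edges"
  then obtain n where "(par ^^ n) x = r" using reaches_root by blast
  then have "(par ^^ gen x) x = r" unfolding tree_gen_def by (rule LeastI)
  moreover obtain n where "gen x = Suc n" using gen_Suc[OF x] by blast
  ultimately show ?thesis by simp
qed

lemma vdepth_rec: "x \<in> edges \<Longrightarrow> vdepth r par len x = vdepth r par len (par x) + len x"
  unfolding vdepth_def by (simp add: gen_Suc sum.lessThan_Suc_shift funpow_swap1 del: sum.lessThan_Suc)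

text \<open>The edges on the way to the root have different generations and are therefore
  distinct.\<close>

lemma sum_ancestors_le:
  fixes f :: "nat \<Rightarrow> real"
  assumes x: "x \<in> edges" and f: "(f has_sum S) edges" "\<And>y. 0 \<le> f y" and j: "j \<le> gen x"
  shows "(\<Sum>i<j. f ((par ^^ i) x)) \<le> S"
proof -
  have "inj_on (\<lambda>i. (par ^^ i) x) {..<j}"
  proof (rule inj_onI)
    fix i k assume "i \<in> {..<j}" "k \<in> {..<j}" "(par ^^ i) x = (par ^^ k) x"
    then have "gen x - i = gen x - k" "i < gen x" "k < gen x" using ancestor[OF x] j by (metis lessThan_iff less_le_trans)+
    then show "i = k" by simp
  qed
  then have "(\<Sum>i<j. f ((par ^^ i) x)) = sum f ((\<lambda>i. (par ^^ i) x) ` {..<j})"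
    by (simp add: sum.reindex)
  also have "\<dots> \<le> S"
  proof (intro finite_sum_le_has_sum[OF f(1)] f(2))
    show "(\<lambda>i. (par ^^ i) x) ` {..<j} \<subseteq> edges"
      using ancestor[OF x] j by (intro image_subsetI) (metis lessThan_iff less_le_trans)
  qed simp
  finally show ?thesis .
qed

lemma finite_children: "x \<in> Vt \<Longrightarrow> finite (children x)"
  unfolding children_def using tree unfolding metric_tree_def
  by (cases "x = r") (auto intro: card_ge_0_finite)

section \<open>Levels and truncations of the tree\<close>

definition "root_edge = (THE e. children r = {e})"

lemma children_root: "children r = {root_edge}"
proof -
  have "card (children r) = 1" using tree by (simp add: metric_tree_def children_def)
  then obtain e where "children r = {e}" by (auto simp: card_1_singleton_iff)
  then show ?thesis unfolding root_edge_def by auto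
qed

lemma root_edge: "root_edge \<in> edges" "par root_edge = r"
  using children_root unfolding children_def by auto

lemma root_edgeI: "x \<in> edges \<Longrightarrow> par x = r \<Longrightarrow> x = root_edge"
  using children_root unfolding children_def by auto

text \<open>The shift by one arises because the generation of an edge is that of its endpoint away
  from the root: the root edge has generation 1 and forms level 0.\<close>

definition "level n = {x \<in> edges. gen x = Suc n}"

lemma level_0: "level 0 = {root_edge}"
proof -
  have "x = root_edge" if x: "x \<in> level 0" for x
  proof -
    have xe: "x \<in> edges" "gen x = Suc 0" using x by (auto simp: level_def)
    have "par x = r"
    proof (rule ccontr)
      assume "par x \<noteq> r"
      then show False using gen_Suc[OF xe(1)] gen_Suc[OF par_in[OF xe(1)]] xe(2) by simp
    qed
    then show ?thesis by (rule root_edgeI[OF xe(1)])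
  qed
  then have "level 0 \<subseteq> {root_edge}" by (intro subsetI) (rule singleton_iff[THEN iffD2])
  moreover have "gen root_edge = Suc 0" using gen_Suc[OF root_edge(1)] root_edge(2) gen_root by simp
  then have "root_edge \<in> level 0" using root_edge(1) by (simp add: level_def)
  ultimately show ?thesis by (intro equalityI) simp_all
qed

lemma level_Suc: "level (Suc n) = (\<Union>x\<in>level n. children x)"
proof -
  have "par y \<in> edges \<and> gen (par y) = Suc n" if y: "y \<in> edges" "gen y = Suc (Suc n)" for y
  proof -
    have "gen (par y) = Suc n" using gen_Suc[OF y(1)] y(2) by simp
    moreover from this have "par y \<noteq> r" using gen_root by auto
    ultimately show ?thesis using par_in[OF y(1)] by blast
  qed
  moreover have "gen y = Suc (Suc n)" if "y \<in> edges" "gen (par y) = Suc n" for y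
    using gen_Suc[OF that(1)] that(2) by simp
  ultimately show ?thesis unfolding level_def children_def by blast
qed

lemma finite_level: "finite (level n)"
proof (induction n)
  case (Suc n)
  then show ?case unfolding level_Suc by (auto intro!: finite_children simp: level_def)
qed (simp add: level_0)

text \<open>The sum of \<open>g\<close> over \<open>x\<close> and its descendants, \<open>k\<close>
  generations in all. The recursion has the order of the covering procedure: first the branches at
  the far end are put together, then the edge \<open>x\<close> is added.\<close>

primrec branch_sum :: "nat \<Rightarrow> (nat \<Rightarrow> real) \<Rightarrow> nat \<Rightarrow> real" where
  "branch_sum 0 g x = 0"
| "branch_sum (Suc k) g x = (\<Sum>y\<in>children x. branch_sum k g y) + g x"

text \<open>Different edges have disjoint sets of children, so the sum over a level of the sums over
  children is the sum over the next level.\<close>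

lemma sum_level_branch_sum:
  "(\<Sum>x\<in>level n. branch_sum k g x) = (\<Sum>j<k. \<Sum>x\<in>level (n + j). g x)"
proof (induction k arbitrary: n)
  case (Suc k)
  have "(\<Sum>x\<in>level n. branch_sum (Suc k) g x)
      = (\<Sum>x\<in>level n. \<Sum>y\<in>children x. branch_sum k g y) + (\<Sum>x\<in>level n. g x)"
    by (simp add: sum.distrib)
  also have "(\<Sum>x\<in>level n. \<Sum>y\<in>children x. branch_sum k g y) = (\<Sum>y\<in>level (Suc n). branch_sum k g y)"
    unfolding level_Suc
    by (intro sum.UNION_disjoint[symmetric] finite_level ballI finite_children)
      (auto simp: level_def children_def)
  also have "\<dots> = (\<Sum>j<k. \<Sum>x\<in>level (n + Suc j). g x)" by (simp add: Suc)
  finally show ?case by (simp add: sum.lessThan_Suc_shift del: sum.lessThan_Suc)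
qed simp

definition "truncation N = (\<Union>j<N. level j)"

lemma finite_truncation: "finite (truncation N)"
  and truncation_subset: "truncation N \<subseteq> edges"
  unfolding truncation_def using finite_level by (auto simp: level_def)

lemma branch_sum_root: "branch_sum N g root_edge = sum g (truncation N)"
proof -
  have "branch_sum N g root_edge = (\<Sum>j<N. sum g (level j))"
    using sum_level_branch_sum[where n = 0 and k = N and g = g] by (simp add: level_0)
  also have "\<dots> = sum g (truncation N)"
    unfolding truncation_def
    by (rule sum.UNION_disjoint[symmetric]) (use finite_level in \<open>auto simp: level_def\<close>)
  finally show ?thesis .
qed

lemma finite_subset_truncation: "finite F \<Longrightarrow> F \<subseteq> edges \<Longrightarrow> \<exists>N. F \<subseteq> truncation N"
proof (induction rule: finite_induct)
  case (insert x F)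
  then obtain N where N: "F \<subseteq> truncation N" by auto
  have "x \<in> level (gen x - 1)" using insert.prems gen_Suc[of x] by (simp add: level_def)
  then have "insert x F \<subseteq> truncation (max N (gen x))"
    using N gen_Suc[of x] insert.prems by (fastforce simp: truncation_def)
  then show ?case by blast
qed simp

text \<open>Infinite height enters here: \<open>L\<close> may be arbitrarily large, whatever part of
  the tree carries the potential. The bound for one segment is extended along a path from a deep
  vertex up to the root.\<close>

lemma root_small_value:
  assumes \<phi>: "\<phi> \<in> H1" and L: "0 < L"
  shows "\<exists>b\<ge>0. L * b\<^sup>2 \<le> mass_total \<phi> \<and> \<bar>fst \<phi> root_edge 0\<bar> \<le> b + sqrt (L * kin_total \<phi>)"
proof -
  obtain x where x: "x \<in> edges" "L < vdepth r par len x"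
    using tree unfolding metric_tree_def by blast
  define k where "k i = kin ((par ^^ i) x) 0 (len ((par ^^ i) x)) \<phi>" for i
  define m where "m i = mass ((par ^^ i) x) 0 (len ((par ^^ i) x)) \<phi>" for i
  have nn: "0 \<le> k i" "0 \<le> m i" for i by (auto simp: k_def m_def kin_nonneg mass_nonneg)
  have seg: "\<exists>b\<ge>0. L * b\<^sup>2 \<le> mass y 0 (len y) \<phi> \<and> \<bar>fst \<phi> y 0\<bar> \<le> b + sqrt (L * kin y 0 (len y) \<phi>)"
    if yL: "y \<in> edges" "0 < L" "L \<le> len y" for y L
  proof -
    obtain b where b: "b \<ge> 0" "L * b\<^sup>2 \<le> mass y 0 L \<phi>" "\<bar>fst \<phi> y 0\<bar> \<le> b + sqrt (L * kin y 0 L \<phi>)"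
      using H1_small_value[OF \<phi> yL(1), of 0 L] yL by auto
    have "kin y 0 L \<phi> \<le> kin y 0 (len y) \<phi>" "mass y 0 L \<phi> \<le> mass y 0 (len y) \<phi>"
      using kin_mono[OF \<phi> yL(1), of 0 0 L "len y"] yL by auto
    then have "sqrt (L * kin y 0 L \<phi>) \<le> sqrt (L * kin y 0 (len y) \<phi>)" using yL by simp
    then show ?thesis using b \<open>mass y 0 L \<phi> \<le> mass y 0 (len y) \<phi>\<close>
      by (intro exI[of _ b] conjI) linarith+
  qed
  \<comment> \<open>Climbing from \<open>x\<close>: the \<open>j + 1\<close> lowest edges of the
    path are in use, and the value is taken at the end of the last of them that faces the
    root.\<close>
  have step: "j < gen x \<Longrightarrow> 0 < L \<Longrightarrow> L \<le> (\<Sum>i<Suc j. len ((par ^^ i) x)) \<Longrightarrow>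
     \<exists>b\<ge>0. L * b\<^sup>2 \<le> (\<Sum>i<Suc j. m i) \<and> \<bar>fst \<phi> ((par ^^ j) x) 0\<bar> \<le> b + sqrt (L * (\<Sum>i<Suc j. k i))" for j L
  proof (induction j arbitrary: L)
    case 0
    then show ?case using seg[of x L] x by (simp add: k_def m_def)
  next
    case (Suc j)
    define y where "y = (par ^^ Suc j) x"
    have y: "y \<in> edges" using ancestor[OF x(1), of "Suc j"] Suc.prems by (simp add: y_def)
    have z: "(par ^^ j) x \<in> edges" "par ((par ^^ j) x) = y"
      using ancestor[OF x(1), of j] Suc.prems by (auto simp: y_def)
    have "fst \<phi> ((par ^^ j) x) 0 = fst \<phi> y (len y)"
      using H1_vertex[OF \<phi> z(1)] z(2) y by auto
    then have osc: "\<bar>fst \<phi> ((par ^^ j) x) 0 - fst \<phi> y 0\<bar> \<le> sqrt (len y * k (Suc j))"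
      using H1_oscillation[OF \<phi> y, of 0 "len y"] len_pos[OF y] by (simp add: k_def y_def)
    have "\<exists>b\<ge>0. L * b\<^sup>2 \<le> (\<Sum>i<Suc j. m i) + m (Suc j) \<and>
        \<bar>fst \<phi> y 0\<bar> \<le> b + sqrt (L * ((\<Sum>i<Suc j. k i) + k (Suc j)))"
    proof (rule small_value_extend[OF len_pos[OF y] _ _ _ _ osc, where h = "\<Sum>i<Suc j. len ((par ^^ i) x)"])
      show "\<exists>b\<ge>0. L * b\<^sup>2 \<le> m (Suc j) \<and> \<bar>fst \<phi> y 0\<bar> \<le> b + sqrt (L * k (Suc j))"
        if "0 < L" "L \<le> len y" for L using seg[OF y that] by (simp add: k_def m_def y_def)
      show "L \<le> (\<Sum>i<Suc j. len ((par ^^ i) x)) + len y" using Suc.prems(3) by (simp add: y_def)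
    qed (use Suc nn in \<open>auto intro!: sum_nonneg add_nonneg_nonneg\<close>)
    then show ?case by (simp add: y_def)
  qed
  have g: "gen x = Suc (gen x - 1)" using gen_Suc[OF x(1)] by simp
  have "(par ^^ (gen x - 1)) x = root_edge"
    using ancestor[OF x(1), of "gen x - 1"] ancestor_root[OF x(1)] g by (intro root_edgeI) auto
  moreover have "L \<le> (\<Sum>i<Suc (gen x - 1). len ((par ^^ i) x))"
    using x(2) g unfolding vdepth_def by simp
  ultimately obtain b where b: "b \<ge> 0" "L * b\<^sup>2 \<le> (\<Sum>i<gen x. m i)"
      "\<bar>fst \<phi> root_edge 0\<bar> \<le> b + sqrt (L * (\<Sum>i<gen x. k i))"
    using step[of "gen x - 1" L] L g by (metis lessI)
  have "(\<Sum>i<gen x. m i) \<le> mass_total \<phi>" "(\<Sum>i<gen x. k i) \<le> kin_total \<phi>"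
    unfolding m_def k_def
    by (rule sum_ancestors_le[OF x(1)]; (rule H1_total[OF \<phi>] kin_nonneg mass_nonneg order_refl))+
  moreover from this(2) have "sqrt (L * (\<Sum>i<gen x. k i)) \<le> sqrt (L * kin_total \<phi>)" using L by simp
  ultimately show ?thesis using b by (intro exI[of _ b] conjI) linarith+
qed

text \<open>The oscillations along the path from the root add up by
  \<open>sqrt_add_le_sqrt_prod\<close> and by continuity at the vertices. The nonnegativity of the
  distance is carried through the induction because that lemma asks for it.\<close>

lemma root_distance_bound:
  assumes \<phi>: "\<phi> \<in> H1" and "x \<in> edges" "0 \<le> t" "t \<le> len x"
  shows "\<bar>fst \<phi> x t - fst \<phi> root_edge 0\<bar>
     \<le> sqrt (point_dist r par len x t * (\<Sum>i<gen x. kin ((par ^^ i) x) 0 (len ((par ^^ i) x)) \<phi>))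
   \<and> 0 \<le> point_dist r par len x t"
  using assms(2-)
proof (induction "gen x" arbitrary: x t rule: less_induct)
  case less
  let ?k = "\<lambda>x. \<Sum>i<gen x. kin ((par ^^ i) x) 0 (len ((par ^^ i) x)) \<phi>"
  note x = less.prems(1)
  have k: "?k x = ?k (par x) + kin x 0 (len x) \<phi>"
    by (simp add: gen_Suc[OF x] sum.lessThan_Suc_shift funpow_swap1 del: sum.lessThan_Suc)
  have "\<bar>fst \<phi> x t - fst \<phi> x 0\<bar> \<le> sqrt (t * kin x 0 t \<phi>)"
    using H1_oscillation[OF \<phi> x, of 0 t] less.prems by simp
  also have "\<dots> \<le> sqrt (t * kin x 0 (len x) \<phi>)"
    using less.prems \<phi> by (intro real_sqrt_le_mono mult_left_mono kin_mono) auto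
  finally have o: "\<bar>fst \<phi> x t - fst \<phi> x 0\<bar> \<le> sqrt (t * kin x 0 (len x) \<phi>)" .
  have knn: "0 \<le> ?k y" for y by (intro sum_nonneg kin_nonneg)
  have pd: "point_dist r par len x t = vdepth r par len (par x) + t"
    using vdepth_rec[OF x] by (simp add: point_dist_def)
  have v: "\<bar>fst \<phi> x 0 - fst \<phi> root_edge 0\<bar> \<le> sqrt (vdepth r par len (par x) * ?k (par x)) \<and> 0 \<le> vdepth r par len (par x)"
  proof (cases "par x = r")
    case True
    then show ?thesis using root_edgeI[OF x] by (simp add: vdepth_def gen_root)
  next
    case False
    note p = par_in[OF x False]
    show ?thesis
      using less.hyps[of "par x" "len (par x)"] gen_Suc[OF x] p len_pos[OF p] H1_vertex[OF \<phi> x False]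
      by (simp add: point_dist_def)
  qed
  have "\<bar>fst \<phi> x t - fst \<phi> root_edge 0\<bar> \<le> sqrt (vdepth r par len (par x) * ?k (par x)) + sqrt (t * kin x 0 (len x) \<phi>)"
    using v o by linarith
  also have "\<dots> \<le> sqrt (point_dist r par len x t * ?k x)"
    unfolding pd k by (rule sqrt_add_le_sqrt_prod) (use v knn less.prems in \<open>auto simp: kin_nonneg\<close>)
  finally show ?case using pd v less.prems by auto
qed

text \<open>A Sobolev bound in the ball of radius \<open>R\<close>, later used on the edges outside
  a truncation. The value at the root is controlled by a path of length 1; the factor 3 is that of
  (x + y + z)^2 \<le> 3 * (x^2 + y^2 + z^2).\<close>

lemma H1_bound:
  assumes \<phi>: "\<phi> \<in> H1" and x: "x \<in> edges" "0 \<le> t" "t \<le> len x" and R: "point_dist r par len x t \<le> R"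
  shows "(fst \<phi> x t)\<^sup>2 \<le> 3 * (1 + R) * (kin_total \<phi> + mass_total \<phi>)"
proof -
  let ?k = "\<Sum>i<gen x. kin ((par ^^ i) x) 0 (len ((par ^^ i) x)) \<phi>"
  let ?K = "kin_total \<phi>" and ?M = "mass_total \<phi>"
  note d = root_distance_bound[OF \<phi> x]
  have k: "0 \<le> ?k" "?k \<le> ?K"
    by (intro sum_nonneg kin_nonneg)
      (rule sum_ancestors_le[OF x(1)]; (rule H1_total[OF \<phi>] kin_nonneg order_refl))
  obtain b where b: "b \<ge> 0" "b\<^sup>2 \<le> ?M" "\<bar>fst \<phi> root_edge 0\<bar> \<le> b + sqrt ?K"
    using root_small_value[OF \<phi>, of 1] by auto
  have R0: "0 \<le> R" using d R by linarith
  have "sqrt (point_dist r par len x t * ?k) \<le> sqrt (R * ?K)"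
    using k R d R0 by (intro real_sqrt_le_mono mult_mono) auto
  then have "\<bar>fst \<phi> x t\<bar> \<le> b + sqrt ?K + sqrt (R * ?K)" using d b by linarith
  then have "(fst \<phi> x t)\<^sup>2 \<le> (b + sqrt ?K + sqrt (R * ?K))\<^sup>2" by (metis abs_ge_zero power2_abs power_mono)
  also have "\<dots> \<le> 3 * b\<^sup>2 + 3 * (sqrt ?K)\<^sup>2 + 3 * (sqrt (R * ?K))\<^sup>2"
    using sum_squares_bound[of b "sqrt ?K"] sum_squares_bound[of b "sqrt (R * ?K)"]
      sum_squares_bound[of "sqrt ?K" "sqrt (R * ?K)"]
    by (simp add: power2_eq_square algebra_simps)
  also have "\<dots> \<le> 3 * ?M + 3 * ?K + 3 * (R * ?K)" using b k R0 by simp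
  also have "\<dots> \<le> 3 * (1 + R) * (?K + ?M)"
    using R0 order_trans[OF zero_le_power2 b(2)] by (simp add: algebra_simps)
  finally show ?thesis .
qed

end

section \<open>Covering a metric tree\<close>

locale tree_potential = neumann_tree +
  fixes W :: "nat \<Rightarrow> real \<Rightarrow> real" and B :: real
  assumes W_measurable: "\<And>x. x \<in> edges \<Longrightarrow> W x \<in> borel_measurable borel"
    and W_nonneg: "\<And>x s. x \<in> edges \<Longrightarrow> s \<in> {0..len x} \<Longrightarrow> 0 \<le> W x s"
    and W_le: "\<And>x s. x \<in> edges \<Longrightarrow> s \<in> {0..len x} \<Longrightarrow> W x s \<le> B"
    and B_nonneg: "0 \<le> B"
begin

definition "pot x a b = (LINT s:{a..b}|lborel. W x s)"
definition "pot_energy x a b \<phi> = (LINT s:{a..b}|lborel. W x s * (fst \<phi> x s)\<^sup>2)"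
  for x :: nat and \<phi> :: "(nat \<Rightarrow> real \<Rightarrow> real) \<times> (nat \<Rightarrow> real \<Rightarrow> real)"
text \<open>Point evaluations are linear on linear combinations of functions, so the conditions
  attached to closed pieces become linear equations for the coefficients.\<close>

definition "evals = range (\<lambda>(x, t) (\<phi> :: (nat \<Rightarrow> real \<Rightarrow> real) \<times> (nat \<Rightarrow> real \<Rightarrow> real)). fst \<phi> x t)"

lemma eval_in_evals: "(\<lambda>\<phi>. fst \<phi> x t) \<in> evals"
  unfolding evals_def by (rule range_eqI[of _ _ "(x, t)"]) simp

lemma set_integrable_W_mult:
  assumes x: "x \<in> edges" and ab: "0 \<le> a" "b \<le> len x" and g: "set_integrable lborel {a..b} g"
  shows "set_integrable lborel {a..b} (\<lambda>s. W x s * g s)"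
proof (rule set_integrable_bound[where f = "\<lambda>s. B * g s"])
  show "set_integrable lborel {a..b} (\<lambda>s. B * g s)" using g by (rule set_integrable_mult_right)
  have "(\<lambda>s. W x s * (indicator {a..b} s *\<^sub>R g s)) \<in> borel_measurable lborel"
    using W_measurable[OF x] borel_measurable_integrable[OF g[unfolded set_integrable_def]] by measurable
  then show "set_borel_measurable lborel {a..b} (\<lambda>s. W x s * g s)"
    unfolding set_borel_measurable_def by (simp add: ac_simps)
  show "AE s in lborel. s \<in> {a..b} \<longrightarrow> norm (W x s * g s) \<le> norm (B * g s)"
  proof (intro AE_I2 impI)
    fix s assume "s \<in> {a..b}"
    then have s: "s \<in> {0..len x}" using ab by auto
    show "norm (W x s * g s) \<le> norm (B * g s)"
      using W_nonneg[OF x s] W_le[OF x s] B_nonneg by (simp add: abs_mult mult_right_mono)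
  qed
qed

lemma set_integrable_W:
  assumes "x \<in> edges" "0 \<le> a" "b \<le> len x"
  shows "set_integrable lborel {a..b} (W x)"
  using set_integrable_W_mult[OF assms, of "\<lambda>_. 1"] by (simp add: borel_integrable_atLeastAtMost')

lemma pot_split:
  assumes "x \<in> edges" "0 \<le> a" "a \<le> b" "b \<le> c" "c \<le> len x"
  shows "pot x a c = pot x a b + pot x b c"
  unfolding pot_def using assms by (auto intro!: set_integral_Icc_split set_integrable_W)

lemma pot_energy_split:
  assumes "\<phi> \<in> H1" "x \<in> edges" "0 \<le> a" "a \<le> b" "b \<le> c" "c \<le> len x"
  shows "pot_energy x a c \<phi> = pot_energy x a b \<phi> + pot_energy x b c \<phi>"
  unfolding pot_energy_def using assms
  by (auto intro!: set_integral_Icc_split set_integrable_W_mult H1_edge)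

lemma pot_nonneg: "x \<in> edges \<Longrightarrow> 0 \<le> a \<Longrightarrow> b \<le> len x \<Longrightarrow> 0 \<le> pot x a b"
  unfolding pot_def set_lebesgue_integral_def
  by (intro Bochner_Integration.integral_nonneg) (auto simp: indicator_def intro!: W_nonneg)

lemma pot_le: "x \<in> edges \<Longrightarrow> 0 \<le> a \<Longrightarrow> a \<le> b \<Longrightarrow> b \<le> len x \<Longrightarrow> pot x a b \<le> B * (b - a)"
proof -
  assume x: "x \<in> edges" "0 \<le> a" "a \<le> b" "b \<le> len x"
  have "pot x a b \<le> (LINT s:{a..b}|lborel. B)"
    unfolding pot_def using x
    by (intro set_integral_mono set_integrable_W W_le borel_integrable_atLeastAtMost') auto
  also have "\<dots> = B * (b - a)" using x by (simp add: set_integral_const)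
  finally show ?thesis .
qed

text \<open>The bound \<open>S\<close> is required only where \<open>W\<close> is nonzero, so that a
  bound valid in a ball carrying \<open>W\<close> suffices.\<close>

lemma pot_energy_le_sup:
  assumes \<phi>: "\<phi> \<in> H1" and x: "x \<in> edges" "0 \<le> a" "b \<le> len x"
    and S: "\<And>s. s \<in> {a..b} \<Longrightarrow> W x s \<noteq> 0 \<Longrightarrow> (fst \<phi> x s)\<^sup>2 \<le> S"
  shows "pot_energy x a b \<phi> \<le> S * pot x a b"
proof -
  have "pot_energy x a b \<phi> \<le> (LINT s:{a..b}|lborel. W x s * S)"
    unfolding pot_energy_def
  proof (rule set_integral_mono)
    show "set_integrable lborel {a..b} (\<lambda>s. W x s * S)"
      by (rule set_integrable_mult_left) (use set_integrable_W x in auto)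
    show "W x s * (fst \<phi> x s)\<^sup>2 \<le> W x s * S" if "s \<in> {a..b}" for s
      using S[OF that] W_nonneg[OF x(1), of s] that x by (cases "W x s = 0") (auto intro: mult_left_mono)
  qed (use x \<phi> in \<open>auto intro!: set_integrable_W_mult H1_edge\<close>)
  then show ?thesis by (simp add: pot_def mult.commute)
qed

text \<open>Since \<open>W\<close> is at most \<open>B\<close>, a short segment has little potential
  mass; this is how \<open>small\<close> yields the smallness that
  \<open>energy_cover_extend\<close> asks for.\<close>

lemma energy_cover_segment:
  assumes c: "energy_cover H1 evals (\<lambda>\<phi>. fst \<phi> x b) K M U l w"
    and x: "x \<in> edges" and ab: "0 \<le> a" "a < b" "b \<le> len x"
    and l: "0 \<le> l" and small: "(b - a) * (w + l * B + len x * B) \<le> 1/16"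
  shows "energy_cover H1 evals (\<lambda>\<phi>. fst \<phi> x a) (\<lambda>\<phi>. K \<phi> + kin x a b \<phi>) (\<lambda>\<phi>. M \<phi> + mass x a b \<phi>)
     (\<lambda>\<phi>. U \<phi> + pot_energy x a b \<phi>) (l + (b - a)) (w + pot x a b)"
proof (rule energy_cover_extend[OF c eval_in_evals])
  show "0 < b - a" "0 \<le> pot x a b" using ab x pot_nonneg by auto
  have "(b - a) * w + l * pot x a b + (b - a) * pot x a b
     \<le> (b - a) * w + l * (B * (b - a)) + (b - a) * (B * len x)"
  proof (intro add_mono mult_left_mono)
    show "pot x a b \<le> B * (b - a)" using pot_le x ab by simp
    also have "\<dots> \<le> B * len x" using ab B_nonneg by (intro mult_left_mono) auto
    finally show "pot x a b \<le> B * len x" .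
  qed (use ab l in auto)
  also have "\<dots> = (b - a) * (w + l * B + len x * B)" by (simp add: algebra_simps)
  finally show "(b - a) * w + l * pot x a b + (b - a) * pot x a b \<le> 1/16" using small by simp
  fix \<phi> assume \<phi>: "\<phi> \<in> H1"
  show "0 \<le> kin x a b \<phi>" "0 \<le> mass x a b \<phi>" by (rule kin_nonneg mass_nonneg)+
  show "\<bar>fst \<phi> x b - fst \<phi> x a\<bar> \<le> sqrt ((b - a) * kin x a b \<phi>)"
    using H1_oscillation[OF \<phi> x] ab by simp
  have sub: "sqrt ((s - a) * kin x a s \<phi>) \<le> sqrt ((b - a) * kin x a b \<phi>)" if "a \<le> s" "s \<le> b" for s
    using that ab x \<phi> by (intro real_sqrt_le_mono mult_mono kin_mono kin_nonneg) auto
  show "pot_energy x a b \<phi> \<le> pot x a b * (\<bar>fst \<phi> x a\<bar> + sqrt ((b - a) * kin x a b \<phi>))\<^sup>2"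
  proof (subst mult.commute, rule pot_energy_le_sup[OF \<phi> x ab(1,3)])
    fix s assume s: "s \<in> {a..b}"
    have "\<bar>fst \<phi> x s - fst \<phi> x a\<bar> \<le> sqrt ((b - a) * kin x a b \<phi>)"
      by (rule order_trans[OF H1_oscillation[OF \<phi> x] sub]) (use s ab in auto)
    then have "\<bar>fst \<phi> x s\<bar> \<le> \<bar>fst \<phi> x a\<bar> + sqrt ((b - a) * kin x a b \<phi>)" by linarith
    then show "(fst \<phi> x s)\<^sup>2 \<le> (\<bar>fst \<phi> x a\<bar> + sqrt ((b - a) * kin x a b \<phi>))\<^sup>2"
      using power_mono[OF _ abs_ge_zero, of "fst \<phi> x s" _ 2] by simp
  qed
  fix L assume L: "0 < L" "L \<le> b - a"
  obtain \<beta> where \<beta>: "\<beta> \<ge> 0" "L * \<beta>\<^sup>2 \<le> mass x a (a + L) \<phi>" "\<bar>fst \<phi> x a\<bar> \<le> \<beta> + sqrt (L * kin x a (a + L) \<phi>)"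
    using H1_small_value[OF \<phi> x ab(1), of L] L ab by auto
  have le: "kin x a (a + L) \<phi> \<le> kin x a b \<phi>" "mass x a (a + L) \<phi> \<le> mass x a b \<phi>"
    using kin_mono[OF \<phi> x ab(1), of a "a + L" b] L ab by auto
  then have "sqrt (L * kin x a (a + L) \<phi>) \<le> sqrt (L * kin x a b \<phi>)" using L by simp
  then show "\<exists>\<beta>\<ge>0. L * \<beta>\<^sup>2 \<le> mass x a b \<phi> \<and> \<bar>fst \<phi> x a\<bar> \<le> \<beta> + sqrt (L * kin x a b \<phi>)"
    using \<beta> le by (intro exI[of _ \<beta>] conjI) linarith+
qed

text \<open>The edge is cut into \<open>n\<close> equal segments, which are added one by one from
  the far end. How large \<open>n\<close> must be depends on the potential and the subtree, but
  \<open>n\<close> leaves no trace in the result.\<close>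

lemma energy_cover_edge:
  assumes c: "energy_cover H1 evals (\<lambda>\<phi>. fst \<phi> x (len x)) K M U l w"
    and x: "x \<in> edges" and l: "0 \<le> l"
  shows "energy_cover H1 evals (\<lambda>\<phi>. fst \<phi> x 0) (\<lambda>\<phi>. K \<phi> + kin x 0 (len x) \<phi>) (\<lambda>\<phi>. M \<phi> + mass x 0 (len x) \<phi>)
     (\<lambda>\<phi>. U \<phi> + pot_energy x 0 (len x) \<phi>) (l + len x) (w + pot x 0 (len x))"
proof -
  \<comment> \<open>An upper bound, valid at every stage, for the bracket in the hypothesis
    \<open>small\<close> of \<open>energy_cover_segment\<close>: at most B * len x of mass and len x
    of height have been added before.\<close>
  define C where "C = (w + B * len x) + (l + len x) * B + len x * B"
  obtain n where n: "16 * len x * C < real n" "0 < n"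
    by (metis gr0I less_irrefl of_nat_0_less_iff order_less_trans reals_Archimedean2 zero_less_one_class.zero_less_one
        max_less_iff_conj)
  define s where "s = len x / real n"
  have s: "0 < s" "real n * s = len x" using n len_pos[OF x] by (auto simp: s_def)
  have sC: "s * C \<le> 1/16" using n by (simp add: s_def field_simps)
  have mono: "j \<le> n \<Longrightarrow> real j * s \<le> len x" for j
    using s mult_right_mono[of "real j" "real n" s] by simp
  have "j \<le> n \<Longrightarrow> energy_cover H1 evals (\<lambda>\<phi>. fst \<phi> x (len x - j * s)) (\<lambda>\<phi>. K \<phi> + kin x (len x - j * s) (len x) \<phi>)
     (\<lambda>\<phi>. M \<phi> + mass x (len x - j * s) (len x) \<phi>)
     (\<lambda>\<phi>. U \<phi> + pot_energy x (len x - j * s) (len x) \<phi>) (l + j * s) (w + pot x (len x - j * s) (len x))" for j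
  proof (induction j)
    case 0
    have z: "(LINT s:{len x..len x}|lborel. g s) = 0" for g :: "real \<Rightarrow> real"
    proof -
      have "AE s in lborel. s \<noteq> len x" by (rule AE_lborel_singleton)
      then have "AE s in lborel. indicator {len x..len x} s *\<^sub>R g s = 0" by eventually_elim auto
      then show ?thesis unfolding set_lebesgue_integral_def by (rule integral_eq_zero_AE)
    qed
    show ?case using c by (simp only: kin_def mass_def pot_def pot_energy_def z of_nat_0 mult_zero_left diff_zero add_0_right)
  next
    case (Suc j)
    define a b where "a = len x - real (Suc j) * s" and "b = len x - real j * s"
    have ab: "0 \<le> a" "a < b" "b \<le> len x" "b - a = s"
      using mono[OF Suc.prems] s by (auto simp: a_def b_def algebra_simps)
    have js: "0 \<le> real j * s" "real j * s \<le> len x" using mono[of j] Suc.prems s by auto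
    have "pot x b (len x) \<le> B * (len x - b)" using pot_le x ab by simp
    also have "\<dots> \<le> B * len x" using ab B_nonneg by (intro mult_left_mono) auto
    finally have "(w + pot x b (len x)) + (l + real j * s) * B + len x * B \<le> C"
      unfolding C_def using js B_nonneg by (intro add_mono mult_right_mono) auto
    then have *: "s * ((w + pot x b (len x)) + (l + real j * s) * B + len x * B) \<le> s * C"
      using s by (intro mult_left_mono) auto
    have small: "(b - a) * ((w + pot x b (len x)) + (l + real j * s) * B + len x * B) \<le> 1/16"
      unfolding ab(4) by (rule order_trans[OF * sC])
    have "energy_cover H1 evals (\<lambda>\<phi>. fst \<phi> x a) (\<lambda>\<phi>. K \<phi> + kin x b (len x) \<phi> + kin x a b \<phi>)
      (\<lambda>\<phi>. M \<phi> + mass x b (len x) \<phi> + mass x a b \<phi>)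
      (\<lambda>\<phi>. U \<phi> + pot_energy x b (len x) \<phi> + pot_energy x a b \<phi>) (l + real j * s + (b - a))
      (w + pot x b (len x) + pot x a b)"
      by (rule energy_cover_segment[OF _ x ab(1-3) _ small]) (use Suc js l in \<open>auto simp: b_def\<close>)
    then show ?case
      unfolding a_def[symmetric]
    proof (rule energy_cover_cong)
      show "l + real j * s + (b - a) = l + real (Suc j) * s" using ab by (simp add: algebra_simps)
      show "w + pot x b (len x) + pot x a b = w + pot x a (len x)"
        using pot_split[OF x ab(1), of b "len x"] ab by simp
    qed (use kin_split[OF _ x ab(1), of _ b "len x"] pot_energy_split[OF _ x ab(1), of _ b "len x"] ab in auto)
  qed
  from this[of n] show ?thesis by (simp add: s)
qed

text \<open>Induction on the number of generations: the covers of the children are merged at the far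
  end of \<open>x\<close>, where continuity identifies their values, and then the edge is added. The
  second conjunct is the hypothesis on \<open>l\<close> in \<open>energy_cover_edge\<close>.\<close>

lemma energy_cover_branch:
  "x \<in> edges \<Longrightarrow> energy_cover H1 evals (\<lambda>\<phi>. fst \<phi> x 0)
     (\<lambda>\<phi>. branch_sum k (\<lambda>y. kin y 0 (len y) \<phi>) x) (\<lambda>\<phi>. branch_sum k (\<lambda>y. mass y 0 (len y) \<phi>) x)
     (\<lambda>\<phi>. branch_sum k (\<lambda>y. pot_energy y 0 (len y) \<phi>) x) (branch_sum k len x)
     (branch_sum k (\<lambda>y. pot y 0 (len y)) x)
   \<and> 0 \<le> branch_sum k len x"
proof (induction k arbitrary: x)
  case 0
  then show ?case by (simp add: energy_cover_0)
next
  case (Suc k)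
  have ch: "C \<subseteq> children x \<Longrightarrow> energy_cover H1 evals (\<lambda>\<phi>. fst \<phi> x (len x))
     (\<lambda>\<phi>. \<Sum>z\<in>C. branch_sum k (\<lambda>y. kin y 0 (len y) \<phi>) z) (\<lambda>\<phi>. \<Sum>z\<in>C. branch_sum k (\<lambda>y. mass y 0 (len y) \<phi>) z)
     (\<lambda>\<phi>. \<Sum>z\<in>C. branch_sum k (\<lambda>y. pot_energy y 0 (len y) \<phi>) z) (\<Sum>z\<in>C. branch_sum k len z)
     (\<Sum>z\<in>C. branch_sum k (\<lambda>y. pot y 0 (len y)) z) \<and> 0 \<le> (\<Sum>z\<in>C. branch_sum k len z)" if "finite C" for C
    using that
  proof (induction C rule: finite_induct)
    case empty
    show ?case by (simp add: energy_cover_0)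
  next
    case (insert z C)
    then have z: "z \<in> edges" "par z = x" by (auto simp: children_def)
    have "par z \<noteq> r" using z(2) Suc.prems by auto
    then have v: "\<phi> \<in> H1 \<Longrightarrow> fst \<phi> z 0 = fst \<phi> x (len x)" for \<phi> using H1_vertex[OF _ z(1)] z(2) by simp
    note IHz = Suc.IH[OF z(1)] and IHC = insert.IH
    have sub: "C \<subseteq> children x" using insert.prems by simp
    have "energy_cover H1 evals (\<lambda>\<phi>. fst \<phi> x (len x))
      (\<lambda>\<phi>. branch_sum k (\<lambda>y. kin y 0 (len y) \<phi>) z + (\<Sum>z\<in>C. branch_sum k (\<lambda>y. kin y 0 (len y) \<phi>) z))
      (\<lambda>\<phi>. branch_sum k (\<lambda>y. mass y 0 (len y) \<phi>) z + (\<Sum>z\<in>C. branch_sum k (\<lambda>y. mass y 0 (len y) \<phi>) z))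
      (\<lambda>\<phi>. branch_sum k (\<lambda>y. pot_energy y 0 (len y) \<phi>) z + (\<Sum>z\<in>C. branch_sum k (\<lambda>y. pot_energy y 0 (len y) \<phi>) z))
      (branch_sum k len z + (\<Sum>z\<in>C. branch_sum k len z))
      (branch_sum k (\<lambda>y. pot y 0 (len y)) z + (\<Sum>z\<in>C. branch_sum k (\<lambda>y. pot y 0 (len y)) z))"
      by (rule energy_cover_merge[OF conjunct1[OF IHz] conjunct1[OF IHC[OF sub]] v refl eval_in_evals])
    then show ?case using insert.hyps IHz IHC[OF sub] by simp
  qed
  have x: "x \<in> edges" by fact
  have "finite (children x)" using x by (intro finite_children) auto
  from ch[OF this] have c: "energy_cover H1 evals (\<lambda>\<phi>. fst \<phi> x (len x))
     (\<lambda>\<phi>. \<Sum>z\<in>children x. branch_sum k (\<lambda>y. kin y 0 (len y) \<phi>) z)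
     (\<lambda>\<phi>. \<Sum>z\<in>children x. branch_sum k (\<lambda>y. mass y 0 (len y) \<phi>) z)
     (\<lambda>\<phi>. \<Sum>z\<in>children x. branch_sum k (\<lambda>y. pot_energy y 0 (len y) \<phi>) z) (\<Sum>z\<in>children x. branch_sum k len z)
     (\<Sum>z\<in>children x. branch_sum k (\<lambda>y. pot y 0 (len y)) z)" and l: "0 \<le> (\<Sum>z\<in>children x. branch_sum k len z)"
    by auto
  show ?case
    using energy_cover_edge[OF c x l] l len_pos[OF x] by simp
qed

text \<open>The piece left open at the root is closed too. Its own height is at most 1 / (16 * v),
  too short to charge the value at the root, so \<open>root_small_value\<close> provides a path of
  exactly this length in the full tree. Energy and mass on that path may have been used already and
  are charged a second time: 1 becomes 5/4, and 64 becomes 128.\<close>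

lemma truncation_estimate:
  "\<exists>ks. sum_list (map snd ks) \<le> (\<Sum>x\<in>truncation N. pot x 0 (len x)) \<and> (\<forall>(f, u) \<in> set ks. f \<in> evals \<and> 0 \<le> u) \<and>
     (\<forall>e>0. \<forall>\<phi>\<in>H1. (\<forall>(f, u) \<in> set ks. e \<le> u \<longrightarrow> f \<phi> = 0) \<longrightarrow>
        (\<Sum>x\<in>truncation N. pot_energy x 0 (len x) \<phi>) \<le> 5/4 * kin_total \<phi> + 128 * e\<^sup>2 * mass_total \<phi>)"
proof -
  have "energy_cover H1 evals (\<lambda>\<phi>. fst \<phi> root_edge 0)
     (\<lambda>\<phi>. \<Sum>x\<in>truncation N. kin x 0 (len x) \<phi>) (\<lambda>\<phi>. \<Sum>x\<in>truncation N. mass x 0 (len x) \<phi>)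
     (\<lambda>\<phi>. \<Sum>x\<in>truncation N. pot_energy x 0 (len x) \<phi>) (\<Sum>x\<in>truncation N. len x) (\<Sum>x\<in>truncation N. pot x 0 (len x))"
    using energy_cover_branch[OF root_edge(1), of N] unfolding branch_sum_root by blast
  then show ?thesis
  proof (rule energy_coverE)
    fix h v ks
    assume h: "0 \<le> h" "h \<le> (\<Sum>x\<in>truncation N. len x)" "0 \<le> v" "h * v \<le> 1/16"
    and w: "v + sum_list (map snd ks) \<le> (\<Sum>x\<in>truncation N. pot x 0 (len x))"
    and ks: "\<forall>(f, u) \<in> set ks. f \<in> evals \<and> 0 \<le> u"
    and c: "\<And>e \<phi>. 0 < e \<Longrightarrow> \<phi> \<in> H1 \<Longrightarrow> \<forall>(f, u) \<in> set ks. e \<le> u \<longrightarrow> f \<phi> = 0 \<Longrightarrow>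
       \<exists>D m. 0 \<le> D \<and> 0 \<le> m \<and> (\<Sum>x\<in>truncation N. pot_energy x 0 (len x) \<phi>)
          \<le> v * (\<bar>fst \<phi> root_edge 0\<bar> + sqrt (h * D))\<^sup>2 + ((\<Sum>x\<in>truncation N. kin x 0 (len x) \<phi>) - D)
             + 64 * e\<^sup>2 * ((\<Sum>x\<in>truncation N. mass x 0 (len x) \<phi>) - m) \<and>
          (\<forall>L. 0 < L \<and> L \<le> h \<longrightarrow> (\<exists>b\<ge>0. L * b\<^sup>2 \<le> m \<and> \<bar>fst \<phi> root_edge 0\<bar> \<le> b + sqrt (L * D)))"
    show ?thesis
    proof (intro exI conjI allI ballI impI)
      show "sum_list (map snd (((\<lambda>\<phi>. fst \<phi> root_edge 0), v) # ks)) \<le> (\<Sum>x\<in>truncation N. pot x 0 (len x))"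
        using w by simp
      show "case q of (f, u) \<Rightarrow> f \<in> evals \<and> 0 \<le> u" if "q \<in> set (((\<lambda>\<phi>. fst \<phi> root_edge 0), v) # ks)" for q
        using that ks h by (auto simp: eval_in_evals)
      fix e \<phi> assume e: "(0::real) < e" and \<phi>: "\<phi> \<in> H1"
        and z: "\<forall>(f, u) \<in> set (((\<lambda>\<phi>. fst \<phi> root_edge 0), v) # ks). e \<le> u \<longrightarrow> f \<phi> = 0"
      define a where "a = fst \<phi> root_edge 0"
      let ?K = "kin_total \<phi>" and ?M = "mass_total \<phi>"
      have KM: "(\<Sum>x\<in>truncation N. kin x 0 (len x) \<phi>) \<le> ?K" "(\<Sum>x\<in>truncation N. mass x 0 (len x) \<phi>) \<le> ?M"
        by (rule finite_sum_le_has_sum[OF H1_total(1)[OF \<phi>] finite_truncation truncation_subset kin_nonneg]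
            finite_sum_le_has_sum[OF H1_total(2)[OF \<phi>] finite_truncation truncation_subset mass_nonneg])+
      have KM0: "0 \<le> ?K" "0 \<le> ?M" unfolding kin_total_def mass_total_def by auto
      have az: "a = 0 \<or> v < e" using z by (auto simp: a_def)
      obtain D m where d: "0 \<le> D" "0 \<le> m" "(\<Sum>x\<in>truncation N. pot_energy x 0 (len x) \<phi>)
            \<le> v * (\<bar>a\<bar> + sqrt (h * D))\<^sup>2 + ((\<Sum>x\<in>truncation N. kin x 0 (len x) \<phi>) - D)
               + 64 * e\<^sup>2 * ((\<Sum>x\<in>truncation N. mass x 0 (len x) \<phi>) - m)"
        using c[OF e \<phi>] z unfolding a_def by auto
      have "64 * e\<^sup>2 * ((\<Sum>x\<in>truncation N. mass x 0 (len x) \<phi>) - m) \<le> 64 * e\<^sup>2 * ?M"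
        using KM d by (intro mult_left_mono) auto
      moreover have "v * (\<bar>a\<bar> + sqrt (h * D))\<^sup>2 \<le> 2 * v * a\<^sup>2 + D"
      proof -
        have "v * (\<bar>a\<bar> + sqrt (h * D))\<^sup>2 \<le> v * (2 * \<bar>a\<bar>\<^sup>2 + 2 * (sqrt (h * D))\<^sup>2)"
          by (rule mult_left_mono[OF square_add_le h(3)])
        also have "\<dots> = 2 * v * a\<^sup>2 + 2 * (h * v) * D" using h d by (simp add: algebra_simps)
        also have "2 * (h * v) * D \<le> 1 * D" using h d by (intro mult_right_mono) auto
        finally show ?thesis by simp
      qed
      moreover have "2 * v * a\<^sup>2 \<le> 64 * e\<^sup>2 * ?M + ?K / 4"
      proof (cases "a = 0 \<or> v = 0")
        case True
        then show ?thesis using KM0 by auto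
      next
        case False
        then have v: "0 < v" "v < e" using h az by auto
        define L where "L = 1 / (16 * v)"
        have L: "0 < L" using v by (simp add: L_def)
        obtain b where b: "b \<ge> 0" "L * b\<^sup>2 \<le> ?M" "\<bar>a\<bar> \<le> b + sqrt (L * ?K)"
          using root_small_value[OF \<phi> L] unfolding a_def by auto
        have "a\<^sup>2 = \<bar>a\<bar>\<^sup>2" by simp
        also have "\<dots> \<le> (b + sqrt (L * ?K))\<^sup>2" using b by (intro power_mono) auto
        also have "\<dots> \<le> 2 * b\<^sup>2 + 2 * (sqrt (L * ?K))\<^sup>2" by (rule square_add_le)
        also have "\<dots> = 2 * b\<^sup>2 + 2 * (L * ?K)" using L KM0 by simp
        finally have "2 * v * a\<^sup>2 \<le> 2 * v * (2 * b\<^sup>2 + 2 * (L * ?K))" using v by simp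
        also have "\<dots> = 64 * v\<^sup>2 * (L * b\<^sup>2) + ?K / 4"
          using v by (simp add: L_def power2_eq_square field_simps)
        also have "\<dots> \<le> 64 * e\<^sup>2 * ?M + ?K / 4"
          using v b L KM0 by (intro add_right_mono mult_mono) (auto intro!: power_mono)
        finally show ?thesis .
      qed
      ultimately show "(\<Sum>x\<in>truncation N. pot_energy x 0 (len x) \<phi>) \<le> 5/4 * ?K + 128 * e\<^sup>2 * ?M"
        using d(3) KM by linarith
    qed
  qed
qed

end

section \<open>From the covering to eigenvalue sums\<close>

text \<open>Gaussian elimination: the first equation is solved for an unknown \<open>p\<close> with
  nonzero coefficient and \<open>p\<close> is eliminated from the others by \<open>b'\<close>; an
  equation without such an unknown is dropped.\<close>

lemma underdetermined_system:
  fixes as :: "('j \<Rightarrow> real) list"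
  assumes "finite J" "length as < card J"
  shows "\<exists>c. (\<exists>j\<in>J. c j \<noteq> 0) \<and> (\<forall>a\<in>set as. (\<Sum>j\<in>J. c j * a j) = 0)"
  using assms
proof (induction "length as" arbitrary: as J)
  case 0
  then obtain j where "j \<in> J" by fastforce
  then show ?case using 0 by (intro exI[of _ "\<lambda>_. 1"]) auto
next
  case (Suc n)
  then obtain a bs where as: "as = a # bs" "length bs = n" by (metis length_Suc_conv)
  show ?case
  proof (cases "\<forall>j\<in>J. a j = 0")
    case True
    obtain c where "\<exists>j\<in>J. c j \<noteq> 0" "\<forall>b\<in>set bs. (\<Sum>j\<in>J. c j * b j) = 0"
      using Suc.hyps(1)[of bs J] Suc.prems as by auto
    then show ?thesis using True as by (intro exI[of _ c]) auto
  next
    case False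
    then obtain p where p: "p \<in> J" "a p \<noteq> 0" by blast
    define b' where "b' b j = b j - b p / a p * a j" for b j
    obtain c where c: "\<exists>j\<in>J - {p}. c j \<noteq> 0" "\<forall>b\<in>set (map b' bs). (\<Sum>j\<in>J - {p}. c j * b j) = 0"
    proof -
      have "length (map b' bs) < card (J - {p})" using Suc.prems as p by (simp add: card_Diff_singleton)
      then show thesis using Suc.hyps(1)[of "map b' bs" "J - {p}"] Suc.prems(1) as(2) that by auto
    qed
    define S where "S = (\<Sum>j\<in>J - {p}. c j * a j)"
    define d where "d = c(p := - S / a p)"
    have d: "(\<Sum>j\<in>J. d j * b j) = - S / a p * b p + (\<Sum>j\<in>J - {p}. c j * b j)" for b
      using p Suc.prems by (subst sum.remove[of _ p]) (auto simp: d_def intro!: sum.cong)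
    have "(\<Sum>j\<in>J. d j * a j) = 0" using p unfolding d S_def[symmetric] by simp
    moreover have "(\<Sum>j\<in>J. d j * b j) = 0" if "b \<in> set bs" for b
    proof -
      have "0 = (\<Sum>j\<in>J - {p}. c j * b' b j)" using c that by auto
      also have "\<dots> = (\<Sum>j\<in>J - {p}. c j * b j) - b p / a p * S"
        by (simp add: b'_def S_def sum_distrib_left sum_subtractf algebra_simps)
      finally show ?thesis unfolding d by simp
    qed
    moreover have "\<exists>j\<in>J. d j \<noteq> 0" using c by (auto simp: d_def)
    ultimately show ?thesis using as by (intro exI[of _ d]) auto
  qed
qed

text \<open>The comparison of counting functions is a comparison of the ordered values. The largest
  \<open>x m\<close> is matched with a list entry that dominates it, and both are removed.\<close>

lemma sum_le_sum_list_of_counting: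
  fixes x :: "'i \<Rightarrow> real"
  assumes "finite I" "\<forall>u\<in>set us. 0 \<le> u"
    and "\<And>e. 0 < e \<Longrightarrow> card {i \<in> I. e < x i} \<le> length (filter (\<lambda>u. e \<le> u) us)"
  shows "sum x I \<le> sum_list us"
  using assms
proof (induction "card I" arbitrary: I us)
  case 0
  then show ?case by (auto intro!: sum_list_nonneg)
next
  case (Suc n)
  then have "I \<noteq> {}" by auto
  then obtain m where m: "m \<in> I" "\<And>i. i \<in> I \<Longrightarrow> x i \<le> x m"
  proof -
    have "Max (x ` I) \<in> x ` I" using Suc.prems(1) \<open>I \<noteq> {}\<close> by (intro Max_in) auto
    then obtain m where "m \<in> I" "x m = Max (x ` I)" by auto
    then show thesis using Suc.prems(1) by (intro that[of m]) auto
  qed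
  show ?case
  proof (cases "x m \<le> 0")
    case True
    then have "sum x I \<le> 0" using m by (intro sum_nonpos) (auto intro: order_trans)
    also have "0 \<le> sum_list us" using Suc.prems by (intro sum_list_nonneg) auto
    finally show ?thesis .
  next
    case False
    have "\<exists>u\<in>set us. x m \<le> u"
    proof (rule ccontr)
      assume n: "\<not> ?thesis"
      define M where "M = Max (insert 0 (set us))"
      have M: "0 \<le> M" "\<And>u. u \<in> set us \<Longrightarrow> u \<le> M" "M < x m"
        unfolding M_def using n False by auto
      \<comment> \<open>A level strictly between all list entries and \<open>x m\<close>: above it
        the list has nothing, but \<open>I\<close> still contains \<open>m\<close>.\<close>
      define e where "e = (M + x m) / 2"
      have e: "0 < e" "M < e" "e < x m" using M False by (auto simp: e_def)
      have "filter (\<lambda>u. e \<le> u) us = []" using M e by (fastforce simp: filter_empty_conv)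
      moreover have "0 < card {i \<in> I. e < x i}" using m e Suc.prems by (auto simp: card_gt_0_iff)
      ultimately show False using Suc.prems(3)[OF e(1)] by simp
    qed
    then obtain u where u: "u \<in> set us" "x m \<le> u" by blast
    have "sum x (I - {m}) \<le> sum_list (remove1 u us)"
    proof (rule Suc.hyps(1))
      show "n = card (I - {m})" using Suc.hyps(2) m Suc.prems by simp
      show "\<forall>u\<in>set (remove1 u us). 0 \<le> u" using Suc.prems(2) by (meson notin_set_remove1)
      fix e :: real assume e: "0 < e"
      show "card {i \<in> I - {m}. e < x i} \<le> length (filter ((\<le>) e) (remove1 u us))"
      proof (cases "e < x m")
        case True
        have "{i \<in> I - {m}. e < x i} = {i \<in> I. e < x i} - {m}" by auto
        then have "card {i \<in> I - {m}. e < x i} = card {i \<in> I. e < x i} - 1"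
          using True m by (simp add: card_Diff_singleton)
        \<comment> \<open>The removed entry satisfies e < x m \<le> u, so both counts drop by
          one.\<close>
        moreover have "length (filter ((\<le>) e) (remove1 u us)) = length (filter ((\<le>) e) us) - 1"
          using u True by (simp add: filter_remove1 length_remove1)
        ultimately show ?thesis using Suc.prems(3)[OF e] by simp
      next
        case False
        then have "{i \<in> I - {m}. e < x i} = {}" using m(2) by force
        then show ?thesis by (simp only: card.empty)
      qed
    qed (use Suc.prems in auto)
    moreover have "sum_list us = u + sum_list (remove1 u us)"
      using sum_list_map_remove1[OF u(1), of "\<lambda>x. x"] by simp
    moreover have "sum x I = x m + sum x (I - {m})" using m Suc.prems by (simp add: sum.remove)
    ultimately show ?thesis using u by simp
  qed
qed

lemma AE_tree_measure:
  "AE p in tree_measure Vt r len. fst p \<in> Vt - {r} \<and> snd p \<in> {0..len (fst p)}"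
proof -
  have "(\<lambda>p. ennreal (indicator {0..len (fst p)} (snd p))) \<in> borel_measurable (count_space (Vt - {r}) \<Otimes>\<^sub>M lborel)"
    using measurable_edge_indicator[of len "Vt - {r}"] by measurable
  from AE_density[OF this] show ?thesis
    unfolding tree_measure_alt by (auto intro!: AE_I2 simp: space_pair_measure indicator_def split: if_splits)
qed

lemma integrable_square_add:
  fixes f g :: "'a \<Rightarrow> real"
  assumes "f \<in> borel_measurable M" "g \<in> borel_measurable M"
    "integrable M (\<lambda>p. (f p)\<^sup>2)" "integrable M (\<lambda>p. (g p)\<^sup>2)"
  shows "integrable M (\<lambda>p. (c * f p + g p)\<^sup>2)"
proof (rule Bochner_Integration.integrable_bound)
  show "integrable M (\<lambda>p. 2 * c\<^sup>2 * (f p)\<^sup>2 + 2 * (g p)\<^sup>2)" using assms by auto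
  show "AE p in M. norm ((c * f p + g p)\<^sup>2) \<le> norm (2 * c\<^sup>2 * (f p)\<^sup>2 + 2 * (g p)\<^sup>2)"
  proof (rule AE_I2)
    show "norm ((c * f p + g p)\<^sup>2) \<le> norm (2 * c\<^sup>2 * (f p)\<^sup>2 + 2 * (g p)\<^sup>2)" for p
      using square_add_le[of "c * f p" "g p"] by (simp add: power_mult_distrib)
  qed
qed (use assms in measurable)

section \<open>Linear combinations of functions in H1\<close>

context neumann_tree
begin

definition lincomb ::
  "('i \<Rightarrow> (nat \<Rightarrow> real \<Rightarrow> real) \<times> (nat \<Rightarrow> real \<Rightarrow> real)) \<Rightarrow> 'i set \<Rightarrow> ('i \<Rightarrow> real)
    \<Rightarrow> (nat \<Rightarrow> real \<Rightarrow> real) \<times> (nat \<Rightarrow> real \<Rightarrow> real)" where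
  "lincomb \<phi> I c = (\<lambda>x t. \<Sum>i\<in>I. c i * fst (\<phi> i) x t, \<lambda>x t. \<Sum>i\<in>I. c i * snd (\<phi> i) x t)"

lemma H1_outside: "\<phi> \<in> H1 \<Longrightarrow> x \<notin> edges \<or> t \<notin> {0..len x} \<Longrightarrow> fst \<phi> x t = 0"
  unfolding H1_def tree_H1_def by blast

lemma H1_siblings: "\<phi> \<in> H1 \<Longrightarrow> y \<in> edges \<Longrightarrow> z \<in> edges \<Longrightarrow> par y = par z \<Longrightarrow> fst \<phi> y 0 = fst \<phi> z 0"
  unfolding H1_def tree_H1_def by blast

lemma H1_square_integrable:
  assumes "\<phi> \<in> H1"
  shows "(\<lambda>p. fst \<phi> (fst p) (snd p)) \<in> borel_measurable T"
    "(\<lambda>p. snd \<phi> (fst p) (snd p)) \<in> borel_measurable T"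
    "integrable T (\<lambda>p. (fst \<phi> (fst p) (snd p))\<^sup>2)"
    "integrable T (\<lambda>p. (snd \<phi> (fst p) (snd p))\<^sup>2)"
  using assms unfolding H1_def tree_H1_def by auto

lemma H1_add:
  assumes \<phi>: "\<phi> \<in> H1" and \<psi>: "\<psi> \<in> H1"
  shows "(\<lambda>x t. c * fst \<phi> x t + fst \<psi> x t, \<lambda>x t. c * snd \<phi> x t + snd \<psi> x t) \<in> H1"
proof -
  have formula: "c * fst \<phi> x t + fst \<psi> x t = c * fst \<phi> x 0 + fst \<psi> x 0 + (LINT s:{0..t}|lborel. c * snd \<phi> x s + snd \<psi> x s)"
    if x: "x \<in> edges" and t: "t \<in> {0..len x}" for x t
  proof -
    have "set_integrable lborel {0..t} (snd \<phi> x)" "set_integrable lborel {0..t} (snd \<psi> x)"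
      using H1_edge(1)[OF \<phi> x] H1_edge(1)[OF \<psi> x] t by auto
    then show ?thesis
      using H1_edge(4)[OF \<phi> x, of 0 t] H1_edge(4)[OF \<psi> x, of 0 t] t by (simp add: algebra_simps)
  qed
  have int: "set_integrable lborel {0..len x} (\<lambda>s. c * snd \<phi> x s + snd \<psi> x s)" if x: "x \<in> edges" for x
    using H1_edge(1)[OF \<phi> x] H1_edge(1)[OF \<psi> x] by auto
  have outside: "c * fst \<phi> x t + fst \<psi> x t = 0" if "x \<notin> edges \<or> t \<notin> {0..len x}" for x t
    using H1_outside[OF \<phi> that] H1_outside[OF \<psi> that] by simp
  have siblings: "c * fst \<phi> y 0 + fst \<psi> y 0 = c * fst \<phi> z 0 + fst \<psi> z 0"
    if "y \<in> edges" "z \<in> edges" "par y = par z" for y z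
    using H1_siblings[OF \<phi> that] H1_siblings[OF \<psi> that] by simp
  have vertex: "c * fst \<phi> y 0 + fst \<psi> y 0 = c * fst \<phi> (par y) (len (par y)) + fst \<psi> (par y) (len (par y))"
    if "y \<in> edges" "par y \<noteq> r" for y
    using H1_vertex[OF \<phi> that] H1_vertex[OF \<psi> that] by simp
  note \<Phi> = H1_square_integrable[OF \<phi>] and \<Psi> = H1_square_integrable[OF \<psi>]
  have meas: "(\<lambda>p. c * fst \<phi> (fst p) (snd p) + fst \<psi> (fst p) (snd p)) \<in> borel_measurable T"
    "(\<lambda>p. c * snd \<phi> (fst p) (snd p) + snd \<psi> (fst p) (snd p)) \<in> borel_measurable T"
    using \<Phi>(1,2) \<Psi>(1,2) by measurable
  have sq: "integrable T (\<lambda>p. (c * fst \<phi> (fst p) (snd p) + fst \<psi> (fst p) (snd p))\<^sup>2)"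
    "integrable T (\<lambda>p. (c * snd \<phi> (fst p) (snd p) + snd \<psi> (fst p) (snd p))\<^sup>2)"
    by (rule integrable_square_add[OF \<Phi>(1) \<Psi>(1) \<Phi>(3) \<Psi>(3)] integrable_square_add[OF \<Phi>(2) \<Psi>(2) \<Phi>(4) \<Psi>(4)])+
  show ?thesis
    unfolding H1_def tree_H1_def mem_Collect_eq fst_conv snd_conv
    using formula int outside siblings vertex meas sq by (intro conjI allI ballI impI) blast+
qed

lemma H1_zero: "(\<lambda>x t. 0, \<lambda>x t. 0) \<in> H1"
  by (simp add: H1_def tree_H1_def set_integrable_def)

lemma H1_lincomb:
  assumes "finite I" "\<And>i. i \<in> I \<Longrightarrow> \<phi> i \<in> H1"
  shows "lincomb \<phi> I c \<in> H1"
  using assms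
proof (induction I rule: finite_induct)
  case (insert i I)
  then have "lincomb \<phi> (insert i I) c = (\<lambda>x t. c i * fst (\<phi> i) x t + fst (lincomb \<phi> I c) x t,
      \<lambda>x t. c i * snd (\<phi> i) x t + snd (lincomb \<phi> I c) x t)"
    by (simp add: lincomb_def)
  then show ?case using insert by (simp add: H1_add)
qed (simp add: lincomb_def H1_zero)

end

section \<open>Square roots of the eigenvalues and the truncated potential\<close>

context tree_potential
begin

definition "pot_total = (LINT p|T. W (fst p) (snd p))"
definition "pot_energy_total \<phi> = (LINT p|T. W (fst p) (snd p) * (fst \<phi> (fst p) (snd p))\<^sup>2)"
  for \<phi> :: "(nat \<Rightarrow> real \<Rightarrow> real) \<times> (nat \<Rightarrow> real \<Rightarrow> real)"

lemma W_T_measurable: "(\<lambda>p. W (fst p) (snd p)) \<in> borel_measurable T"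
proof -
  have "(\<lambda>p. W (fst p) (snd p)) \<in> borel_measurable (count_space edges \<Otimes>\<^sub>M lborel)"
    by (rule measurable_pair_measure_countable1) (use W_measurable in auto)
  then show ?thesis by (simp cong: measurable_cong_sets add: sets_tree_measure)
qed

lemma integrable_pot_energy:
  assumes \<phi>: "\<phi> \<in> H1"
  shows "integrable T (\<lambda>p. W (fst p) (snd p) * (fst \<phi> (fst p) (snd p))\<^sup>2)"
proof (rule Bochner_Integration.integrable_bound)
  note \<Phi> = H1_square_integrable[OF \<phi>]
  show "integrable T (\<lambda>p. B * (fst \<phi> (fst p) (snd p))\<^sup>2)" using \<Phi>(3) by simp
  show "AE p in T. norm (W (fst p) (snd p) * (fst \<phi> (fst p) (snd p))\<^sup>2) \<le> norm (B * (fst \<phi> (fst p) (snd p))\<^sup>2)"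
    using AE_tree_measure
    by eventually_elim (use W_nonneg W_le B_nonneg in \<open>auto simp: abs_mult intro!: mult_right_mono\<close>)
  show "(\<lambda>p. W (fst p) (snd p) * (fst \<phi> (fst p) (snd p))\<^sup>2) \<in> borel_measurable T"
    using \<Phi>(1) W_T_measurable by measurable
qed

lemma has_sum_pot_energy:
  "\<phi> \<in> H1 \<Longrightarrow> ((\<lambda>x. pot_energy x 0 (len x) \<phi>) has_sum pot_energy_total \<phi>) edges"
  using has_sum_tree_integral[OF integrable_pot_energy] by (simp add: pot_energy_def pot_energy_total_def)

text \<open>On the edges outside the truncation, infinitely many of which may lie in the ball,
  \<phi>^2 is bounded by \<open>H1_bound\<close> and the remaining potential mass is factored
  out.\<close>

lemma tail_estimate:
  assumes Wint: "integrable T (\<lambda>p. W (fst p) (snd p))"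
    and supp: "\<And>x s. x \<in> edges \<Longrightarrow> s \<in> {0..len x} \<Longrightarrow> W x s \<noteq> 0 \<Longrightarrow> point_dist r par len x s \<le> R"
    and \<phi>: "\<phi> \<in> H1"
  shows "pot_energy_total \<phi> \<le> (\<Sum>x\<in>truncation N. pot_energy x 0 (len x) \<phi>)
     + 3 * (1 + R) * (kin_total \<phi> + mass_total \<phi>) * (pot_total - (\<Sum>x\<in>truncation N. pot x 0 (len x)))"
proof -
  let ?F = "truncation N"
  let ?S = "3 * (1 + R) * (kin_total \<phi> + mass_total \<phi>)"
  have p: "((\<lambda>x. pot x 0 (len x)) has_sum pot_total) edges"
    using has_sum_tree_integral[OF Wint] by (simp add: pot_def pot_total_def)
  have "((\<lambda>x. pot_energy x 0 (len x) \<phi>) has_sum (pot_energy_total \<phi> - (\<Sum>x\<in>?F. pot_energy x 0 (len x) \<phi>))) (edges - ?F)"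
    by (rule has_sum_Diff[OF has_sum_pot_energy[OF \<phi>] has_sum_finite[OF finite_truncation] truncation_subset])
  moreover have "((\<lambda>x. ?S * pot x 0 (len x)) has_sum (?S * (pot_total - (\<Sum>x\<in>?F. pot x 0 (len x))))) (edges - ?F)"
    by (intro has_sum_cmult_right has_sum_Diff[OF p has_sum_finite[OF finite_truncation] truncation_subset])
  ultimately have "pot_energy_total \<phi> - (\<Sum>x\<in>?F. pot_energy x 0 (len x) \<phi>) \<le> ?S * (pot_total - (\<Sum>x\<in>?F. pot x 0 (len x)))"
  proof (rule has_sum_mono)
    fix x assume x: "x \<in> edges - ?F"
    show "pot_energy x 0 (len x) \<phi> \<le> ?S * pot x 0 (len x)"
    proof (rule pot_energy_le_sup[OF \<phi>])
      fix s assume "s \<in> {0..len x}" "W x s \<noteq> 0"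
      then show "(fst \<phi> x s)\<^sup>2 \<le> ?S" using x supp by (intro H1_bound[OF \<phi>]) auto
    qed (use x in auto)
  qed
  then show ?thesis by simp
qed

text \<open>If more of the \<open>\<kappa> i\<close> exceeded 64 * e^2 + \<eta> than there are
  pieces of mass at least \<open>e\<close>, some nonzero combination would be annihilated by all
  evaluations of these pieces, contradicting \<open>form\<close>. Hence
  \<open>sum_le_sum_list_of_counting\<close> applies. The margin \<eta> pays for the truncated tail
  and tends to 0 at the end.\<close>

theorem sum_sqrt_le_potential:
  fixes \<phi> :: "'i \<Rightarrow> (nat \<Rightarrow> real \<Rightarrow> real) \<times> (nat \<Rightarrow> real \<Rightarrow> real)"
  assumes Wint: "integrable T (\<lambda>p. W (fst p) (snd p))"
    and supp: "\<And>x s. x \<in> edges \<Longrightarrow> s \<in> {0..len x} \<Longrightarrow> W x s \<noteq> 0 \<Longrightarrow> point_dist r par len x s \<le> R"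
    and I: "finite I" and \<phi>: "\<And>i. i \<in> I \<Longrightarrow> \<phi> i \<in> H1"
    and form: "\<And>c. kin_total (lincomb \<phi> I c) - pot_energy_total (lincomb \<phi> I c) / 2 \<le> - (\<Sum>i\<in>I. \<kappa> i * (c i)\<^sup>2)"
    and mass: "\<And>c. mass_total (lincomb \<phi> I c) = (\<Sum>i\<in>I. (c i)\<^sup>2)"
  shows "(\<Sum>i\<in>I. sqrt (max 0 (\<kappa> i))) \<le> 8 * pot_total"
proof -
  have p: "((\<lambda>x. pot x 0 (len x)) has_sum pot_total) edges"
    using has_sum_tree_integral[OF Wint] by (simp add: pot_def pot_total_def)
  have trunc_le: "(\<Sum>x\<in>truncation N. pot x 0 (len x)) \<le> pot_total" for N
    by (rule finite_sum_le_has_sum[OF p finite_truncation truncation_subset]) (auto intro: pot_nonneg)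
  define S where "S = 3 * (1 + max 0 R)"
  have S: "0 < S" by (simp add: S_def)
  have eta: "(\<Sum>i\<in>I. sqrt (max 0 (\<kappa> i - \<eta>))) \<le> 8 * pot_total" if \<eta>: "0 < \<eta>" for \<eta>
  proof -
    \<comment> \<open>Half of the tail is at most \<epsilon> * S / 2 times energy plus mass. The
      energy part must fit into the free 3/8 of the kinetic energy, the mass part into
      \<eta>.\<close>
    define \<epsilon> where "\<epsilon> = min (3/4) \<eta> / S"
    have \<epsilon>: "0 < \<epsilon>" "\<epsilon> * S / 2 \<le> 3/8" "\<epsilon> * S / 2 \<le> \<eta>" using \<eta> S by (auto simp: \<epsilon>_def)
    obtain F where F: "finite F" "F \<subseteq> edges" "dist (\<Sum>x\<in>F. pot x 0 (len x)) pot_total \<le> \<epsilon>"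
      using has_sum_finite_approximation[OF p \<epsilon>(1)] by blast
    obtain N where N: "F \<subseteq> truncation N" using finite_subset_truncation[OF F(1,2)] by blast
    have "(\<Sum>x\<in>F. pot x 0 (len x)) \<le> (\<Sum>x\<in>truncation N. pot x 0 (len x))"
      using N truncation_subset by (intro sum_mono2 finite_truncation) (auto intro: pot_nonneg)
    then have tail: "pot_total - (\<Sum>x\<in>truncation N. pot x 0 (len x)) \<le> \<epsilon>"
      using F(3) by (simp add: dist_real_def)
    obtain ks where ks: "sum_list (map snd ks) \<le> (\<Sum>x\<in>truncation N. pot x 0 (len x))"
      "\<And>f u. (f, u) \<in> set ks \<Longrightarrow> f \<in> evals \<and> 0 \<le> u"
      and est: "\<And>e \<psi>. 0 < e \<Longrightarrow> \<psi> \<in> H1 \<Longrightarrow> (\<And>f u. (f, u) \<in> set ks \<Longrightarrow> e \<le> u \<Longrightarrow> f \<psi> = 0) \<Longrightarrow>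
        (\<Sum>x\<in>truncation N. pot_energy x 0 (len x) \<psi>) \<le> 5/4 * kin_total \<psi> + 128 * e\<^sup>2 * mass_total \<psi>"
      using truncation_estimate[of N] by fast
    \<comment> \<open>The divisor 8 is the square root of 64, so that e < x i means 64 * e^2 +
      \<eta> < \<kappa> i.\<close>
    define x where "x i = sqrt (max 0 (\<kappa> i - \<eta>)) / 8" for i
    have "sum x I \<le> sum_list (map snd ks)"
    proof (rule sum_le_sum_list_of_counting[OF I])
      show "\<forall>u\<in>set (map snd ks). 0 \<le> u" using ks(2) by force
      fix e :: real assume e: "0 < e"
      define J where "J = {i \<in> I. e < x i}"
      define fs where "fs = filter (\<lambda>(f, u). e \<le> u) ks"
      have \<kappa>: "64 * e\<^sup>2 + \<eta> < \<kappa> i" if "i \<in> J" for i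
      proof -
        have "8 * e < sqrt (max 0 (\<kappa> i - \<eta>))" using that by (simp add: J_def x_def)
        then have "(8 * e)\<^sup>2 < (sqrt (max 0 (\<kappa> i - \<eta>)))\<^sup>2" using e by (intro power_strict_mono) auto
        then have "64 * e\<^sup>2 < max 0 (\<kappa> i - \<eta>)" by (simp add: power_mult_distrib)
        moreover have "0 \<le> 64 * e\<^sup>2" by simp
        ultimately show ?thesis by linarith
      qed
      have "card J \<le> length fs"
      proof (rule ccontr)
        assume "\<not> card J \<le> length fs"
        then have "length (map (\<lambda>(f, u) i. f (\<phi> i)) fs) < card J" by simp
        moreover have "finite J" using I by (simp add: J_def)
        ultimately obtain c where c: "\<exists>j\<in>J. c j \<noteq> 0"
          "\<And>a. a \<in> set (map (\<lambda>(f, u) i. f (\<phi> i)) fs) \<Longrightarrow> (\<Sum>j\<in>J. c j * a j) = 0"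
          using underdetermined_system by blast
        define d where "d i = (if i \<in> J then c i else 0)" for i
        define \<psi> where "\<psi> = lincomb \<phi> I d"
        have sumJ: "(\<Sum>i\<in>I. g i * d i) = (\<Sum>i\<in>J. g i * c i)" for g
          unfolding J_def d_def using I by (intro sum.mono_neutral_cong_right) (auto split: if_splits)
        have sumJ2: "(\<Sum>i\<in>I. g i * (d i)\<^sup>2) = (\<Sum>i\<in>J. g i * (c i)\<^sup>2)" for g
          unfolding J_def d_def using I by (intro sum.mono_neutral_cong_right) auto
        have \<psi>: "\<psi> \<in> H1" unfolding \<psi>_def by (rule H1_lincomb[OF I \<phi>])
        have z: "f \<psi> = 0" if f: "(f, u) \<in> set ks" "e \<le> u" for f u
        proof -
          obtain y t where ft: "f = (\<lambda>\<phi>. fst \<phi> y t)" using ks(2)[OF f(1)] unfolding evals_def by auto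
          have "(f, u) \<in> set fs" using f by (simp add: fs_def)
          then have "(\<lambda>i. f (\<phi> i)) \<in> set (map (\<lambda>(f, u) i. f (\<phi> i)) fs)" by force
          from c(2)[OF this] have "(\<Sum>j\<in>J. f (\<phi> j) * c j) = 0" by (simp add: mult.commute)
          then show ?thesis using sumJ[of "\<lambda>i. f (\<phi> i)"] by (simp add: ft \<psi>_def lincomb_def mult.commute)
        qed
        let ?K = "kin_total \<psi>" and ?M = "mass_total \<psi>"
        have KM: "0 \<le> ?K" "0 \<le> ?M" unfolding kin_total_def mass_total_def by auto
        have "pot_energy_total \<psi> \<le> (\<Sum>x\<in>truncation N. pot_energy x 0 (len x) \<psi>)
           + S * (?K + ?M) * (pot_total - (\<Sum>x\<in>truncation N. pot x 0 (len x)))"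
          unfolding S_def by (rule tail_estimate[OF Wint _ \<psi>]) (use supp in force)
        moreover have est': "(\<Sum>x\<in>truncation N. pot_energy x 0 (len x) \<psi>) \<le> 5/4 * ?K + 128 * e\<^sup>2 * ?M"
          by (rule est[OF e \<psi>]) (rule z)
        moreover have "(\<Sum>x\<in>truncation N. pot_energy x 0 (len x) \<psi>)
           + S * (?K + ?M) * (pot_total - (\<Sum>x\<in>truncation N. pot x 0 (len x))) \<le> (5/4 * ?K + 128 * e\<^sup>2 * ?M) + S * (?K + ?M) * \<epsilon>"
          using tail S KM by (intro add_mono est' mult_left_mono) auto
        ultimately have "pot_energy_total \<psi> \<le> (5/4 * ?K + 128 * e\<^sup>2 * ?M) + S * (?K + ?M) * \<epsilon>"
          by linarith
        then have "pot_energy_total \<psi> / 2 \<le> 5/8 * ?K + 64 * e\<^sup>2 * ?M + (\<epsilon> * S / 2) * ?K + (\<epsilon> * S / 2) * ?M"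
          by (simp add: field_simps)
        also have "\<dots> \<le> 5/8 * ?K + 64 * e\<^sup>2 * ?M + 3/8 * ?K + \<eta> * ?M"
          using \<epsilon> KM by (intro add_mono mult_right_mono order_refl)
        finally have "pot_energy_total \<psi> / 2 - ?K \<le> (64 * e\<^sup>2 + \<eta>) * ?M" by (simp add: algebra_simps)
        then have "(\<Sum>i\<in>I. \<kappa> i * (d i)\<^sup>2) \<le> (64 * e\<^sup>2 + \<eta>) * (\<Sum>i\<in>I. (d i)\<^sup>2)"
          using form[of d] mass[of d] unfolding \<psi>_def by simp
        then have "(\<Sum>i\<in>J. \<kappa> i * (c i)\<^sup>2) \<le> (\<Sum>i\<in>J. (64 * e\<^sup>2 + \<eta>) * (c i)\<^sup>2)"
          using sumJ2[of \<kappa>] sumJ2[of "\<lambda>_. 1"] by (simp add: sum_distrib_left[symmetric])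
        moreover have "(\<Sum>i\<in>J. (64 * e\<^sup>2 + \<eta>) * (c i)\<^sup>2) < (\<Sum>i\<in>J. \<kappa> i * (c i)\<^sup>2)"
        proof (rule sum_strict_mono_ex1)
          show "finite J" using I by (simp add: J_def)
          show "\<forall>i\<in>J. (64 * e\<^sup>2 + \<eta>) * (c i)\<^sup>2 \<le> \<kappa> i * (c i)\<^sup>2"
            by (intro ballI mult_right_mono less_imp_le[OF \<kappa>]) simp_all
          show "\<exists>i\<in>J. (64 * e\<^sup>2 + \<eta>) * (c i)\<^sup>2 < \<kappa> i * (c i)\<^sup>2"
          proof -
            obtain j where "j \<in> J" "c j \<noteq> 0" using c(1) by blast
            then show ?thesis using \<kappa>[of j] by (intro bexI[of _ j] mult_strict_right_mono) auto
          qed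
        qed
        ultimately show False by linarith
      qed
      also have "length fs = length (filter ((\<le>) e) (map snd ks))"
        by (simp add: fs_def filter_map o_def case_prod_unfold)
      finally show "card {i \<in> I. e < x i} \<le> length (filter ((\<le>) e) (map snd ks))" by (simp add: J_def)
    qed
    also have "\<dots> \<le> pot_total" using ks(1) trunc_le order_trans by blast
    finally show ?thesis by (simp add: x_def sum_divide_distrib[symmetric])
  qed
  have "(\<lambda>n. \<Sum>i\<in>I. sqrt (max 0 (\<kappa> i - inverse (real (Suc n))))) \<longlonglongrightarrow> (\<Sum>i\<in>I. sqrt (max 0 (\<kappa> i - 0)))"
    by (intro tendsto_intros LIMSEQ_inverse_real_of_nat)
  then show ?thesis
    by (intro LIMSEQ_le_const2[where X = "\<lambda>n. \<Sum>i\<in>I. sqrt (max 0 (\<kappa> i - inverse (real (Suc n))))"])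
      (auto intro!: eta)
qed

end

section \<open>Moments of the eigenvalues\<close>

text \<open>Needed because \<open>neg_trace\<close> integrates over the uncountable set of all
  negative numbers. A simple function with infinite support takes some nonzero value infinitely
  often, which forces \<open>X\<close> to be infinite.\<close>

lemma nn_integral_count_space_le:
  fixes X :: ennreal
  assumes "\<And>F. finite F \<Longrightarrow> F \<subseteq> A \<Longrightarrow> sum f F \<le> X"
  shows "(\<integral>\<^sup>+x. f x \<partial>count_space A) \<le> X"
  unfolding nn_integral_def
proof (rule SUP_least)
  fix g assume "g \<in> {g. simple_function (count_space A) g \<and> g \<le> f}"
  then have g: "simple_function (count_space A) g" "finite (g ` A)" "\<And>x. g x \<le> f x"
    by (auto simp: le_fun_def simple_function_def)
  have le: "sum g F \<le> X" if "finite F" "F \<subseteq> A" for F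
    using sum_mono[of F g f] g(3) assms[OF that] by (meson order_trans)
  show "integral\<^sup>S (count_space A) g \<le> X"
  proof (cases "finite {x \<in> A. g x \<noteq> 0}")
    case True
    have "integral\<^sup>S (count_space A) g = (\<integral>\<^sup>+x. g x \<partial>count_space A)"
      by (rule nn_integral_eq_simple_integral[OF g(1), symmetric])
    also have "\<dots> = (\<Sum>a | a \<in> A \<and> 0 < g a. g a)"
      using True by (intro nn_integral_count_space) (simp add: zero_less_iff_neq_zero)
    also have "\<dots> \<le> X" using True by (intro le) (auto simp: zero_less_iff_neq_zero)
    finally show ?thesis .
  next
    case False
    have "{x \<in> A. g x \<noteq> 0} = (\<Union>y\<in>g ` A - {0}. {x \<in> A. g x = y})" by auto
    then obtain y where y: "y \<noteq> 0" "infinite {x \<in> A. g x = y}"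
      using False g(2) by (metis (no_types, lifting) DiffD2 finite_Diff finite_UN_I singletonI)
    have "of_nat n * y \<le> X" for n
    proof -
      obtain F where F: "finite F" "card F = n" "F \<subseteq> {x \<in> A. g x = y}"
        using infinite_arbitrarily_large[OF y(2)] by blast
      have "sum g F = (\<Sum>x\<in>F. y)" using F by (intro sum.cong) auto
      then show ?thesis using le[of F] F by auto
    qed
    then have "(SUP n. of_nat n * y) \<le> X" by (intro SUP_least)
    then have "(SUP n. of_nat n) * y \<le> X" by (simp add: SUP_mult_right_ennreal)
    then have "X = top" using y(1) by (simp add: ennreal_SUP_of_nat_eq_top ennreal_top_mult top_unique)
    then show ?thesis by simp
  qed
qed

text \<open>The suprema are taken one after another; \<open>Y\<close> collects the terms chosen so
  far, which makes the induction go through.\<close>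

lemma add_sum_Sup_le:
  fixes c :: "'a \<Rightarrow> ennreal" and S :: "'a \<Rightarrow> ennreal set"
  assumes "finite F" "\<And>x. x \<in> F \<Longrightarrow> S x \<noteq> {}"
    and "\<And>s. (\<And>x. x \<in> F \<Longrightarrow> s x \<in> S x) \<Longrightarrow> Y + (\<Sum>x\<in>F. s x * c x) \<le> X"
  shows "Y + (\<Sum>x\<in>F. Sup (S x) * c x) \<le> X"
  using assms
proof (induction F arbitrary: Y rule: finite_induct)
  case (insert x F)
  have *: "(Y + t * c x) + (\<Sum>x\<in>F. Sup (S x) * c x) \<le> X" if t: "t \<in> S x" for t
  proof (rule insert.IH)
    fix s assume s: "\<And>x. x \<in> F \<Longrightarrow> s x \<in> S x"
    have "Y + (\<Sum>y\<in>insert x F. (s(x := t)) y * c y) \<le> X"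
      using s t by (intro insert.prems(2)) auto
    moreover have "(\<Sum>y\<in>F. (s(x := t)) y * c y) = (\<Sum>y\<in>F. s y * c y)"
      using insert.hyps by (intro sum.cong) auto
    ultimately show "(Y + t * c x) + (\<Sum>x\<in>F. s x * c x) \<le> X"
      using insert.hyps by (simp add: add.assoc)
  qed (use insert.prems in auto)
  have "Y + (\<Sum>y\<in>insert x F. Sup (S y) * c y) = (SUP t\<in>S x. t * c x) + (Y + (\<Sum>x\<in>F. Sup (S x) * c x))"
    using insert.hyps by (simp add: SUP_mult_right_ennreal[symmetric] ac_simps)
  also have "\<dots> = (SUP t\<in>S x. t * c x + (Y + (\<Sum>x\<in>F. Sup (S x) * c x)))"
    using insert.prems(1) by (intro ennreal_SUP_add_left[symmetric]) auto
  also have "\<dots> \<le> X" using * by (intro SUP_least) (simp add: ac_simps)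
  finally show ?case .
qed simp

section \<open>Lifting the exponent 1/2 to larger exponents\<close>

lemma nn_integral_powr_Icc:
  assumes "0 < s" "0 \<le> a"
  shows "(\<integral>\<^sup>+t. ennreal (indicator {0..a} t * t powr (s - 1)) \<partial>lborel) = ennreal (a powr s / s)"
proof (rule nn_integral_has_integral_lborel)
  have "((\<lambda>t. t powr (s - 1)) has_integral (a powr (s - 1 + 1) / (s - 1 + 1))) {0..a}"
    using assms by (intro has_integral_powr_from_0) auto
  then have "((\<lambda>t. if t \<in> {0..a} then t powr (s - 1) else 0) has_integral (a powr s / s)) UNIV"
    unfolding has_integral_restrict_UNIV using assms by simp
  moreover have "(\<lambda>t. if t \<in> {0..a} then t powr (s - 1) else 0) = (\<lambda>t. indicator {0..a} t * t powr (s - 1))"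
    by (auto simp: indicator_def)
  ultimately show "((\<lambda>t. indicator {0..a} t * t powr (s - 1)) has_integral (a powr s / s)) UNIV" by simp
qed auto

text \<open>Rough bounds replace the exact Beta integrals: t is restricted to [0, \<kappa>/2] on the
  left, and v - t is replaced by v on the right. The weight is not integrable at 0 if \<gamma> =
  1/2; there a single small value of \<tau> does the job.\<close>

lemma sum_powr_le_of_sum_sqrt:
  fixes v :: "'a \<Rightarrow> real" and \<kappa> :: "'i \<Rightarrow> real"
  assumes M: "sigma_finite_measure M" and v [measurable]: "v \<in> borel_measurable M"
    and I: "finite I" and \<kappa>: "\<And>i. i \<in> I \<Longrightarrow> 0 < \<kappa> i" and \<gamma>: "1/2 \<le> \<gamma>" and A: "0 \<le> A"
    and le: "\<And>\<tau>. 0 < \<tau> \<Longrightarrow> ennreal (\<Sum>i\<in>I. sqrt (max 0 (\<kappa> i - \<tau>))) \<le> ennreal A * (\<integral>\<^sup>+p. ennreal (max 0 (v p - \<tau>)) \<partial>M)"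
  shows "ennreal (\<Sum>i\<in>I. \<kappa> i powr \<gamma>) \<le> ennreal (A * 2 powr \<gamma>) * (\<integral>\<^sup>+p. ennreal (max 0 (v p) powr (\<gamma> + 1/2)) \<partial>M)"
proof (cases "I = {} \<or> \<gamma> = 1/2")
  case True
  show ?thesis
  proof (cases "I = {}")
    case False
    then have \<gamma>2: "\<gamma> = 1/2" using True by simp
    \<comment> \<open>Half of the smallest \<open>\<kappa> i\<close> halves no
      \<open>\<kappa> i\<close> by more than a factor 2, at the cost of sqrt 2 = 2 powr \<gamma>,
      the same constant as in the general case.\<close>
    define \<tau> where "\<tau> = Min (\<kappa> ` I) / 2"
    have \<tau>: "0 < \<tau>" using I False \<kappa> by (auto simp: \<tau>_def)
    have half: "\<kappa> i powr \<gamma> \<le> 2 powr \<gamma> * sqrt (max 0 (\<kappa> i - \<tau>))" if i: "i \<in> I" for i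
    proof -
      have "Min (\<kappa> ` I) \<le> \<kappa> i" using I i by (intro Min_le) auto
      then have "\<kappa> i \<le> 2 * max 0 (\<kappa> i - \<tau>)" by (simp add: \<tau>_def max_def)
      from powr_mono2[OF _ _ this, of \<gamma>] have "\<kappa> i powr \<gamma> \<le> (2 * max 0 (\<kappa> i - \<tau>)) powr \<gamma>"
        using \<kappa>[OF i] \<gamma> by simp
      then show ?thesis by (simp add: powr_mult \<gamma>2 powr_half_sqrt)
    qed
    have "ennreal (\<Sum>i\<in>I. \<kappa> i powr \<gamma>) \<le> ennreal (2 powr \<gamma> * (\<Sum>i\<in>I. sqrt (max 0 (\<kappa> i - \<tau>))))"
      unfolding sum_distrib_left by (intro ennreal_leI sum_mono half)
    also have "\<dots> = ennreal (2 powr \<gamma>) * ennreal (\<Sum>i\<in>I. sqrt (max 0 (\<kappa> i - \<tau>)))"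
      by (intro ennreal_mult) (auto intro: sum_nonneg)
    also have "\<dots> \<le> ennreal (2 powr \<gamma>) * (ennreal A * (\<integral>\<^sup>+p. ennreal (max 0 (v p) powr (\<gamma> + 1/2)) \<partial>M))"
    proof (intro mult_left_mono order_trans[OF le[OF \<tau>]] nn_integral_mono)
      show "ennreal (max 0 (v p - \<tau>)) \<le> ennreal (max 0 (v p) powr (\<gamma> + 1/2))" for p
        using \<tau> by (intro ennreal_leI) (auto simp: \<gamma>2)
    qed auto
    finally show ?thesis using A by (simp add: ennreal_mult ac_simps)
  qed simp
next
  case False
  define s where "s = \<gamma> - 1/2"
  have s: "0 < s" using False \<gamma> by (simp add: s_def)
  interpret sigma_finite_measure M by fact
  interpret pair_sigma_finite lborel M
    by (intro pair_sigma_finite.intro lborel.sigma_finite_measure_axioms M)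
  \<comment> \<open>Cut off at 0, because the hypothesis \<open>le\<close> speaks of positive \<tau>
    only.\<close>
  define g where "g t = (if 0 < t then t powr (s - 1) else 0)" for t :: real
  have [measurable]: "g \<in> borel_measurable borel" unfolding g_def by measurable
  have g0: "0 \<le> g t" for t by (simp add: g_def)
  have g_eq: "indicator {0..a} t * t powr (s - 1) = (if t \<le> a then g t else 0)" for a t
    by (auto simp: g_def indicator_def)
  have lower: "ennreal (\<kappa> i powr \<gamma>) \<le> ennreal (s * 2 powr \<gamma>) * (\<integral>\<^sup>+t. ennreal (g t * sqrt (max 0 (\<kappa> i - t))) \<partial>lborel)"
    if i: "i \<in> I" for i
  proof -
    \<comment> \<open>For t up to \<kappa>/2 the difference \<kappa> - t is still at least
      \<kappa>/2; this costs the factor 2 powr \<gamma>.\<close>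
    let ?a = "\<kappa> i / 2"
    have a: "0 < ?a" using \<kappa>[OF i] by simp
    have "\<kappa> i powr \<gamma> = 2 powr \<gamma> * ?a powr \<gamma>" using a by (simp add: powr_divide)
    also have "?a powr \<gamma> = sqrt ?a * ?a powr s"
      using a by (simp add: s_def powr_half_sqrt[symmetric] powr_add[symmetric])
    finally have "ennreal (\<kappa> i powr \<gamma>) = ennreal (s * 2 powr \<gamma> * (sqrt ?a * (?a powr s / s)))"
      using s by simp
    also have "\<dots> = ennreal (s * 2 powr \<gamma>) * (ennreal (sqrt ?a) * ennreal (?a powr s / s))"
      using s a by (simp add: ennreal_mult[symmetric])
    also have "ennreal (?a powr s / s) = (\<integral>\<^sup>+t. ennreal (indicator {0..?a} t * t powr (s - 1)) \<partial>lborel)"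
      using s a by (intro nn_integral_powr_Icc[symmetric]) auto
    also have "ennreal (sqrt ?a) * \<dots> = (\<integral>\<^sup>+t. ennreal (sqrt ?a) * ennreal (indicator {0..?a} t * t powr (s - 1)) \<partial>lborel)"
      by (intro nn_integral_cmult[symmetric]) auto
    also have "\<dots> \<le> (\<integral>\<^sup>+t. ennreal (g t * sqrt (max 0 (\<kappa> i - t))) \<partial>lborel)"
    proof (rule nn_integral_mono)
      fix t :: real
      have "sqrt ?a * (if t \<le> ?a then g t else 0) \<le> g t * sqrt (max 0 (\<kappa> i - t))"
      proof (cases "t \<le> ?a")
        case True
        then have "?a \<le> max 0 (\<kappa> i - t)" by linarith
        then have "sqrt ?a \<le> sqrt (max 0 (\<kappa> i - t))" by (rule real_sqrt_le_mono)
        then show ?thesis using True g0[of t] by (simp add: mult.commute mult_left_mono)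
      qed (use g0[of t] in auto)
      then show "ennreal (sqrt ?a) * ennreal (indicator {0..?a} t * t powr (s - 1)) \<le> ennreal (g t * sqrt (max 0 (\<kappa> i - t)))"
        unfolding g_eq using a g0[of t] by (auto simp: ennreal_mult[symmetric] intro!: ennreal_leI)
    qed
    finally show ?thesis by (simp add: mult_left_mono)
  qed
  have upper: "(\<integral>\<^sup>+t. ennreal (g t * max 0 (v p - t)) \<partial>lborel) \<le> ennreal (max 0 (v p) powr (\<gamma> + 1/2) / s)" for p
  proof -
    let ?a = "max 0 (v p)"
    have "(\<integral>\<^sup>+t. ennreal (g t * max 0 (v p - t)) \<partial>lborel)
      \<le> (\<integral>\<^sup>+t. ennreal ?a * ennreal (indicator {0..?a} t * t powr (s - 1)) \<partial>lborel)"
    proof (rule nn_integral_mono)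
      fix t :: real
      have "g t * max 0 (v p - t) \<le> ?a * (if t \<le> ?a then g t else 0)"
      proof (cases "0 < t \<and> t \<le> ?a")
        case True
        then have "g t * max 0 (v p - t) \<le> g t * ?a" using g0[of t] by (intro mult_left_mono) auto
        then show ?thesis using True by (simp add: mult.commute)
      qed (auto simp: g_def)
      then show "ennreal (g t * max 0 (v p - t)) \<le> ennreal ?a * ennreal (indicator {0..?a} t * t powr (s - 1))"
        unfolding g_eq using g0[of t] by (subst ennreal_mult[symmetric]) (auto intro!: ennreal_leI)
    qed
    also have "\<dots> = ennreal ?a * ennreal (?a powr s / s)"
      using s by (subst nn_integral_cmult) (auto simp: nn_integral_powr_Icc)
    also have "\<dots> = ennreal (?a powr (\<gamma> + 1/2) / s)"
    proof -
      have "?a * ?a powr s = ?a powr (1 + s)" by (cases "?a = 0") (auto simp: powr_add)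
      then show ?thesis using s by (simp add: ennreal_mult[symmetric] s_def ac_simps)
    qed
    finally show ?thesis .
  qed
  have "ennreal (\<Sum>i\<in>I. \<kappa> i powr \<gamma>) = (\<Sum>i\<in>I. ennreal (\<kappa> i powr \<gamma>))" by simp
  also have "\<dots> \<le> (\<Sum>i\<in>I. ennreal (s * 2 powr \<gamma>) * (\<integral>\<^sup>+t. ennreal (g t * sqrt (max 0 (\<kappa> i - t))) \<partial>lborel))"
    by (intro sum_mono lower)
  also have "\<dots> = ennreal (s * 2 powr \<gamma>) * (\<integral>\<^sup>+t. (\<Sum>i\<in>I. ennreal (g t * sqrt (max 0 (\<kappa> i - t)))) \<partial>lborel)"
    by (subst nn_integral_sum) (auto simp: sum_distrib_left)
  also have "\<dots> \<le> ennreal (s * 2 powr \<gamma>) * (\<integral>\<^sup>+t. ennreal A * (\<integral>\<^sup>+p. ennreal (g t * max 0 (v p - t)) \<partial>M) \<partial>lborel)"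
  proof (intro mult_left_mono nn_integral_mono)
    fix t :: real
    show "(\<Sum>i\<in>I. ennreal (g t * sqrt (max 0 (\<kappa> i - t)))) \<le> ennreal A * (\<integral>\<^sup>+p. ennreal (g t * max 0 (v p - t)) \<partial>M)"
    proof (cases "0 < t")
      case True
      have "(\<Sum>i\<in>I. ennreal (g t * sqrt (max 0 (\<kappa> i - t)))) = ennreal (g t) * ennreal (\<Sum>i\<in>I. sqrt (max 0 (\<kappa> i - t)))"
        using g0[of t] by (subst ennreal_mult[symmetric]) (auto simp: sum_distrib_left sum_nonneg)
      also have "\<dots> \<le> ennreal (g t) * (ennreal A * (\<integral>\<^sup>+p. ennreal (max 0 (v p - t)) \<partial>M))"
        by (intro mult_left_mono le True) auto
      also have "\<dots> = ennreal A * (\<integral>\<^sup>+p. ennreal (g t) * ennreal (max 0 (v p - t)) \<partial>M)"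
        by (subst nn_integral_cmult) (auto simp: ac_simps)
      finally show ?thesis using g0[of t] by (simp add: ennreal_mult)
    qed (simp add: g_def)
  qed auto
  also have "\<dots> = ennreal (s * 2 powr \<gamma>) * (ennreal A * (\<integral>\<^sup>+t. (\<integral>\<^sup>+p. ennreal (g t * max 0 (v p - t)) \<partial>M) \<partial>lborel))"
    by (subst nn_integral_cmult) auto
  also have "(\<integral>\<^sup>+t. (\<integral>\<^sup>+p. ennreal (g t * max 0 (v p - t)) \<partial>M) \<partial>lborel)
      = (\<integral>\<^sup>+p. (\<integral>\<^sup>+t. ennreal (g t * max 0 (v p - t)) \<partial>lborel) \<partial>M)"
    by (rule Fubini'[symmetric]) measurable
  also have "\<dots> \<le> (\<integral>\<^sup>+p. ennreal (1 / s) * ennreal (max 0 (v p) powr (\<gamma> + 1/2)) \<partial>M)"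
  proof (rule nn_integral_mono)
    show "(\<integral>\<^sup>+t. ennreal (g t * max 0 (v p - t)) \<partial>lborel) \<le> ennreal (1 / s) * ennreal (max 0 (v p) powr (\<gamma> + 1/2))" for p
      using upper[of p] s by (simp add: ennreal_mult[symmetric])
  qed
  also have "\<dots> = ennreal (1 / s) * (\<integral>\<^sup>+p. ennreal (max 0 (v p) powr (\<gamma> + 1/2)) \<partial>M)"
    by (rule nn_integral_cmult) measurable
  also have "ennreal (s * 2 powr \<gamma>) * (ennreal A * (ennreal (1 / s) * Y)) = ennreal (A * 2 powr \<gamma>) * Y" for Y
  proof -
    have "ennreal (s * 2 powr \<gamma>) * ennreal A * ennreal (1 / s) = ennreal (A * 2 powr \<gamma>)"
      using s A by (simp add: ennreal_mult[symmetric])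
    then show ?thesis by (metis mult.assoc)
  qed
  finally show ?thesis by (simp add: mult_left_mono)
qed

lemma integral_square_sum:
  fixes f :: "'i \<Rightarrow> 'a \<Rightarrow> real"
  assumes "\<And>i j. i \<in> I \<Longrightarrow> j \<in> I \<Longrightarrow> integrable M (\<lambda>p. w p * f i p * f j p)"
  shows "integrable M (\<lambda>p. w p * (\<Sum>i\<in>I. c i * f i p)\<^sup>2)"
    and "(LINT p|M. w p * (\<Sum>i\<in>I. c i * f i p)\<^sup>2) = (\<Sum>i\<in>I. \<Sum>j\<in>I. c i * c j * (LINT p|M. w p * f i p * f j p))"
proof -
  have eq: "(\<lambda>p. w p * (\<Sum>i\<in>I. c i * f i p)\<^sup>2) = (\<lambda>p. \<Sum>i\<in>I. \<Sum>j\<in>I. c i * c j * (w p * f i p * f j p))"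
    by (simp add: power2_eq_square sum_product sum_distrib_left ac_simps)
  show "integrable M (\<lambda>p. w p * (\<Sum>i\<in>I. c i * f i p)\<^sup>2)"
    unfolding eq using assms by (intro Bochner_Integration.integrable_sum integrable_mult_right) auto
  have "(LINT p|M. (\<Sum>i\<in>I. \<Sum>j\<in>I. c i * c j * (w p * f i p * f j p)))
      = (\<Sum>i\<in>I. LINT p|M. (\<Sum>j\<in>I. c i * c j * (w p * f i p * f j p)))"
    using assms by (intro Bochner_Integration.integral_sum Bochner_Integration.integrable_sum integrable_mult_right) auto
  also have "\<dots> = (\<Sum>i\<in>I. \<Sum>j\<in>I. LINT p|M. c i * c j * (w p * f i p * f j p))"
    using assms by (intro sum.cong refl Bochner_Integration.integral_sum integrable_mult_right) auto
  finally show "(LINT p|M. w p * (\<Sum>i\<in>I. c i * f i p)\<^sup>2) = (\<Sum>i\<in>I. \<Sum>j\<in>I. c i * c j * (LINT p|M. w p * f i p * f j p))"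
    unfolding eq by simp
qed

lemma integrable_weighted_product:
  fixes f g w :: "'a \<Rightarrow> real"
  assumes "f \<in> borel_measurable M" "g \<in> borel_measurable M" "w \<in> borel_measurable M"
    "integrable M (\<lambda>p. \<bar>w p\<bar> * (f p)\<^sup>2)" "integrable M (\<lambda>p. \<bar>w p\<bar> * (g p)\<^sup>2)"
  shows "integrable M (\<lambda>p. w p * f p * g p)"
proof (rule Bochner_Integration.integrable_bound)
  show "integrable M (\<lambda>p. \<bar>w p\<bar> * (f p)\<^sup>2 + \<bar>w p\<bar> * (g p)\<^sup>2)" using assms by simp
  show "AE p in M. norm (w p * f p * g p) \<le> norm (\<bar>w p\<bar> * (f p)\<^sup>2 + \<bar>w p\<bar> * (g p)\<^sup>2)"
  proof (rule AE_I2)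
    fix p
    have "\<bar>f p * g p\<bar> \<le> (f p)\<^sup>2 + (g p)\<^sup>2"
      using sum_squares_bound[of "\<bar>f p\<bar>" "\<bar>g p\<bar>"] mult_nonneg_nonneg[OF abs_ge_zero abs_ge_zero, of "f p" "g p"]
      unfolding abs_mult power2_abs by linarith
    then have "\<bar>w p\<bar> * \<bar>f p * g p\<bar> \<le> \<bar>w p\<bar> * ((f p)\<^sup>2 + (g p)\<^sup>2)" by (intro mult_left_mono) auto
    then show "norm (w p * f p * g p) \<le> norm (\<bar>w p\<bar> * (f p)\<^sup>2 + \<bar>w p\<bar> * (g p)\<^sup>2)"
      by (simp add: abs_mult distrib_left mult.assoc)
  qed
qed (use assms in measurable)

section \<open>Eigenfunctions of the Schroedinger operator\<close>

locale schroedinger_tree = neumann_tree +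
  fixes V :: "nat \<Rightarrow> real \<Rightarrow> real"
  assumes V: "admissible_potential Vt r par len V"
begin

lemma V_pair_measurable: "(\<lambda>p. V (fst p) (snd p)) \<in> borel_measurable (count_space edges \<Otimes>\<^sub>M lborel)"
  using V by (simp add: admissible_potential_def)

lemma V_measurable: "x \<in> edges \<Longrightarrow> V x \<in> borel_measurable borel"
  using measurable_compose[OF measurable_Pair1'[of x "count_space edges" lborel] V_pair_measurable] by simp

lemma V_T_measurable: "(\<lambda>p. V (fst p) (snd p)) \<in> borel_measurable T"
  using V_pair_measurable by (simp cong: measurable_cong_sets add: sets_tree_measure)

lemma V_bounded_above: "\<exists>C\<ge>0. \<forall>x\<in>edges. \<forall>t\<in>{0..len x}. V x t \<le> C"
proof -
  obtain R where R: "\<And>x t. x \<in> edges \<Longrightarrow> t \<in> {0..len x} \<Longrightarrow> R < point_dist r par len x t \<Longrightarrow> V x t \<le> 1"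
    using V unfolding admissible_potential_def by (meson zero_less_one)
  obtain C where C: "\<And>x t. x \<in> edges \<Longrightarrow> t \<in> {0..len x} \<Longrightarrow> point_dist r par len x t \<le> R \<Longrightarrow> \<bar>V x t\<bar> \<le> C"
    using V unfolding admissible_potential_def by meson
  have "V x t \<le> max 1 C" if "x \<in> edges" "t \<in> {0..len x}" for x t
    using R[OF that] C[OF that] by (cases "R < point_dist r par len x t") auto
  then show ?thesis by (intro exI[of _ "max 1 C"]) auto
qed

text \<open>Testing the weak equation of one eigenfunction with another shows that the form is
  diagonal on their span, with entries \<open>lam i\<close>. Subtracting \<tau> from the potential
  turns these into \<open>\<kappa> i\<close> = - lam i - \<tau>.\<close>

lemma sum_sqrt_eigenvalues_le:
  fixes \<phi> :: "'i \<Rightarrow> (nat \<Rightarrow> real \<Rightarrow> real) \<times> (nat \<Rightarrow> real \<Rightarrow> real)"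
  assumes I: "finite I" and eig: "\<And>i. i \<in> I \<Longrightarrow> eigenfun Vt r par len V (lam i) (fst (\<phi> i)) (snd (\<phi> i))"
    and on: "\<And>i j. i \<in> I \<Longrightarrow> j \<in> I \<Longrightarrow>
      (LINT p|T. fst (\<phi> i) (fst p) (snd p) * fst (\<phi> j) (fst p) (snd p)) = (if i = j then 1 else 0)"
    and \<tau>: "0 < \<tau>" and int: "integrable T (\<lambda>p. max 0 (V (fst p) (snd p) - \<tau>))"
  shows "(\<Sum>i\<in>I. sqrt (max 0 (- lam i - \<tau>))) \<le> 16 * (LINT p|T. max 0 (V (fst p) (snd p) - \<tau>))"
proof -
  obtain C where C: "0 \<le> C" "\<And>x t. x \<in> edges \<Longrightarrow> t \<in> {0..len x} \<Longrightarrow> V x t \<le> C"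
    using V_bounded_above by blast
  obtain R where R: "\<And>x t. x \<in> edges \<Longrightarrow> t \<in> {0..len x} \<Longrightarrow> R < point_dist r par len x t \<Longrightarrow> V x t \<le> \<tau>"
    using V \<tau> unfolding admissible_potential_def by meson
  \<comment> \<open>With this factor 2, V \<le> W/2 + \<tau>, which matches
    \<open>pot_energy_total / 2\<close> in \<open>sum_sqrt_le_potential\<close> and turns its 8 into
    16. Since \<tau> is positive, \<open>W\<close> vanishes outside the ball of radius
    \<open>R\<close>.\<close>
  define W where "W x s = 2 * max 0 (V x s - \<tau>)" for x s
  interpret P: tree_potential Vt r par len W "2 * C"
  proof
    show "W x \<in> borel_measurable borel" if "x \<in> edges" for x
      unfolding W_def using V_measurable[OF that] by measurable
    show "W x s \<le> 2 * C" if "x \<in> edges" "s \<in> {0..len x}" for x s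
      unfolding W_def using C(1) C(2)[OF that] \<tau> by auto
  qed (use C in \<open>auto simp: W_def\<close>)
  have dom: "form_dom Vt r par len V (fst (\<phi> i)) (snd (\<phi> i))" if "i \<in> I" for i
    using eig[OF that] unfolding eigenfun_def by blast
  have H: "\<phi> i \<in> H1" if "i \<in> I" for i
    using dom[OF that] unfolding form_dom_def H1_def by simp
  have weak: "(LINT p|T. snd (\<phi> i) (fst p) (snd p) * snd (\<phi> j) (fst p) (snd p))
      - (LINT p|T. V (fst p) (snd p) * fst (\<phi> i) (fst p) (snd p) * fst (\<phi> j) (fst p) (snd p))
      = lam i * (if i = j then 1 else 0)" if "i \<in> I" "j \<in> I" for i j
    using eig[OF that(1)] dom[OF that(2)] on[OF that] unfolding eigenfun_def by simp
  note sq = H1_square_integrable[OF H]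
  \<comment> \<open>The form domain controls the negative part of \<open>V\<close>; the positive
    part is at most \<open>C\<close>.\<close>
  have absV: "integrable T (\<lambda>p. \<bar>V (fst p) (snd p)\<bar> * (fst (\<phi> i) (fst p) (snd p))\<^sup>2)" if i: "i \<in> I" for i
  proof (rule Bochner_Integration.integrable_bound)
    show "integrable T (\<lambda>p. max 0 (- V (fst p) (snd p)) * (fst (\<phi> i) (fst p) (snd p))\<^sup>2 + C * (fst (\<phi> i) (fst p) (snd p))\<^sup>2)"
      using dom[OF i] sq[OF i] unfolding form_dom_def by simp
    show "AE p in T. norm (\<bar>V (fst p) (snd p)\<bar> * (fst (\<phi> i) (fst p) (snd p))\<^sup>2)
       \<le> norm (max 0 (- V (fst p) (snd p)) * (fst (\<phi> i) (fst p) (snd p))\<^sup>2 + C * (fst (\<phi> i) (fst p) (snd p))\<^sup>2)"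
      using AE_tree_measure
    proof eventually_elim
      fix p assume p: "fst p \<in> edges \<and> snd p \<in> {0..len (fst p)}"
      have "\<bar>V (fst p) (snd p)\<bar> \<le> max 0 (- V (fst p) (snd p)) + C" using C p by fastforce
      then have "\<bar>V (fst p) (snd p)\<bar> * (fst (\<phi> i) (fst p) (snd p))\<^sup>2 \<le> (max 0 (- V (fst p) (snd p)) + C) * (fst (\<phi> i) (fst p) (snd p))\<^sup>2"
        by (intro mult_right_mono) auto
      then show "norm (\<bar>V (fst p) (snd p)\<bar> * (fst (\<phi> i) (fst p) (snd p))\<^sup>2)
       \<le> norm (max 0 (- V (fst p) (snd p)) * (fst (\<phi> i) (fst p) (snd p))\<^sup>2 + C * (fst (\<phi> i) (fst p) (snd p))\<^sup>2)"
        by (simp add: distrib_right)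
    qed
  qed (use sq[OF i] V_T_measurable in measurable)
  have iV: "integrable T (\<lambda>p. V (fst p) (snd p) * fst (\<phi> i) (fst p) (snd p) * fst (\<phi> j) (fst p) (snd p))"
    if "i \<in> I" "j \<in> I" for i j
    by (rule integrable_weighted_product[OF sq(1)[OF that(1)] sq(1)[OF that(2)] V_T_measurable absV[OF that(1)] absV[OF that(2)]])
  have iM: "integrable T (\<lambda>p. 1 * fst (\<phi> i) (fst p) (snd p) * fst (\<phi> j) (fst p) (snd p))"
    and iK: "integrable T (\<lambda>p. 1 * snd (\<phi> i) (fst p) (snd p) * snd (\<phi> j) (fst p) (snd p))"
    if "i \<in> I" "j \<in> I" for i j
    using sq[OF that(1)] sq[OF that(2)] by (intro integrable_weighted_product; simp)+
  have delta: "(\<Sum>i\<in>I. \<Sum>j\<in>I. c i * c j * (a i * (if i = j then 1 else 0))) = (\<Sum>i\<in>I. a i * (c i)\<^sup>2)" for a c :: "'i \<Rightarrow> real"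
    using I by (intro sum.cong refl) (simp add: if_distrib[of "\<lambda>x. _ * x"] power2_eq_square ac_simps cong: if_cong)
  have M: "mass_total (lincomb \<phi> I c) = (\<Sum>i\<in>I. (c i)\<^sup>2)" for c
  proof -
    have "mass_total (lincomb \<phi> I c) = (\<Sum>i\<in>I. \<Sum>j\<in>I. c i * c j * (1 * (if i = j then 1 else 0)))"
      using integral_square_sum(2)[where I = I and M = T and w = "\<lambda>_. 1" and c = c
          and f = "\<lambda>i p. fst (\<phi> i) (fst p) (snd p)", OF iM] on
      by (simp add: mass_total_def lincomb_def cong: sum.cong)
    then show ?thesis using delta[of c "\<lambda>_. 1"] by simp
  qed
  have "(\<Sum>i\<in>I. sqrt (max 0 (- lam i - \<tau>))) \<le> 8 * P.pot_total"
  proof (rule P.sum_sqrt_le_potential[where R = R and \<phi> = \<phi>])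
    show "integrable T (\<lambda>p. W (fst p) (snd p))" unfolding W_def using int by simp
    show "point_dist r par len x s \<le> R" if "x \<in> edges" "s \<in> {0..len x}" "W x s \<noteq> 0" for x s
      using R[OF that(1,2)] that(3) unfolding W_def by force
    fix c
    let ?\<psi> = "lincomb \<phi> I c"
    have \<psi>: "?\<psi> \<in> H1" by (rule H1_lincomb[OF I H])
    let ?V = "LINT p|T. V (fst p) (snd p) * (fst ?\<psi> (fst p) (snd p))\<^sup>2"
    have K: "kin_total ?\<psi> = (\<Sum>i\<in>I. \<Sum>j\<in>I. c i * c j * (LINT p|T. snd (\<phi> i) (fst p) (snd p) * snd (\<phi> j) (fst p) (snd p)))"
      using integral_square_sum(2)[where I = I and M = T and w = "\<lambda>_. 1" and c = c
          and f = "\<lambda>i p. snd (\<phi> i) (fst p) (snd p)", OF iK]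
      by (simp add: kin_total_def lincomb_def)
    have Vi: "integrable T (\<lambda>p. V (fst p) (snd p) * (fst ?\<psi> (fst p) (snd p))\<^sup>2)"
      and Ve: "?V = (\<Sum>i\<in>I. \<Sum>j\<in>I. c i * c j *
        (LINT p|T. V (fst p) (snd p) * fst (\<phi> i) (fst p) (snd p) * fst (\<phi> j) (fst p) (snd p)))"
      using integral_square_sum[where I = I and M = T and w = "\<lambda>p. V (fst p) (snd p)" and c = c
          and f = "\<lambda>i p. fst (\<phi> i) (fst p) (snd p)", OF iV]
      by (simp_all add: lincomb_def)
    have "kin_total ?\<psi> - ?V = (\<Sum>i\<in>I. \<Sum>j\<in>I. c i * c j * (lam i * (if i = j then 1 else 0)))"
      unfolding K Ve sum_subtractf[symmetric] right_diff_distrib[symmetric]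
      by (intro sum.cong refl) (simp only: weak)
    then have KV: "kin_total ?\<psi> - ?V = (\<Sum>i\<in>I. lam i * (c i)\<^sup>2)" unfolding delta .
    have "?V \<le> (LINT p|T. W (fst p) (snd p) * (fst ?\<psi> (fst p) (snd p))\<^sup>2 / 2 + \<tau> * (fst ?\<psi> (fst p) (snd p))\<^sup>2)"
    proof (rule integral_mono[OF Vi])
      show "integrable T (\<lambda>p. W (fst p) (snd p) * (fst ?\<psi> (fst p) (snd p))\<^sup>2 / 2 + \<tau> * (fst ?\<psi> (fst p) (snd p))\<^sup>2)"
        using P.integrable_pot_energy[OF \<psi>] H1_square_integrable(3)[OF \<psi>] by simp
      show "V (fst p) (snd p) * (fst ?\<psi> (fst p) (snd p))\<^sup>2
         \<le> W (fst p) (snd p) * (fst ?\<psi> (fst p) (snd p))\<^sup>2 / 2 + \<tau> * (fst ?\<psi> (fst p) (snd p))\<^sup>2" for p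
        using mult_right_mono[of "V (fst p) (snd p)" "max 0 (V (fst p) (snd p) - \<tau>) + \<tau>" "(fst ?\<psi> (fst p) (snd p))\<^sup>2"]
        by (simp add: W_def distrib_right)
    qed
    also have "\<dots> = P.pot_energy_total ?\<psi> / 2 + \<tau> * mass_total ?\<psi>"
      unfolding P.pot_energy_total_def mass_total_def
      using P.integrable_pot_energy[OF \<psi>] H1_square_integrable(3)[OF \<psi>] by simp
    finally have "kin_total ?\<psi> - P.pot_energy_total ?\<psi> / 2 \<le> (\<Sum>i\<in>I. lam i * (c i)\<^sup>2) + \<tau> * (\<Sum>i\<in>I. (c i)\<^sup>2)"
      using KV M[of c] by simp
    also have "\<dots> = - (\<Sum>i\<in>I. (- lam i - \<tau>) * (c i)\<^sup>2)"
      by (simp add: sum_negf[symmetric] sum_distrib_left sum.distrib[symmetric] algebra_simps)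
    finally show "kin_total ?\<psi> - P.pot_energy_total ?\<psi> / 2 \<le> - (\<Sum>i\<in>I. (- lam i - \<tau>) * (c i)\<^sup>2)" .
    show "mass_total ?\<psi> = (\<Sum>i\<in>I. (c i)\<^sup>2)" by (rule M)
  qed (use I H in auto)
  also have "8 * P.pot_total = 16 * (LINT p|T. max 0 (V (fst p) (snd p) - \<tau>))"
    unfolding P.pot_total_def W_def by simp
  finally show ?thesis .
qed

lemma sigma_finite_T: "sigma_finite_measure T"
proof -
  interpret P: pair_sigma_finite "count_space edges" lborel by (rule pair_sigma_finite_edges)
  show ?thesis
    unfolding tree_measure_alt
    by (subst P.P.sigma_finite_iff_density_finite)
      (use measurable_edge_indicator[of len edges] in \<open>auto simp: indicator_def\<close>)
qed

lemma sum_powr_eigenvalues_le: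
  fixes \<phi> :: "'i \<Rightarrow> (nat \<Rightarrow> real \<Rightarrow> real) \<times> (nat \<Rightarrow> real \<Rightarrow> real)"
  assumes I: "finite I" and eig: "\<And>i. i \<in> I \<Longrightarrow> eigenfun Vt r par len V (lam i) (fst (\<phi> i)) (snd (\<phi> i))"
    and on: "\<And>i j. i \<in> I \<Longrightarrow> j \<in> I \<Longrightarrow>
      (LINT p|T. fst (\<phi> i) (fst p) (snd p) * fst (\<phi> j) (fst p) (snd p)) = (if i = j then 1 else 0)"
    and neg: "\<And>i. i \<in> I \<Longrightarrow> lam i < 0" and \<gamma>: "1/2 \<le> \<gamma>"
  shows "ennreal (\<Sum>i\<in>I. \<bar>lam i\<bar> powr \<gamma>)
    \<le> ennreal (16 * 2 powr \<gamma>) * (\<integral>\<^sup>+p. ennreal (max 0 (V (fst p) (snd p)) powr (\<gamma> + 1/2)) \<partial>T)"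
proof -
  have "ennreal (\<Sum>i\<in>I. (- lam i) powr \<gamma>)
    \<le> ennreal (16 * 2 powr \<gamma>) * (\<integral>\<^sup>+p. ennreal (max 0 (V (fst p) (snd p)) powr (\<gamma> + 1/2)) \<partial>T)"
  proof (rule sum_powr_le_of_sum_sqrt[OF sigma_finite_T V_T_measurable I _ \<gamma>])
    fix \<tau> :: real assume \<tau>: "0 < \<tau>"
    let ?X = "\<integral>\<^sup>+p. ennreal (max 0 (V (fst p) (snd p) - \<tau>)) \<partial>T"
    show "ennreal (\<Sum>i\<in>I. sqrt (max 0 (- lam i - \<tau>))) \<le> ennreal 16 * ?X"
    proof (cases "?X = \<infinity>")
      case True
      then show ?thesis by (simp add: ennreal_mult_top)
    next
      case False
      have int: "integrable T (\<lambda>p. max 0 (V (fst p) (snd p) - \<tau>))"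
        using False V_T_measurable by (intro integrableI_nonneg) (auto simp: less_top)
      have "?X = ennreal (LINT p|T. max 0 (V (fst p) (snd p) - \<tau>))"
        by (rule nn_integral_eq_integral[OF int]) auto
      moreover have "(\<Sum>i\<in>I. sqrt (max 0 (- lam i - \<tau>))) \<le> 16 * (LINT p|T. max 0 (V (fst p) (snd p) - \<tau>))"
        by (rule sum_sqrt_eigenvalues_le[OF I eig on \<tau> int])
      ultimately show ?thesis by (simp add: ennreal_mult'[symmetric] ennreal_leI del: ennreal_numeral)
    qed
  qed (use neg in auto)
  moreover have "(\<Sum>i\<in>I. \<bar>lam i\<bar> powr \<gamma>) = (\<Sum>i\<in>I. (- lam i) powr \<gamma>)"
    using neg by (intro sum.cong refl) (simp add: abs_if)
  ultimately show ?thesis by simp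
qed

text \<open>The form is symmetric, so testing each function with the other gives both
  \<open>a\<close> and \<open>b\<close> times the same inner product.\<close>

lemma eigenfun_orthogonal:
  assumes "eigenfun Vt r par len V a \<phi> d\<phi>" "eigenfun Vt r par len V b \<psi> d\<psi>" "a \<noteq> b"
  shows "(LINT p|T. \<phi> (fst p) (snd p) * \<psi> (fst p) (snd p)) = 0"
proof -
  have "(LINT p|T. d\<phi> (fst p) (snd p) * d\<psi> (fst p) (snd p))
      - (LINT p|T. V (fst p) (snd p) * \<phi> (fst p) (snd p) * \<psi> (fst p) (snd p))
      = a * (LINT p|T. \<phi> (fst p) (snd p) * \<psi> (fst p) (snd p))"
    using assms(1,2) unfolding eigenfun_def by blast
  moreover have "(LINT p|T. d\<psi> (fst p) (snd p) * d\<phi> (fst p) (snd p))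
      - (LINT p|T. V (fst p) (snd p) * \<psi> (fst p) (snd p) * \<phi> (fst p) (snd p))
      = b * (LINT p|T. \<psi> (fst p) (snd p) * \<phi> (fst p) (snd p))"
    using assms(1,2) unfolding eigenfun_def by blast
  ultimately have "a * (LINT p|T. \<phi> (fst p) (snd p) * \<psi> (fst p) (snd p))
      = b * (LINT p|T. \<phi> (fst p) (snd p) * \<psi> (fst p) (snd p))"
    by (simp only: ac_simps)
  then show ?thesis using assms(3) by simp
qed

text \<open>Finite orthonormal families for finitely many different eigenvalues unite to one
  orthonormal family, to which the finite estimate applies; the suprema defining multiplicity and
  trace follow.\<close>

theorem neg_trace_le:
  assumes \<gamma>: "1/2 \<le> \<gamma>"
  shows "neg_trace Vt r par len V \<gamma>
    \<le> ennreal (16 * 2 powr \<gamma>) * (\<integral>\<^sup>+p. ennreal (max 0 (V (fst p) (snd p)) powr (\<gamma> + 1/2)) \<partial>T)"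
  (is "_ \<le> ?X")
  unfolding neg_trace_def
proof (rule nn_integral_count_space_le)
  fix F :: "real set" assume F: "finite F" "F \<subseteq> {lam. lam < 0}"
  define is_family where "is_family lam n \<phi> d\<phi> \<longleftrightarrow>
      (\<forall>i<n. eigenfun Vt r par len V lam (\<phi> i) (d\<phi> i)) \<and>
      (\<forall>i<n. \<forall>j<n. (LINT p|T. \<phi> i (fst p) (snd p) * \<phi> j (fst p) (snd p)) = (if i = j then 1 else 0))"
    for lam and n :: nat and \<phi> d\<phi> :: "nat \<Rightarrow> nat \<Rightarrow> real \<Rightarrow> real"
  define S where "S lam = {of_nat n :: ennreal | n. \<exists>\<phi> d\<phi>. is_family lam n \<phi> d\<phi>}" for lam
  have mult: "eig_mult Vt r par len V lam = Sup (S lam)" for lam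
    by (simp add: eig_mult_def S_def is_family_def)
  have "0 + (\<Sum>lam\<in>F. Sup (S lam) * ennreal (\<bar>lam\<bar> powr \<gamma>)) \<le> ?X"
  proof (rule add_sum_Sup_le[OF F(1)])
    \<comment> \<open>The empty family is present even if \<open>lam\<close> is not an
      eigenvalue.\<close>
    show "S lam \<noteq> {}" for lam
      unfolding S_def is_family_def by (auto intro!: exI[of _ "0::nat"])
    fix s assume "\<And>lam. lam \<in> F \<Longrightarrow> s lam \<in> S lam"
    then have "\<forall>lam\<in>F. \<exists>n \<phi> d\<phi>. s lam = of_nat n \<and> is_family lam n \<phi> d\<phi>" unfolding S_def by blast
    then obtain n \<phi> d\<phi> where fam: "\<And>lam. lam \<in> F \<Longrightarrow> s lam = of_nat (n lam)"
      "\<And>lam. lam \<in> F \<Longrightarrow> is_family lam (n lam) (\<phi> lam) (d\<phi> lam)" by metis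
    define I where "I = Sigma F (\<lambda>lam. {..<n lam})"
    have "(\<Sum>lam\<in>F. s lam * ennreal (\<bar>lam\<bar> powr \<gamma>)) = (\<Sum>lam\<in>F. \<Sum>i<n lam. ennreal (\<bar>lam\<bar> powr \<gamma>))"
      by (intro sum.cong refl) (simp add: fam)
    also have "\<dots> = (\<Sum>q\<in>I. ennreal (\<bar>fst q\<bar> powr \<gamma>))"
      unfolding I_def using F(1) by (subst sum.Sigma) (auto simp: case_prod_unfold)
    also have "\<dots> = ennreal (\<Sum>q\<in>I. \<bar>fst q\<bar> powr \<gamma>)" by simp
    also have "\<dots> \<le> ?X"
    proof (rule sum_powr_eigenvalues_le[where \<phi> = "\<lambda>(lam, i). (\<phi> lam i, d\<phi> lam i)", OF _ _ _ _ \<gamma>])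
      show "finite I" unfolding I_def using F(1) by auto
      have eig: "eigenfun Vt r par len V (fst q) (\<phi> (fst q) (snd q)) (d\<phi> (fst q) (snd q))" if "q \<in> I" for q
        using that fam(2)[of "fst q"] unfolding I_def is_family_def by auto
      then show "eigenfun Vt r par len V (fst q) (fst (case q of (lam, i) \<Rightarrow> (\<phi> lam i, d\<phi> lam i)))
          (snd (case q of (lam, i) \<Rightarrow> (\<phi> lam i, d\<phi> lam i)))" if "q \<in> I" for q
        using that by (simp add: case_prod_unfold)
      show "fst q < 0" if "q \<in> I" for q using that F(2) unfolding I_def by auto
      fix q q' assume q: "q \<in> I" "q' \<in> I"
      have "(LINT p|T. \<phi> (fst q) (snd q) (fst p) (snd p) * \<phi> (fst q') (snd q') (fst p) (snd p)) = (if q = q' then 1 else 0)"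
      proof (cases "fst q = fst q'")
        case True
        then show ?thesis
          using q fam(2)[of "fst q"] unfolding I_def is_family_def by (auto simp: prod_eq_iff)
      next
        case False
        then show ?thesis using eigenfun_orthogonal[OF eig[OF q(1)] eig[OF q(2)] False] by auto
      qed
      then show "(LINT p|T. fst (case q of (lam, i) \<Rightarrow> (\<phi> lam i, d\<phi> lam i)) (fst p) (snd p)
          * fst (case q' of (lam, i) \<Rightarrow> (\<phi> lam i, d\<phi> lam i)) (fst p) (snd p)) = (if q = q' then 1 else 0)"
        by (simp add: case_prod_unfold)
    qed
    finally show "0 + (\<Sum>lam\<in>F. s lam * ennreal (\<bar>lam\<bar> powr \<gamma>)) \<le> ?X" by simp
  qed
  then show "(\<Sum>lam\<in>F. eig_mult Vt r par len V lam * ennreal (\<bar>lam\<bar> powr \<gamma>)) \<le> ?X" by (simp add: mult)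
qed

end

theorem theorem2p1:
  fixes gamma :: real
  assumes "1/2 \<le> gamma"
  shows "\<exists>L::real. \<forall>Vt r par len (V :: nat \<Rightarrow> real \<Rightarrow> real).
           metric_tree Vt r par len \<and> admissible_potential Vt r par len V \<longrightarrow>
           neg_trace Vt r par len V gamma
             \<le> ennreal L * (\<integral>\<^sup>+ p. ennreal ((max 0 (V (fst p) (snd p))) powr (gamma + 1/2))
                               \<partial>tree_measure Vt r len)"
proof (intro exI allI impI)
  fix Vt r par len and V :: "nat \<Rightarrow> real \<Rightarrow> real"
  assume "metric_tree Vt r par len \<and> admissible_potential Vt r par len V"
  then interpret schroedinger_tree Vt r par len V by unfold_locales auto
  \<comment> \<open>This fixes the witness for \<open>L\<close>: 8 is the square root of 64,
    doubling the potential makes it 16, and 2 powr gamma comes from lifting the exponent.\<close>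
  show "neg_trace Vt r par len V gamma
    \<le> ennreal (16 * 2 powr gamma) * (\<integral>\<^sup>+ p. ennreal ((max 0 (V (fst p) (snd p))) powr (gamma + 1/2)) \<partial>tree_measure Vt r len)"
    by (rule neg_trace_le[OF assms])
qed

end
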